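(* Suppose that $\mathbb{T}\times G^{(0)}\overset{\iota}{\to}E\overset{\pi}{\to}G$ is a topological twist over a Lie groupoid $G$, that $\{(U_\alpha,\varphi_\alpha)\}_{\alpha\in\mathfrak{A}}$ is a smooth atlas of $G$, and that $\{\sigma_\alpha:U_\alpha\to\pi^{-1}(U_\alpha)\}_{\alpha\in\mathfrak{A}}$ is a family of continuous sections of $\pi$ that satisfies conditions (S$^\infty$) and (U$^\infty$). Give $E$ the unique smooth structure with respect to which $\pi:E\to G$ is a smooth principal $\mathbb{T}$-bundle and all the $\sigma_\alpha$ are smooth. Then the following hold. (1) For each $x\in G^{(0)}$ there exist an open neighbourhood $U$ of $x$ in $G$ and a smooth section $\sigma:U\to\pi^{-1}(U)$ of $\pi$ such that $\sigma(y)=\iota(1,y)$ for all $y\in U\cap G^{(0)}$. (2) $E^{(0)}$ is an embedded submanifold of $E$. (3) $\iota:\mathbb{T}\times G^{(0)}\to\pi^{-1}(G^{(0)})$ is a diffeomorphism. (4) The range and source maps $r,s:E\to E^{(0)}$ of $E$ and the projection map $\pi:E\to G$ are submersions.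
   Context: "Manifold" means smooth manifold (Hausdorff, second-countable, with a maximal smooth atlas compatible with the given topology). A submersion is a smooth map with everywhere surjective differential. All groupoids are locally compact Hausdorff topological groupoids with unit space $G^{(0)}\subseteq G$, continuous surjective range and source maps $r,s:G\to G^{(0)}$, and continuous composition and inversion. A Lie groupoid is a topological groupoid such that $G,G^{(0)}$ are manifolds, $G^{(0)}\hookrightarrow G$ is a smooth embedding, $r,s$ are submersions, and composition and inversion are smooth. A topological twist over $G$ consists of a locally compact Hausdorff groupoid $E$ and groupoid homomorphisms $\iota:\mathbb{T}\times G^{(0)}\to E$ ($\mathbb{T}\times G^{(0)}$ the trivial group bundle) and $\pi:E\to G$ such that $\iota$ is a homeomorphism onto $\pi^{-1}(G^{(0)})$ with $\iota(1,\pi(y))=y$ for $y\in E^{(0)}$; $\pi$ is a continuous open surjection; and $\iota(z,\pi(r(e)))e=e\,\iota(z,\pi(s(e)))$ for all $e\in E$, $z\in\mathbb{T}$. $\mathbb{T}$ acts on $E$ by $z\cdot e=\iota(z,r(e))e$ (units of $E$ identified with units of $G$ via $\pi$). That $\pi:E\to G$ is a smooth principal $\mathbb{T}$-bundle means $E,G$ are manifolds, $\pi$ and the $\mathbb{T}$-action are smooth, and $G$ has an open cover by sets $U$ with $\mathbb{T}$-equivariant diffeomorphisms $\pi^{-1}(U)\cong\mathbb{T}\times U$ over $U$. When (S$^\infty$) below holds for sections defined on the chart domains of an atlas of $G$, there is a unique smooth structure on the topological space $E$ for which $\pi$ is a smooth principal $\mathbb{T}$-bundle and all $\sigma_\alpha$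 are smooth; for it, $\pi^{-1}(G^{(0)})$ is an embedded submanifold of $E$. Conditions: - (U$^\infty$): for each $\alpha$ there is a smooth $k_\alpha:U_\alpha\cap G^{(0)}\to\mathbb{T}$ with $\sigma_\alpha(x)=\iota(k_\alpha(x),x)$ for all $x\in U_\alpha\cap G^{(0)}$. - (S$^\infty$): for all $\alpha,\alpha'$, the map $U_\alpha\cap U_{\alpha'}\to\mathbb{T}\times G^{(0)}$, $\gamma\mapsto\iota^{-1}(\sigma_\alpha(\gamma)\sigma_{\alpha'}(\gamma)^{-1})$, is smooth. *)

theory Defs
  imports "HOL-Analysis.Analysis" "HOL-Analysis.Finite_Function_Topology"
begin

section \<open>Smooth functions on open subsets of Euclidean space\<close>

text \<open>
  Euclidean \<open>n\<close>-space, for a natural number \<open>n \<ge> 0\<close>, is realised as the subspace of sequences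
  supported in \<open>{..<n}\<close> of the normed space of finitely supported real sequences. (On each of
  these finite-dimensional subspaces the norm topology is the usual one.) In contrast to
  a type of class \<^class>\<open>euclidean_space\<close>, this includes dimension 0, and dimensions can be added and
  existentially quantified.
\<close>

type_synonym rvec = "nat \<Rightarrow>\<^sub>0 real"

definition coord_space :: "nat \<Rightarrow> rvec set" where
  "coord_space n = {v. Poly_Mapping.keys v \<subseteq> {..<n}}"

definition coord_append :: "nat \<Rightarrow> rvec \<Rightarrow> rvec \<Rightarrow> rvec" where
  "coord_append m u v =
     Abs_poly_mapping (\<lambda>i. if i < m then Poly_Mapping.lookup u i else Poly_Mapping.lookup v (i - m))"

text \<open>
  Below, \<open>U\<close> is a relatively open subset of \<^term>\<open>coord_space n\<close>; for \<open>x \<in> U\<close> the Frechet derivative at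
  \<open>x\<close> within \<^term>\<open>coord_space n\<close> is determined on \<^term>\<open>coord_space n\<close>. A function is of class
  \<open>C\<^sup>k\<^sup>+\<^sup>1\<close> if it is differentiable and all its directional derivatives are of class \<open>C\<^sup>k\<close>.
\<close>

fun Ck_on :: "nat \<Rightarrow> nat \<Rightarrow> rvec set \<Rightarrow> (rvec \<Rightarrow> rvec) \<Rightarrow> bool" where
  "Ck_on 0 n U f \<longleftrightarrow> continuous_on U f"
| "Ck_on (Suc k) n U f \<longleftrightarrow>
     (\<exists>D. (\<forall>x\<in>U. (f has_derivative D x) (at x within coord_space n)) \<and>
          (\<forall>v\<in>coord_space n. Ck_on k n U (\<lambda>x. D x v)))"

definition smooth_on :: "nat \<Rightarrow> rvec set \<Rightarrow> (rvec \<Rightarrow> rvec) \<Rightarrow> bool" where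
  "smooth_on n U f \<longleftrightarrow> (\<forall>k. Ck_on k n U f)"


section \<open>Smooth manifolds\<close>

text \<open>
  A chart is a pair of its domain and its coordinate map; the values of the coordinate map outside
  the domain are irrelevant, and a maximal atlas contains a chart with all its variants outside the
  domain.
\<close>

type_synonym 'a chart = "'a set \<times> ('a \<Rightarrow> rvec)"

definition is_chart :: "'a topology \<Rightarrow> nat \<Rightarrow> 'a chart \<Rightarrow> bool" where
  "is_chart X n c \<longleftrightarrow> (case c of (U, \<phi>) \<Rightarrow>
     openin X U \<and>
     openin (top_of_set (coord_space n)) (\<phi> ` U) \<and>
     homeomorphic_map (subtopology X U) (top_of_set (\<phi> ` U)) \<phi>)"

definition smoothly_compatible :: "nat \<Rightarrow> 'a chart \<Rightarrow> 'a chart \<Rightarrow> bool" where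
  "smoothly_compatible n c d \<longleftrightarrow> (case (c, d) of ((U, \<phi>), (V, \<psi>)) \<Rightarrow>
     smooth_on n (\<phi> ` (U \<inter> V)) (\<psi> \<circ> inv_into U \<phi>) \<and>
     smooth_on n (\<psi> ` (U \<inter> V)) (\<phi> \<circ> inv_into V \<psi>))"

definition smooth_atlas :: "'a topology \<Rightarrow> nat \<Rightarrow> 'a chart set \<Rightarrow> bool" where
  "smooth_atlas X n A \<longleftrightarrow>
     (\<forall>c\<in>A. is_chart X n c) \<and>
     (\<Union>c\<in>A. fst c) = topspace X \<and>
     (\<forall>c\<in>A. \<forall>d\<in>A. smoothly_compatible n c d)"

record 'a manifold =
  mtop :: "'a topology"
  mdim :: nat
  mcharts :: "'a chart set"

abbreviation mspace :: "'a manifold \<Rightarrow> 'a set" where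
  "mspace M \<equiv> topspace (mtop M)"

definition smooth_manifold :: "'a manifold \<Rightarrow> bool" where
  "smooth_manifold M \<longleftrightarrow>
     Hausdorff_space (mtop M) \<and>
     second_countable (mtop M) \<and>
     smooth_atlas (mtop M) (mdim M) (mcharts M) \<and>
     (\<forall>c. is_chart (mtop M) (mdim M) c \<and>
          (\<forall>d\<in>mcharts M. smoothly_compatible (mdim M) c d) \<longrightarrow> c \<in> mcharts M)"

definition manifold_of_atlas :: "'a topology \<Rightarrow> nat \<Rightarrow> 'a chart set \<Rightarrow> 'a manifold" where
  "manifold_of_atlas X n A =
     \<lparr>mtop = X, mdim = n,
      mcharts = {c. is_chart X n c \<and> (\<forall>d\<in>A. smoothly_compatible n c d)}\<rparr>"

definition open_submanifold :: "'a manifold \<Rightarrow> 'a set \<Rightarrow> 'a manifold" where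
  "open_submanifold M W =
     \<lparr>mtop = subtopology (mtop M) W, mdim = mdim M, mcharts = {c \<in> mcharts M. fst c \<subseteq> W}\<rparr>"

definition product_manifold :: "'a manifold \<Rightarrow> 'b manifold \<Rightarrow> ('a \<times> 'b) manifold" where
  "product_manifold M N =
     manifold_of_atlas (prod_topology (mtop M) (mtop N)) (mdim M + mdim N)
       {(U \<times> V, \<lambda>(x, y). coord_append (mdim M) (\<phi> x) (\<psi> y)) | U \<phi> V \<psi>.
          (U, \<phi>) \<in> mcharts M \<and> (V, \<psi>) \<in> mcharts N}"

text \<open>The unit circle, with the angular coordinates on the arcs that omit one point.\<close>

abbreviation circle :: "complex set" where
  "circle \<equiv> sphere 0 1"

definition circle_manifold :: "complex manifold" where
  "circle_manifold =
     manifold_of_atlas (top_of_set circle) 1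
       {(cis ` {a<..<a + 2 * pi}, \<phi>) | a \<phi>.
          \<forall>t\<in>{a<..<a + 2 * pi}. \<phi> (cis t) = Poly_Mapping.single 0 t}"


section \<open>Smooth maps\<close>

definition smooth_map :: "'a manifold \<Rightarrow> 'b manifold \<Rightarrow> ('a \<Rightarrow> 'b) \<Rightarrow> bool" where
  "smooth_map M N f \<longleftrightarrow>
     f ` mspace M \<subseteq> mspace N \<and>
     (\<forall>p\<in>mspace M. \<exists>U \<phi> V \<psi>.
        (U, \<phi>) \<in> mcharts M \<and> p \<in> U \<and> (V, \<psi>) \<in> mcharts N \<and> f ` U \<subseteq> V \<and>
        smooth_on (mdim M) (\<phi> ` U) (\<psi> \<circ> f \<circ> inv_into U \<phi>))"

text \<open>
  \<open>D\<close> is the differential at \<open>p\<close> of a smooth map \<open>f\<close>, when the tangent spaces at \<open>p\<close> and \<open>f p\<close> are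
  identified with \<open>coord_space (mdim M)\<close> and \<open>coord_space (mdim N)\<close> by the given charts
  around \<open>p\<close> and \<open>f p\<close>. Only the restriction of \<open>D\<close> to \<open>coord_space (mdim M)\<close> is meaningful.
\<close>

definition differential_in_charts ::
    "'a manifold \<Rightarrow> ('a \<Rightarrow> 'b) \<Rightarrow> 'a \<Rightarrow> 'a chart \<Rightarrow> 'b chart \<Rightarrow> (rvec \<Rightarrow> rvec) \<Rightarrow> bool" where
  "differential_in_charts M f p c d D \<longleftrightarrow> (case (c, d) of ((U, \<phi>), (V, \<psi>)) \<Rightarrow>
     ((\<psi> \<circ> f \<circ> inv_into U \<phi>) has_derivative D) (at (\<phi> p) within coord_space (mdim M)))"

definition submersion :: "'a manifold \<Rightarrow> 'b manifold \<Rightarrow> ('a \<Rightarrow> 'b) \<Rightarrow> bool" where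
  "submersion M N f \<longleftrightarrow>
     smooth_map M N f \<and>
     (\<forall>p\<in>mspace M. \<forall>c\<in>mcharts M. \<forall>d\<in>mcharts N. p \<in> fst c \<and> f p \<in> fst d \<longrightarrow>
        (\<exists>D. differential_in_charts M f p c d D \<and>
             D ` coord_space (mdim M) = coord_space (mdim N)))"

definition immersion :: "'a manifold \<Rightarrow> 'b manifold \<Rightarrow> ('a \<Rightarrow> 'b) \<Rightarrow> bool" where
  "immersion M N f \<longleftrightarrow>
     smooth_map M N f \<and>
     (\<forall>p\<in>mspace M. \<forall>c\<in>mcharts M. \<forall>d\<in>mcharts N. p \<in> fst c \<and> f p \<in> fst d \<longrightarrow>
        (\<exists>D. differential_in_charts M f p c d D \<and> inj_on D (coord_space (mdim M))))"

definition smooth_embedding :: "'a manifold \<Rightarrow> 'b manifold \<Rightarrow> ('a \<Rightarrow> 'b) \<Rightarrow> bool" where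
  "smooth_embedding M N f \<longleftrightarrow> immersion M N f \<and> embedding_map (mtop M) (mtop N) f"

definition diffeomorphism :: "'a manifold \<Rightarrow> 'b manifold \<Rightarrow> ('a \<Rightarrow> 'b) \<Rightarrow> bool" where
  "diffeomorphism M N f \<longleftrightarrow>
     bij_betw f (mspace M) (mspace N) \<and>
     smooth_map M N f \<and> smooth_map N M (inv_into (mspace M) f)"

definition embedded_structure :: "'a manifold \<Rightarrow> 'a set \<Rightarrow> 'a manifold \<Rightarrow> bool" where
  "embedded_structure M S N \<longleftrightarrow>
     smooth_manifold N \<and> mspace N = S \<and> smooth_embedding N M (\<lambda>x. x)"

definition embedded_submanifold :: "'a manifold \<Rightarrow> 'a set \<Rightarrow> bool" where
  "embedded_submanifold M S \<longleftrightarrow> (\<exists>N. embedded_structure M S N)"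


section \<open>Topological groupoids and Lie groupoids\<close>

record 'a groupoid =
  gtop :: "'a topology"
  gcomp :: "'a \<Rightarrow> 'a \<Rightarrow> 'a"
  ginv :: "'a \<Rightarrow> 'a"
  grange :: "'a \<Rightarrow> 'a"
  gsource :: "'a \<Rightarrow> 'a"

abbreviation arrows :: "'a groupoid \<Rightarrow> 'a set" where
  "arrows G \<equiv> topspace (gtop G)"

definition units :: "'a groupoid \<Rightarrow> 'a set" where
  "units G = grange G ` arrows G"

definition composable :: "'a groupoid \<Rightarrow> ('a \<times> 'a) set" where
  "composable G = {(x, y). x \<in> arrows G \<and> y \<in> arrows G \<and> gsource G x = grange G y}"

definition algebraic_groupoid :: "'a groupoid \<Rightarrow> bool" where
  "algebraic_groupoid G \<longleftrightarrow>
     (\<forall>x\<in>arrows G.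
        grange G x \<in> arrows G \<and> gsource G x \<in> arrows G \<and> ginv G x \<in> arrows G \<and>
        grange G (grange G x) = grange G x \<and> gsource G (grange G x) = grange G x \<and>
        grange G (gsource G x) = gsource G x \<and> gsource G (gsource G x) = gsource G x \<and>
        gcomp G (grange G x) x = x \<and> gcomp G x (gsource G x) = x \<and>
        grange G (ginv G x) = gsource G x \<and> gsource G (ginv G x) = grange G x \<and>
        gcomp G x (ginv G x) = grange G x \<and> gcomp G (ginv G x) x = gsource G x) \<and>
     (\<forall>(x, y)\<in>composable G.
        gcomp G x y \<in> arrows G \<and>
        grange G (gcomp G x y) = grange G x \<and> gsource G (gcomp G x y) = gsource G y) \<and>
     (\<forall>x y z. (x, y) \<in> composable G \<and> (y, z) \<in> composable G \<longrightarrow>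
        gcomp G (gcomp G x y) z = gcomp G x (gcomp G y z))"

definition topological_groupoid :: "'a groupoid \<Rightarrow> bool" where
  "topological_groupoid G \<longleftrightarrow>
     algebraic_groupoid G \<and>
     locally_compact_space (gtop G) \<and> Hausdorff_space (gtop G) \<and>
     continuous_map (gtop G) (subtopology (gtop G) (units G)) (grange G) \<and>
     continuous_map (gtop G) (subtopology (gtop G) (units G)) (gsource G) \<and>
     continuous_map (subtopology (prod_topology (gtop G) (gtop G)) (composable G)) (gtop G)
       (\<lambda>(x, y). gcomp G x y) \<and>
     continuous_map (gtop G) (gtop G) (ginv G)"

definition groupoid_hom :: "'a groupoid \<Rightarrow> 'b groupoid \<Rightarrow> ('a \<Rightarrow> 'b) \<Rightarrow> bool" where
  "groupoid_hom G H f \<longleftrightarrow>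
     f ` arrows G \<subseteq> arrows H \<and>
     (\<forall>(x, y)\<in>composable G.
        (f x, f y) \<in> composable H \<and> f (gcomp G x y) = gcomp H (f x) (f y))"

text \<open>\<open>M\<close> and \<open>M\<^sub>0\<close> are the smooth structures on the arrow space and on the unit space.\<close>

definition lie_groupoid :: "'a groupoid \<Rightarrow> 'a manifold \<Rightarrow> 'a manifold \<Rightarrow> bool" where
  "lie_groupoid G M M\<^sub>0 \<longleftrightarrow>
     topological_groupoid G \<and>
     smooth_manifold M \<and> mtop M = gtop G \<and>
     embedded_structure M (units G) M\<^sub>0 \<and>
     submersion M M\<^sub>0 (grange G) \<and> submersion M M\<^sub>0 (gsource G) \<and>
     (\<exists>N. embedded_structure (product_manifold M M) (composable G) N \<and>
          smooth_map N M (\<lambda>(x, y). gcomp G x y)) \<and>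
     smooth_map M M (ginv G)"


section \<open>Twists\<close>

definition trivial_circle_bundle :: "'a groupoid \<Rightarrow> (complex \<times> 'a) groupoid" where
  "trivial_circle_bundle G =
     \<lparr>gtop = prod_topology (top_of_set circle) (subtopology (gtop G) (units G)),
      gcomp = (\<lambda>(z, x) (w, y). (z * w, x)),
      ginv = (\<lambda>(z, x). (inverse z, x)),
      grange = (\<lambda>(z, x). (1, x)),
      gsource = (\<lambda>(z, x). (1, x))\<rparr>"

definition preim :: "'e groupoid \<Rightarrow> ('e \<Rightarrow> 'g) \<Rightarrow> 'g set \<Rightarrow> 'e set" where
  "preim E \<pi> U = {e \<in> arrows E. \<pi> e \<in> U}"

definition topological_twist ::
    "'g groupoid \<Rightarrow> 'e groupoid \<Rightarrow> (complex \<times> 'g \<Rightarrow> 'e) \<Rightarrow> ('e \<Rightarrow> 'g) \<Rightarrow> bool" where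
  "topological_twist G E \<iota> \<pi> \<longleftrightarrow>
     topological_groupoid E \<and>
     groupoid_hom (trivial_circle_bundle G) E \<iota> \<and>
     groupoid_hom E G \<pi> \<and>
     homeomorphic_map (gtop (trivial_circle_bundle G))
       (subtopology (gtop E) (preim E \<pi> (units G))) \<iota> \<and>
     (\<forall>y\<in>units E. \<iota> (1, \<pi> y) = y) \<and>
     continuous_map (gtop E) (gtop G) \<pi> \<and> open_map (gtop E) (gtop G) \<pi> \<and>
     \<pi> ` arrows E = arrows G \<and>
     (\<forall>e\<in>arrows E. \<forall>z\<in>circle.
        gcomp E (\<iota> (z, \<pi> (grange E e))) e = gcomp E e (\<iota> (z, \<pi> (gsource E e))))"

definition twist_action ::
    "'e groupoid \<Rightarrow> (complex \<times> 'g \<Rightarrow> 'e) \<Rightarrow> ('e \<Rightarrow> 'g) \<Rightarrow> complex \<Rightarrow> 'e \<Rightarrow> 'e" where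
  "twist_action E \<iota> \<pi> z e = gcomp E (\<iota> (z, \<pi> (grange E e))) e"

definition smooth_principal_circle_bundle ::
    "'e manifold \<Rightarrow> 'g manifold \<Rightarrow> ('e \<Rightarrow> 'g) \<Rightarrow> (complex \<Rightarrow> 'e \<Rightarrow> 'e) \<Rightarrow> bool" where
  "smooth_principal_circle_bundle P M \<pi> act \<longleftrightarrow>
     smooth_manifold P \<and> smooth_manifold M \<and>
     smooth_map P M \<pi> \<and>
     smooth_map (product_manifold circle_manifold P) P (\<lambda>(z, e). act z e) \<and>
     (\<forall>p\<in>mspace M. \<exists>U \<Phi>. openin (mtop M) U \<and> p \<in> U \<and>
        diffeomorphism (open_submanifold P {e \<in> mspace P. \<pi> e \<in> U})
          (product_manifold circle_manifold (open_submanifold M U)) \<Phi> \<and>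
        (\<forall>e\<in>mspace P. \<pi> e \<in> U \<longrightarrow> snd (\<Phi> e) = \<pi> e \<and>
           (\<forall>z\<in>circle. \<Phi> (act z e) = (z * fst (\<Phi> e), \<pi> e))))"

definition continuous_section ::
    "'g groupoid \<Rightarrow> 'e groupoid \<Rightarrow> ('e \<Rightarrow> 'g) \<Rightarrow> 'g set \<Rightarrow> ('g \<Rightarrow> 'e) \<Rightarrow> bool" where
  "continuous_section G E \<pi> U \<sigma> \<longleftrightarrow>
     continuous_map (subtopology (gtop G) U) (subtopology (gtop E) (preim E \<pi> U)) \<sigma> \<and>
     (\<forall>\<gamma>\<in>U. \<pi> (\<sigma> \<gamma>) = \<gamma>)"

definition smooth_section ::
    "'g manifold \<Rightarrow> 'e manifold \<Rightarrow> ('e \<Rightarrow> 'g) \<Rightarrow> 'g set \<Rightarrow> ('g \<Rightarrow> 'e) \<Rightarrow> bool" where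
  "smooth_section M P \<pi> U \<sigma> \<longleftrightarrow>
     smooth_map (open_submanifold M U) (open_submanifold P {e \<in> mspace P. \<pi> e \<in> U}) \<sigma> \<and>
     (\<forall>\<gamma>\<in>U. \<pi> (\<sigma> \<gamma>) = \<gamma>)"

definition cond_U :: "'g groupoid \<Rightarrow> 'g manifold \<Rightarrow> (complex \<times> 'g \<Rightarrow> 'e) \<Rightarrow>
    'i set \<Rightarrow> ('i \<Rightarrow> 'g set) \<Rightarrow> ('i \<Rightarrow> 'g \<Rightarrow> 'e) \<Rightarrow> bool" where
  "cond_U G M\<^sub>0 \<iota> I U \<sigma> \<longleftrightarrow>
     (\<forall>\<alpha>\<in>I. \<exists>k.
        smooth_map (open_submanifold M\<^sub>0 (U \<alpha> \<inter> units G)) circle_manifold k \<and>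
        (\<forall>x\<in>U \<alpha> \<inter> units G. \<sigma> \<alpha> x = \<iota> (k x, x)))"

definition cond_S :: "'g groupoid \<Rightarrow> 'g manifold \<Rightarrow> 'g manifold \<Rightarrow> 'e groupoid \<Rightarrow>
    (complex \<times> 'g \<Rightarrow> 'e) \<Rightarrow> 'i set \<Rightarrow> ('i \<Rightarrow> 'g set) \<Rightarrow> ('i \<Rightarrow> 'g \<Rightarrow> 'e) \<Rightarrow> bool" where
  "cond_S G M M\<^sub>0 E \<iota> I U \<sigma> \<longleftrightarrow>
     (\<forall>\<alpha>\<in>I. \<forall>\<beta>\<in>I.
        smooth_map (open_submanifold M (U \<alpha> \<inter> U \<beta>)) (product_manifold circle_manifold M\<^sub>0)
          (\<lambda>\<gamma>. inv_into (circle \<times> units G) \<iota> (gcomp E (\<sigma> \<alpha> \<gamma>) (ginv E (\<sigma> \<beta> \<gamma>)))))"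

end

theory Submission
  imports Defs
begin

text \<open>
  The whole statement follows from one kind of local section. Near a unit \<open>x\<close>, the section \<open>\<sigma>\<^sub>\<alpha>\<close> takes the
  value \<open>\<iota>(k\<^sub>\<alpha>(y), y)\<close> at every unit \<open>y\<close>; since \<open>r\<close> is smooth and fixes the units,
  \<open>\<tau>(\<gamma>) = k\<^sub>\<alpha>(r(\<gamma>))\<inverse> \<cdot> \<sigma>\<^sub>\<alpha>(\<gamma>)\<close> is a smooth section with \<open>\<tau>(y) = \<iota>(1, y)\<close> (\<open>normalised_section\<close>).
  Hence \<open>y \<mapsto> \<iota>(1, y)\<close> is smooth on the unit space, and so is \<open>\<iota>(z, y) = z \<cdot> \<iota>(1, y)\<close>.

  Both maps have smooth left inverses defined near their images: \<open>r \<circ> \<pi>\<close> for the first one, and for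
  \<open>\<iota>\<close> the pair of \<open>r \<circ> \<pi>\<close> with the circle coordinate of a trivialisation, corrected by \<open>\<tau>\<close>. A smooth map
  \<open>j\<close> with such local retractions is an embedding, so that its image is an embedded submanifold, and it is
  a diffeomorphism onto the image with any embedded structure
  (\<open>embedded_submanifold_if_local_retractions\<close>, \<open>diffeomorphism_onto_embedded\<close>). The only direction
  that does not follow formally is that \<open>j\<close> is smooth into the image: this is the universal property of
  embedded submanifolds (\<open>smooth_at_into_embedded\<close>). It is proved without the inverse function theorem:
  the derivative of a continuous lift through an immersion solves a system of linear equations, and
  solutions of such systems are as smooth as their coefficients (\<open>Ck_linear_system_solution\<close>,
  \<open>smooth_on_lift\<close>).

  Finally \<open>\<pi>\<close> is a submersion because the slices of a trivialisation are smooth sections through every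
  point, and the range map of \<open>E\<close> is \<open>e \<mapsto> \<iota>(1, r(\<pi>(e)))\<close>, a composite of the submersions \<open>\<pi>\<close> and \<open>r\<close> with the
  diffeomorphism \<open>y \<mapsto> \<iota>(1, y)\<close> from the units of \<open>G\<close> to those of \<open>E\<close>; likewise for the source map.
\<close>

section \<open>The coordinate spaces\<close>

abbreviation coord :: "rvec \<Rightarrow> nat \<Rightarrow> real" where
  "coord \<equiv> Poly_Mapping.lookup"

lemma lookup_scaleR [simp]: "coord (r *\<^sub>R v) i = r *\<^sub>R coord v i"
proof -
  have "finite {i. r *\<^sub>R coord v i \<noteq> 0}"
    by (rule finite_subset[OF _ finite_keys[of v]]) (auto simp: in_keys_iff)
  then show ?thesis by (simp add: scaleR_poly_mapping_def)
qed

lemma abs_lookup_le_norm: "\<bar>coord v i\<bar> \<le> norm (v::rvec)"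
proof -
  have "norm v = (\<Sum>n\<in>Poly_Mapping.keys v. \<bar>coord v n\<bar>)"
    by (simp add: norm_poly_mapping_def dist_poly_mapping_def)
  moreover have "\<bar>coord v i\<bar> \<le> (\<Sum>n\<in>Poly_Mapping.keys v. \<bar>coord v n\<bar>)"
  proof (cases "i \<in> Poly_Mapping.keys v")
    case True
    then show ?thesis by (intro member_le_sum) auto
  next
    case False
    then show ?thesis by (simp add: in_keys_iff sum_nonneg)
  qed
  ultimately show ?thesis by simp
qed

lemma bounded_linear_lookup: "bounded_linear (\<lambda>v::rvec. coord v i)"
  by (rule bounded_linear_intro[where K = 1]) (simp_all add: lookup_add abs_lookup_le_norm)

abbreviation unit_vec :: "nat \<Rightarrow> rvec" where
  "unit_vec i \<equiv> Poly_Mapping.single i 1"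

lemma coord_space_iff: "v \<in> coord_space n \<longleftrightarrow> (\<forall>i\<ge>n. coord v i = 0)"
  unfolding coord_space_def by (auto simp: in_keys_iff subset_iff) (meson not_less)

lemma subspace_coord_space: "subspace (coord_space n)"
  by (auto simp: subspace_def coord_space_iff lookup_add)

lemma unit_vec_in_coord_space: "i < n \<Longrightarrow> unit_vec i \<in> coord_space n"
  by (auto simp: coord_space_iff lookup_single when_def)

lemma coord_space_expand:
  assumes "v \<in> coord_space n"
  shows "v = (\<Sum>i<n. coord v i *\<^sub>R unit_vec i)"
  by (rule poly_mapping_eqI)
     (use assms in \<open>auto simp: coord_space_iff lookup_sum lookup_single when_def
        if_distrib[of "\<lambda>t. _ * t"] cong: if_cong\<close>)

lemma linear_coord_expand:
  assumes "linear A" "v \<in> coord_space n"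
  shows "A v = (\<Sum>i<n. coord v i *\<^sub>R A (unit_vec i))"
  by (subst coord_space_expand[OF assms(2)])
     (simp add: linear_sum[OF assms(1)] linear_scale[OF assms(1)])

lemma linear_injective_on_coord_space_left_inverse:
  assumes A: "linear A" "inj_on A (coord_space n)" "A ` coord_space n \<subseteq> coord_space m"
  obtains L :: "rvec \<Rightarrow> rvec" where "bounded_linear L" "\<And>v. v \<in> coord_space n \<Longrightarrow> L (A v) = v"
proof -
  obtain g where g: "linear g" "\<And>v. v \<in> coord_space n \<Longrightarrow> g (A v) = v"
    using linear_exists_left_inverse_on[OF A(1) subspace_coord_space A(2)] by blast
  \<comment> \<open>A linear map on the infinite-dimensional ambient space need not be bounded, so
    \<^term>\<open>g\<close> is first composed with the projection to the first \<^term>\<open>m\<close> coordinates.\<close>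
  define L where "L w = (\<Sum>i<m. coord w i *\<^sub>R g (unit_vec i))" for w
  have "bounded_linear L"
    unfolding L_def
    by (intro bounded_linear_sum bounded_linear_scaleR_const bounded_linear_lookup)
  moreover have "L (A v) = v" if "v \<in> coord_space n" for v
    using that linear_coord_expand[OF g(1), of "A v" m] A(3) g(2)[OF that] by (auto simp: L_def)
  ultimately show thesis using that by blast
qed

text \<open>
  Restricting to the lines through \<open>x\<close> in the coordinate space reduces this to functions of one real
  variable.
\<close>

lemma has_derivative_coord_space_unique:
  assumes D: "(f has_derivative D) (at x within coord_space n)"
    and D': "(f has_derivative D') (at x within coord_space n)"
    and x: "x \<in> coord_space n" and v: "v \<in> coord_space n"
  shows "D v = D' v"
proof -
  define l where "l t = x + t *\<^sub>R v" for t :: real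
  have l: "(l has_derivative (\<lambda>t. t *\<^sub>R v)) (at 0 within UNIV)"
    unfolding l_def by (auto intro!: derivative_eq_intros)
  have lim: "range l \<subseteq> coord_space n"
    using x v subspace_coord_space[of n] by (auto simp: l_def subspace_add subspace_scale)
  have "((\<lambda>t. f (l t)) has_derivative (\<lambda>t. F (t *\<^sub>R v))) (at 0)"
    if "(f has_derivative F) (at x within coord_space n)" for F
    using has_derivative_in_compose[OF l, of f F] has_derivative_subset[OF that lim] by (simp add: l_def)
  from has_derivative_unique[OF this[OF D] this[OF D']]
  show ?thesis by (auto dest: fun_cong[of _ _ 1])
qed

text \<open>
  The coordinates of \<open>f\<close> from the \<open>m\<close>-th on vanish near \<open>x\<close>, hence so do those of its derivative.
\<close>

lemma derivative_in_coord_space: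
  assumes D: "(f has_derivative D) (at x within coord_space n)"
    and f: "\<forall>\<^sub>F y in at x within coord_space n. f y \<in> coord_space m" "f x \<in> coord_space m"
    and x: "x \<in> coord_space n" and v: "v \<in> coord_space n"
  shows "D v \<in> coord_space m"
  unfolding coord_space_iff
proof (intro allI impI)
  fix i assume i: "m \<le> i"
  have "((\<lambda>y. coord (f y) i) has_derivative (\<lambda>h. coord (D h) i))
      (at x within coord_space n)"
    by (rule bounded_linear.has_derivative[OF bounded_linear_lookup D])
  moreover have "((\<lambda>y. coord (f y) i) has_derivative (\<lambda>h. 0)) (at x within coord_space n)"
  proof (rule has_derivative_transform_eventually[OF has_derivative_const[of 0]])
    show "\<forall>\<^sub>F y in at x within coord_space n. 0 = coord (f y) i"
      using f(1) by eventually_elim (use i in \<open>auto simp: coord_space_iff\<close>)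
  qed (use f(2) i x in \<open>auto simp: coord_space_iff\<close>)
  ultimately show "coord (D v) i = 0"
    using has_derivative_coord_space_unique[of _ _ _ n] x v by blast
qed

section \<open>Functions of class \<open>C\<^sup>k\<close>\<close>

abbreviation open_in_coords :: "nat \<Rightarrow> rvec set \<Rightarrow> bool" where
  "open_in_coords n U \<equiv> openin (top_of_set (coord_space n)) U"

text \<open>
  Allowing values in any normed space puts scalar coefficients and coordinates on the same footing as
  vector-valued maps.
\<close>

fun Ck :: "nat \<Rightarrow> nat \<Rightarrow> rvec set \<Rightarrow> (rvec \<Rightarrow> 'b::real_normed_vector) \<Rightarrow> bool" where
  "Ck 0 n U f \<longleftrightarrow> continuous_on U f"
| "Ck (Suc k) n U f \<longleftrightarrow>
     (\<exists>D. (\<forall>x\<in>U. (f has_derivative D x) (at x within coord_space n)) \<and>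
          (\<forall>v\<in>coord_space n. Ck k n U (\<lambda>x. D x v)))"

lemma Ck_on_eq_Ck: "Ck_on k n U f = Ck k n U f"
  by (induction k arbitrary: f) auto

lemma Ck_SucI:
  assumes "\<And>x. x \<in> U \<Longrightarrow> (f has_derivative D x) (at x within coord_space n)"
    and "\<And>v. v \<in> coord_space n \<Longrightarrow> Ck k n U (\<lambda>x. D x v)"
  shows "Ck (Suc k) n U f"
  using assms by auto

lemma Ck_subset: "Ck k n U f \<Longrightarrow> V \<subseteq> U \<Longrightarrow> Ck k n V f"
proof (induction k arbitrary: f)
  case 0
  then show ?case by (auto intro: continuous_on_subset)
next
  case (Suc k)
  then obtain D where D: "\<forall>x\<in>U. (f has_derivative D x) (at x within coord_space n)"
    "\<forall>v\<in>coord_space n. Ck k n U (\<lambda>x. D x v)" by auto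
  show ?case by (rule Ck_SucI[where D = D]) (use D Suc.IH Suc.prems(2) in blast)+
qed

lemma open_in_coords_subset: "open_in_coords n U \<Longrightarrow> U \<subseteq> coord_space n"
  by (simp add: openin_subset[where U = "top_of_set (coord_space n)", simplified])

lemma at_within_coords:
  assumes "open_in_coords n U" "x \<in> U"
  shows "at x within U = at x within coord_space n"
proof -
  obtain T where T: "open T" "U = coord_space n \<inter> T" using assms(1) by (auto simp: openin_open)
  then show ?thesis
    using assms(2) by (intro at_within_nhd[where S = T]) auto
qed

lemma Ck_cong:
  assumes U: "open_in_coords n U" and eq: "\<And>x. x \<in> U \<Longrightarrow> f x = g x" and f: "Ck k n U f"
  shows "Ck k n U g"
proof (cases k)
  case 0
  then show ?thesis using f eq by (simp cong: continuous_on_cong)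
next
  case (Suc j)
  with f obtain D where D: "\<forall>x\<in>U. (f has_derivative D x) (at x within coord_space n)"
    and C: "\<forall>v\<in>coord_space n. Ck j n U (\<lambda>x. D x v)" by auto
  have "(g has_derivative D x) (at x within coord_space n)" if x: "x \<in> U" for x
    using has_derivative_transform[OF x, of g f] D eq at_within_coords[OF U x] x by fastforce
  with C Suc show ?thesis by auto
qed

lemma Ck_Suc_imp_Ck:
  assumes U: "U \<subseteq> coord_space n" and f: "Ck (Suc k) n U f"
  shows "Ck k n U f"
  using f
proof (induction k arbitrary: f)
  case 0
  have "continuous (at x within U) f" if x: "x \<in> U" for x
  proof -
    obtain D where "(f has_derivative D) (at x within coord_space n)" using 0 x by auto
    from has_derivative_continuous[OF this] U show ?thesis by (rule continuous_within_subset)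
  qed
  then show ?case by (simp add: continuous_on_eq_continuous_within)
next
  case (Suc k)
  then show ?case by (subst (asm) Ck.simps(2)) auto
qed

lemma Ck_imp_continuous_on: "U \<subseteq> coord_space n \<Longrightarrow> Ck k n U f \<Longrightarrow> continuous_on U f"
  by (induction k) (auto dest: Ck_Suc_imp_Ck simp del: Ck.simps(2))

text \<open>Derivatives at interior points are unique on the coordinate space, so being of class \<open>C\<^sup>k\<close> is
  a local property although the derivative is quantified globally.\<close>

lemma Ck_derivative:
  assumes U: "open_in_coords n U" and f: "Ck (Suc k) n U f"
    and D: "\<And>x. x \<in> U \<Longrightarrow> (f has_derivative D x) (at x within coord_space n)"
    and v: "v \<in> coord_space n"
  shows "Ck k n U (\<lambda>x. D x v)"
proof -
  from f obtain D' where D': "\<forall>x\<in>U. (f has_derivative D' x) (at x within coord_space n)"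
    and C: "\<forall>v\<in>coord_space n. Ck k n U (\<lambda>x. D' x v)" by auto
  show ?thesis
    by (rule Ck_cong[OF U _ C[rule_format, OF v]])
       (use has_derivative_coord_space_unique[OF D'[rule_format] D] open_in_coords_subset[OF U] v in blast)
qed

lemma Ck_local:
  assumes U: "open_in_coords n U"
    and loc: "\<And>x. x \<in> U \<Longrightarrow> \<exists>V. open_in_coords n V \<and> x \<in> V \<and> Ck k n V f"
  shows "Ck k n U f"
  using loc
proof (induction k arbitrary: f)
  case 0
  show ?case
    unfolding Ck.simps continuous_on_eq_continuous_within
  proof
    fix x assume x: "x \<in> U"
    with 0 obtain V where V: "open_in_coords n V" "x \<in> V" "continuous_on V f" by auto
    then show "continuous (at x within U) f"
      by (metis U at_within_coords continuous_on_eq_continuous_within x)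
  qed
next
  case (Suc k)
  have "\<exists>D. (f has_derivative D) (at x within coord_space n)" if "x \<in> U" for x
    using Suc.prems[OF that] by auto
  then obtain D where D: "\<And>x. x \<in> U \<Longrightarrow> (f has_derivative D x) (at x within coord_space n)"
    by metis
  have "Ck k n U (\<lambda>x. D x v)" if v: "v \<in> coord_space n" for v
  proof (rule Suc.IH)
    fix x assume x: "x \<in> U"
    with Suc.prems obtain V where V: "open_in_coords n V" "x \<in> V" "Ck (Suc k) n V f" by blast
    have "Ck k n (U \<inter> V) (\<lambda>x. D x v)"
      by (rule Ck_derivative[OF openin_Int[OF U V(1)] Ck_subset[OF V(3)] _ v]) (auto intro: D)
    then show "\<exists>V. open_in_coords n V \<and> x \<in> V \<and> Ck k n V (\<lambda>x. D x v)"
      using openin_Int[OF U V(1)] x V(2) by blast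
  qed
  with D show ?case by (intro Ck_SucI)
qed

lemma Ck_const: "Ck k n U (\<lambda>x. c)"
proof (induction k arbitrary: c)
  case (Suc k)
  show ?case by (rule Ck_SucI[where D = "\<lambda>_ _. 0"]) (auto intro: Suc.IH)
qed auto

lemma Ck_bounded_linear:
  assumes "bounded_linear L" "Ck k n U f"
  shows "Ck k n U (\<lambda>x. L (f x))"
  using assms(2)
proof (induction k arbitrary: f)
  case 0
  then show ?case using bounded_linear.continuous_on[OF assms(1)] by auto
next
  case (Suc k)
  then obtain D where D: "\<forall>x\<in>U. (f has_derivative D x) (at x within coord_space n)"
    "\<forall>v\<in>coord_space n. Ck k n U (\<lambda>x. D x v)" by auto
  show ?case
    by (rule Ck_SucI[where D = "\<lambda>x v. L (D x v)"])
       (use D Suc.IH bounded_linear.has_derivative[OF assms(1)] in blast)+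
qed

lemma Ck_linear: "bounded_linear L \<Longrightarrow> Ck k n U L"
proof (cases k)
  case 0
  assume "bounded_linear L"
  then show ?thesis using 0 by (simp add: linear_continuous_on)
next
  case (Suc j)
  assume L: "bounded_linear L"
  show ?thesis
    unfolding Suc
    by (rule Ck_SucI[where D = "\<lambda>_. L"])
       (auto intro: Ck_const bounded_linear_imp_has_derivative L)
qed

lemma Ck_add:
  assumes "Ck k n U f" "Ck k n U g"
  shows "Ck k n U (\<lambda>x. f x + g x)"
  using assms
proof (induction k arbitrary: f g)
  case 0
  then show ?case by (auto intro: continuous_on_add)
next
  case (Suc k)
  then obtain D D' where D: "\<forall>x\<in>U. (f has_derivative D x) (at x within coord_space n)"
    "\<forall>v\<in>coord_space n. Ck k n U (\<lambda>x. D x v)"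
    "\<forall>x\<in>U. (g has_derivative D' x) (at x within coord_space n)"
    "\<forall>v\<in>coord_space n. Ck k n U (\<lambda>x. D' x v)" by auto
  show ?case
    by (rule Ck_SucI[where D = "\<lambda>x v. D x v + D' x v"])
       (use D Suc.IH has_derivative_add in auto)
qed

lemma Ck_sum: "(\<And>i. i \<in> S \<Longrightarrow> Ck k n U (f i)) \<Longrightarrow> Ck k n U (\<lambda>x. \<Sum>i\<in>S. f i x)"
  by (induction S rule: infinite_finite_induct) (auto intro: Ck_const Ck_add)

lemma Ck_diff:
  assumes "Ck k n U f" "Ck k n U g"
  shows "Ck k n U (\<lambda>x. f x - g x)"
  using Ck_add[OF assms(1) Ck_bounded_linear[OF bounded_linear_minus[OF bounded_linear_ident] assms(2)]]
  by simp

lemma Ck_scaleR: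
  assumes U: "U \<subseteq> coord_space n" and "Ck k n U c" "Ck k n U f"
  shows "Ck k n U (\<lambda>x. c x *\<^sub>R f x)"
  using assms(2,3)
proof (induction k arbitrary: c f)
  case 0
  then show ?case by (auto intro: continuous_on_scaleR)
next
  case (Suc k)
  note low = Suc.prems[THEN Ck_Suc_imp_Ck[OF U]]
  obtain D D' where D: "\<forall>x\<in>U. (c has_derivative D x) (at x within coord_space n)"
    "\<forall>v\<in>coord_space n. Ck k n U (\<lambda>x. D x v)"
    "\<forall>x\<in>U. (f has_derivative D' x) (at x within coord_space n)"
    "\<forall>v\<in>coord_space n. Ck k n U (\<lambda>x. D' x v)" using Suc.prems by auto
  show ?case
    by (rule Ck_SucI[where D = "\<lambda>x v. c x *\<^sub>R D' x v + D x v *\<^sub>R f x"])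
       (use D low in \<open>auto intro!: Ck_add Suc.IH has_derivative_scaleR\<close>)
qed

text \<open>
  The derivative \<open>Dg(f(x))(Df(x) v)\<close> involves two maps that depend on \<open>x\<close>. Expanding \<open>Df(x) v\<close> in coordinates
  turns it into a sum of products of a scalar and a vector function, to which the induction hypothesis
  applies.
\<close>

lemma Ck_compose:
  assumes U: "open_in_coords n U" and V: "open_in_coords m V" and fV: "f ` U \<subseteq> V"
    and f: "Ck k n U f" and g: "Ck k m V g"
  shows "Ck k n U (\<lambda>x. g (f x))"
  using f g
proof (induction k arbitrary: g)
  case 0
  then show ?case using fV by (auto intro: continuous_on_compose2)
next
  case (Suc k)
  note Usub = open_in_coords_subset[OF U] and Vsub = open_in_coords_subset[OF V]
  obtain D D' where D: "\<And>x. x \<in> U \<Longrightarrow> (f has_derivative D x) (at x within coord_space n)"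
    "\<And>v. v \<in> coord_space n \<Longrightarrow> Ck k n U (\<lambda>x. D x v)"
    and D': "\<And>y. y \<in> V \<Longrightarrow> (g has_derivative D' y) (at y within coord_space m)"
    "\<And>w. w \<in> coord_space m \<Longrightarrow> Ck k m V (\<lambda>y. D' y w)"
    using Suc.prems unfolding Ck.simps by metis
  have Dm: "D x v \<in> coord_space m" if "x \<in> U" "v \<in> coord_space n" for x v
  proof (rule derivative_in_coord_space[OF D(1)])
    show "\<forall>\<^sub>F y in at x within coord_space n. f y \<in> coord_space m"
      unfolding at_within_coords[OF U that(1), symmetric]
      using fV Vsub by (auto simp: eventually_at_filter intro!: always_eventually)
  qed (use that fV Usub Vsub in auto)
  have *: "D' (f x) (D x v) = (\<Sum>i<m. coord (D x v) i *\<^sub>R D' (f x) (unit_vec i))"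
    if "x \<in> U" "v \<in> coord_space n" for x v
    by (rule linear_coord_expand[OF _ Dm[OF that]])
       (use D'(1) that fV in \<open>auto intro: has_derivative_linear\<close>)
  show ?case
  proof (rule Ck_SucI[where D = "\<lambda>x v. D' (f x) (D x v)"])
    fix x assume x: "x \<in> U"
    have "(f has_derivative D x) (at x within U)"
      using D(1)[OF x] at_within_coords[OF U x] by simp
    moreover have "(g has_derivative D' (f x)) (at (f x) within f ` U)"
      using D'(1)[of "f x"] x fV Vsub by (blast intro: has_derivative_subset)
    ultimately show "((\<lambda>x. g (f x)) has_derivative (\<lambda>v. D' (f x) (D x v))) (at x within coord_space n)"
      using has_derivative_in_compose at_within_coords[OF U x] by metis
  next
    fix v assume v: "v \<in> coord_space n"
    show "Ck k n U (\<lambda>x. D' (f x) (D x v))"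
      by (rule Ck_cong[OF U *[OF _ v, symmetric]], assumption)
         (intro Ck_sum Ck_scaleR[OF Usub] Ck_bounded_linear[OF bounded_linear_lookup] D(2)[OF v]
           Suc.IH[OF Ck_Suc_imp_Ck[OF Usub Suc.prems(1)] D'(2)], auto intro: unit_vec_in_coord_space)
  qed
qed

section \<open>Linear systems with smooth coefficients\<close>

text \<open>
  Composing with the left inverse \<open>L\<close> of the derivative of \<open>e\<close> gives a map \<open>g = L \<circ> e\<close> that agrees with the
  identity to first order at \<open>f x\<close>. Continuity of \<open>f\<close> makes this approximation available along \<open>f\<close>, so
  \<open>f\<close> has the same derivative at \<open>x\<close> as \<open>g \<circ> f\<close>.
\<close>

lemma has_derivative_lift:
  fixes f :: "'a::real_normed_vector \<Rightarrow> 'b::real_normed_vector"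
    and e :: "'b \<Rightarrow> 'c::real_normed_vector"
  assumes e: "(e has_derivative A) (at (f x) within T)"
    and f: "continuous (at x within S) f" "x \<in> S" "f ` S \<subseteq> T"
    and h: "((\<lambda>x. e (f x)) has_derivative B) (at x within S)"
    and L: "bounded_linear L" "\<And>y. y \<in> T \<Longrightarrow> L (A (y - f x)) = y - f x"
  shows "(f has_derivative (\<lambda>v. L (B v))) (at x within S)"
proof -
  define g where "g y = L (e y)" for y
  have gA: "(g has_derivative (\<lambda>v. L (A v))) (at (f x) within T)"
    unfolding g_def by (rule bounded_linear.has_derivative[OF L(1) e])
  have gB: "((\<lambda>x. g (f x)) has_derivative (\<lambda>v. L (B v))) (at x within S)"
    unfolding g_def by (rule bounded_linear.has_derivative[OF L(1) h])
  then have bl: "bounded_linear (\<lambda>v. L (B v))" by (rule has_derivative_bounded_linear)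
  obtain K where K: "K > 0" "\<And>v. norm (L (B v)) \<le> norm v * K"
    using bounded_linear.pos_bounded[OF bl] by auto
  have near_f: "\<exists>d>0. \<forall>y\<in>S. norm (y - x) < d \<longrightarrow>
      norm (g (f y) - g (f x) - (f y - f x)) \<le> \<epsilon> * norm (f y - f x)" if eps: "\<epsilon> > 0" for \<epsilon>
  proof -
    obtain d where d: "d > 0" "\<And>z. z \<in> T \<Longrightarrow> norm (z - f x) < d \<Longrightarrow>
        norm (g z - g (f x) - L (A (z - f x))) \<le> \<epsilon> * norm (z - f x)"
      using gA eps unfolding has_derivative_within_alt by blast
    obtain d' where "d' > 0" "\<And>y. y \<in> S \<Longrightarrow> dist y x < d' \<Longrightarrow> dist (f y) (f x) < d"
      using f(1) d(1) unfolding continuous_within_eps_delta by blast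
    then show ?thesis
      using d(2) f(3) L(2) by (intro exI[of _ d']) (auto simp: dist_norm image_subset_iff)
  qed
  have near_B: "\<exists>d>0. \<forall>y\<in>S. norm (y - x) < d \<longrightarrow>
      norm (g (f y) - g (f x) - L (B (y - x))) \<le> \<epsilon> * norm (y - x)" if eps: "\<epsilon> > 0" for \<epsilon>
    using gB eps unfolding has_derivative_within_alt by blast
  \<comment> \<open>Near \<^term>\<open>f x\<close> the map \<^term>\<open>g\<close> is close to the identity, so \<^term>\<open>f\<close> inherits a Lipschitz bound
    at \<^term>\<open>x\<close> from \<^term>\<open>\<lambda>x. g (f x)\<close>.\<close>
  obtain d1 where d1: "d1 > 0" "\<And>y. y \<in> S \<Longrightarrow> norm (y - x) < d1 \<Longrightarrow>
      norm (g (f y) - g (f x) - (f y - f x)) \<le> (1/2) * norm (f y - f x)"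
    using near_f[of "1/2"] by auto
  obtain d2 where d2: "d2 > 0" "\<And>y. y \<in> S \<Longrightarrow> norm (y - x) < d2 \<Longrightarrow>
      norm (g (f y) - g (f x) - L (B (y - x))) \<le> 1 * norm (y - x)"
    using near_B[of 1] by auto
  have lip: "norm (f y - f x) \<le> 2 * (K + 1) * norm (y - x)"
    if "y \<in> S" "norm (y - x) < min d1 d2" for y
  proof -
    have "norm (f y - f x) \<le> norm (g (f y) - g (f x)) + norm (g (f y) - g (f x) - (f y - f x))"
      using norm_triangle_ineq4[of "g (f y) - g (f x)" "g (f y) - g (f x) - (f y - f x)"] by simp
    moreover have "norm (g (f y) - g (f x)) \<le>
        norm (L (B (y - x))) + norm (g (f y) - g (f x) - L (B (y - x)))"
      using norm_triangle_ineq[of "L (B (y - x))" "g (f y) - g (f x) - L (B (y - x))"] by simp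
    ultimately show ?thesis
      using d1(2)[of y] d2(2)[of y] K(2)[of "y - x"] that by (simp add: algebra_simps)
  qed
  show ?thesis
    unfolding has_derivative_within_alt
  proof (intro conjI allI impI bl)
    fix \<epsilon> :: real assume eps: "\<epsilon> > 0"
    define \<eta> where "\<eta> = \<epsilon> / (4 * (K + 1))"
    have eta: "\<eta> > 0" using eps K(1) by (simp add: \<eta>_def)
    obtain d3 where d3: "d3 > 0" "\<And>y. y \<in> S \<Longrightarrow> norm (y - x) < d3 \<Longrightarrow>
        norm (g (f y) - g (f x) - (f y - f x)) \<le> \<eta> * norm (f y - f x)"
      using near_f[OF eta] by auto
    obtain d4 where d4: "d4 > 0" "\<And>y. y \<in> S \<Longrightarrow> norm (y - x) < d4 \<Longrightarrow>
        norm (g (f y) - g (f x) - L (B (y - x))) \<le> (\<epsilon>/2) * norm (y - x)"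
      using near_B[of "\<epsilon>/2"] eps by auto
    show "\<exists>d>0. \<forall>y\<in>S. norm (y - x) < d \<longrightarrow> norm (f y - f x - L (B (y - x))) \<le> \<epsilon> * norm (y - x)"
    proof (intro exI[of _ "min (min d1 d2) (min d3 d4)"] conjI ballI impI)
      fix y assume y: "y \<in> S" "norm (y - x) < min (min d1 d2) (min d3 d4)"
      have "f y - f x - L (B (y - x)) =
          (g (f y) - g (f x) - L (B (y - x))) - (g (f y) - g (f x) - (f y - f x))"
        by simp
      then have "norm (f y - f x - L (B (y - x))) \<le>
          norm (g (f y) - g (f x) - L (B (y - x))) + norm (g (f y) - g (f x) - (f y - f x))"
        by (metis norm_triangle_ineq4)
      also have "\<dots> \<le> (\<epsilon>/2) * norm (y - x) + \<eta> * (2 * (K + 1) * norm (y - x))"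
      proof (rule add_mono)
        have "norm (g (f y) - g (f x) - (f y - f x)) \<le> \<eta> * norm (f y - f x)"
          using d3(2) y by simp
        also have "\<dots> \<le> \<eta> * (2 * (K + 1) * norm (y - x))"
          using lip[of y] y eta by (intro mult_left_mono) auto
        finally show "norm (g (f y) - g (f x) - (f y - f x)) \<le> \<eta> * (2 * (K + 1) * norm (y - x))" .
      qed (use d4(2) y in simp)
      also have "\<dots> = \<epsilon> * norm (y - x)"
        using K(1) by (simp add: \<eta>_def field_simps)
      finally show "norm (f y - f x - L (B (y - x))) \<le> \<epsilon> * norm (y - x)" .
    qed (use d1 d2 d3 d4 in auto)
  qed
qed

text \<open>
  A product rule for a coefficient \<open>c\<close> that is only continuous, which suffices where \<open>q\<close> vanishes. It applies
  to the solution of a linear system before that solution is known to be differentiable.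
\<close>

lemma has_derivative_scaleR_vanishing:
  fixes c :: "'a::real_normed_vector \<Rightarrow> real" and q :: "'a \<Rightarrow> 'b::real_normed_vector"
  assumes c: "continuous (at x within S) c" and q: "(q has_derivative q') (at x within S)" and 0: "q x = 0"
  shows "((\<lambda>y. c y *\<^sub>R q y) has_derivative (\<lambda>v. c x *\<^sub>R q' v)) (at x within S)"
proof -
  have bl: "bounded_linear q'" by (rule has_derivative_bounded_linear[OF q])
  obtain K where K: "K > 0" "\<And>v. norm (q' v) \<le> norm v * K"
    using bounded_linear.pos_bounded[OF bl] by auto
  have "((\<lambda>y. (c y - c x) *\<^sub>R q y) has_derivative (\<lambda>v. 0)) (at x within S)"
    unfolding has_derivative_within_alt
  proof (intro conjI allI impI)
    fix e :: real assume e: "e > 0"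
    obtain d1 where d1: "d1 > 0" "\<And>y. y \<in> S \<Longrightarrow> norm (y - x) < d1 \<Longrightarrow>
        norm (q y - q x - q' (y - x)) \<le> 1 * norm (y - x)"
      using q unfolding has_derivative_within_alt by (meson zero_less_one)
    have "e / (K + 1) > 0" using e K by simp
    then obtain d2 where d2: "d2 > 0" "\<And>y. y \<in> S \<Longrightarrow> dist y x < d2 \<Longrightarrow> dist (c y) (c x) < e / (K + 1)"
      using c unfolding continuous_within_eps_delta by blast
    show "\<exists>d>0. \<forall>y\<in>S. norm (y - x) < d \<longrightarrow>
        norm ((c y - c x) *\<^sub>R q y - (c x - c x) *\<^sub>R q x - 0) \<le> e * norm (y - x)"
    proof (intro exI[of _ "min d1 d2"] conjI ballI impI)
      fix y assume y: "y \<in> S" "norm (y - x) < min d1 d2"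
      have "norm (q y) \<le> norm (q' (y - x)) + norm (q y - q x - q' (y - x))"
        using norm_triangle_ineq[of "q' (y - x)" "q y - q x - q' (y - x)"] 0 by simp
      also have "\<dots> \<le> (K + 1) * norm (y - x)"
        using d1(2)[of y] K(2)[of "y - x"] y by (simp add: algebra_simps)
      finally have "norm (q y) \<le> (K + 1) * norm (y - x)" .
      moreover have "\<bar>c y - c x\<bar> \<le> e / (K + 1)"
        using d2(2)[of y] y by (auto simp: dist_norm)
      ultimately have "\<bar>c y - c x\<bar> * norm (q y) \<le> (e / (K + 1)) * ((K + 1) * norm (y - x))"
        using e K by (intro mult_mono) auto
      then show "norm ((c y - c x) *\<^sub>R q y - (c x - c x) *\<^sub>R q x - 0) \<le> e * norm (y - x)"
        using K by simp
    qed (use d1 d2 in auto)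
  qed simp
  from has_derivative_add[OF this has_derivative_scaleR_right[OF q, of "c x"]]
  show ?thesis by (simp add: algebra_simps)
qed

lemma linear_system_residual:
  fixes A0 A L :: "rvec \<Rightarrow> rvec"
  assumes L: "linear L" and A: "linear A0" "linear A" and w: "w \<in> coord_space n" and eq: "L (A0 w) = w"
  shows "w = L (A w) + (\<Sum>i<n. coord w i *\<^sub>R L (A0 (unit_vec i) - A (unit_vec i)))"
proof -
  have "linear (\<lambda>v. L (A0 v - A v))"
    by (intro linear_compose[OF linear_compose_sub[OF A] L, unfolded o_def])
  from linear_coord_expand[OF this w]
  have "(\<Sum>i<n. coord w i *\<^sub>R L (A0 (unit_vec i) - A (unit_vec i))) = w - L (A w)"
    unfolding linear_diff[OF L] eq by (rule sym)
  then show ?thesis by (metis add.commute diff_add_cancel)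
qed

text \<open>
  With a left inverse \<open>L\<close> of \<open>A(x\<^sub>0)\<close>, the system \<open>A(x) w(x) = b(x)\<close> becomes
  \<open>w(x) = L b(x) - L (A(x) - A(x\<^sub>0)) w(x)\<close>, where the last term is small near \<open>x\<^sub>0\<close>. This gives first
  continuity and then differentiability of \<open>w\<close> at \<open>x\<^sub>0\<close>. Differentiating the system shows that the derivative
  of \<open>w\<close> solves a system with the same matrix \<open>A\<close>, so that induction on \<open>k\<close> applies.
\<close>

lemma Ck_linear_system_solution:
  fixes A :: "rvec \<Rightarrow> rvec \<Rightarrow> rvec" and w :: "rvec \<Rightarrow> rvec"
  assumes U: "open_in_coords a U"
    and lin: "\<And>x. x \<in> U \<Longrightarrow> linear (A x)"
    and inj: "\<And>x. x \<in> U \<Longrightarrow> inj_on (A x) (coord_space n)"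
    and ran: "\<And>x. x \<in> U \<Longrightarrow> A x ` coord_space n \<subseteq> coord_space m"
    and A: "\<And>v. v \<in> coord_space n \<Longrightarrow> Ck k a U (\<lambda>x. A x v)"
    and w: "\<And>x. x \<in> U \<Longrightarrow> w x \<in> coord_space n"
    and b: "Ck k a U (\<lambda>x. A x (w x))"
  shows "Ck k a U w"
  using A w b
proof (induction k arbitrary: w)
  case 0
  show ?case
    unfolding Ck.simps continuous_on_eq_continuous_within
  proof
    fix x0 assume x0: "x0 \<in> U"
    obtain L where L: "bounded_linear L" "\<And>v. v \<in> coord_space n \<Longrightarrow> L (A x0 v) = v"
      using linear_injective_on_coord_space_left_inverse[OF lin[OF x0] inj[OF x0] ran[OF x0]] by blast
    define q where "q i x = L (A x0 (unit_vec i) - A x (unit_vec i))" for i x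
    define c where "c x = (\<Sum>i<n. norm (q i x))" for x
    define b where "b x = L (A x (w x))" for x
    have cw: "continuous (at x0 within U) (\<lambda>x. L (A x (w x)))"
      "\<And>i. i < n \<Longrightarrow> continuous (at x0 within U) (\<lambda>x. A x (unit_vec i))"
      using 0 x0 unit_vec_in_coord_space[of _ n]
      by (auto simp: continuous_on_eq_continuous_within intro!: bounded_linear.continuous[OF L(1)])
    have q: "(q i \<longlongrightarrow> 0) (at x0 within U)" if "i < n" for i
    proof -
      have "continuous (at x0 within U) (q i)"
        unfolding q_def
        by (intro bounded_linear.continuous[OF L(1)] continuous_diff continuous_const cw(2) that)
      then show ?thesis
        by (simp add: continuous_within q_def linear_0[OF bounded_linear.linear[OF L(1)]])
    qed
    then have c: "(c \<longlongrightarrow> 0) (at x0 within U)"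
      unfolding c_def by (intro tendsto_null_sum tendsto_norm_zero) auto
    have b: "(b \<longlongrightarrow> w x0) (at x0 within U)"
      using cw(1) unfolding continuous_within L(2)[OF 0(2)[OF x0]] b_def .
    have split: "w x = b x + (\<Sum>i<n. coord (w x) i *\<^sub>R q i x)" if x: "x \<in> U" for x
      unfolding b_def q_def
      by (rule linear_system_residual[where L = L and ?A0.0 = "A x0" and A = "A x" and w = "w x"])
         (auto intro: bounded_linear.linear L lin x0 x 0(2))
    have est: "norm (w x - b x) \<le> norm (w x) * c x" if x: "x \<in> U" for x
    proof -
      have "w x - b x = (\<Sum>i<n. coord (w x) i *\<^sub>R q i x)"
        by (subst split[OF x]) simp
      then have "norm (w x - b x) \<le> (\<Sum>i<n. norm (coord (w x) i *\<^sub>R q i x))"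
        by (simp only: norm_sum)
      also have "\<dots> \<le> (\<Sum>i<n. norm (w x) * norm (q i x))"
        by (intro sum_mono) (simp add: mult_right_mono abs_lookup_le_norm)
      finally show ?thesis by (simp add: c_def sum_distrib_left)
    qed
    have "\<forall>\<^sub>F x in at x0 within U. c x < 1/2"
      using c by (rule order_tendstoD(2)) simp
    then have "\<forall>\<^sub>F x in at x0 within U. x \<in> U \<and> c x < 1/2"
      by (simp add: eventually_at_filter eventually_mono)
    then have bound: "\<forall>\<^sub>F x in at x0 within U. norm (w x - b x) \<le> 2 * norm (b x) * c x"
    proof eventually_elim
      case (elim x)
      have "norm (w x) \<le> norm (b x) + norm (w x - b x)"
        using norm_triangle_ineq[of "b x" "w x - b x"] by simp
      moreover have "norm (w x) * c x \<le> norm (w x) * (1/2)"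
        using elim by (intro mult_left_mono) auto
      ultimately have "norm (w x) \<le> 2 * norm (b x)"
        using est[of x] elim by simp
      moreover have "0 \<le> c x" by (simp add: c_def sum_nonneg)
      ultimately show ?case using est[of x] elim mult_right_mono by fastforce
    qed
    have "((\<lambda>x. 2 * norm (b x) * c x) \<longlongrightarrow> 2 * norm (w x0) * 0) (at x0 within U)"
      by (intro tendsto_mult tendsto_const tendsto_norm b c)
    then have "((\<lambda>x. w x - b x) \<longlongrightarrow> 0) (at x0 within U)"
      unfolding mult_zero_right by (rule Lim_null_comparison[OF bound])
    from tendsto_add[OF this b] show "continuous (at x0 within U) w"
      unfolding continuous_within by simp
  qed
next
  case (Suc k)
  note Usub = open_in_coords_subset[OF U]
  note Asub = Suc.prems(1)[THEN Ck_Suc_imp_Ck[OF Usub]]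
  have wk: "Ck k a U w"
    by (rule Suc.IH[OF Asub Suc.prems(2) Ck_Suc_imp_Ck[OF Usub Suc.prems(3)]])
  have "\<exists>D. (\<forall>x\<in>U. ((\<lambda>x. A x (unit_vec i)) has_derivative D x) (at x within coord_space a)) \<and>
      (\<forall>h\<in>coord_space a. Ck k a U (\<lambda>x. D x h))" if "i < n" for i
    using Suc.prems(1)[OF unit_vec_in_coord_space[OF that]] by simp
  then obtain DA where DA:
    "\<And>i x. i < n \<Longrightarrow> x \<in> U \<Longrightarrow> ((\<lambda>x. A x (unit_vec i)) has_derivative DA i x) (at x within coord_space a)"
    "\<And>i h. i < n \<Longrightarrow> h \<in> coord_space a \<Longrightarrow> Ck k a U (\<lambda>x. DA i x h)"
    by metis
  obtain Db where Db: "\<And>x. x \<in> U \<Longrightarrow> ((\<lambda>x. A x (w x)) has_derivative Db x) (at x within coord_space a)"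
    "\<And>h. h \<in> coord_space a \<Longrightarrow> Ck k a U (\<lambda>x. Db x h)"
    using Suc.prems(3) by auto
  have "\<exists>D. (w has_derivative D) (at x0 within coord_space a)" if x0: "x0 \<in> U" for x0
  proof -
    obtain L where L: "bounded_linear L" "\<And>v. v \<in> coord_space n \<Longrightarrow> L (A x0 v) = v"
      using linear_injective_on_coord_space_left_inverse[OF lin[OF x0] inj[OF x0] ran[OF x0]] by blast
    note Llin = bounded_linear.linear[OF L(1)]
    define q where "q i x = L (A x0 (unit_vec i) - A x (unit_vec i))" for i x
    have "(q i has_derivative (\<lambda>h. L (0 - DA i x0 h))) (at x0 within U)" if "i < n" for i
      unfolding q_def at_within_coords[OF U x0]
      by (intro bounded_linear.has_derivative[OF L(1)] has_derivative_diff has_derivative_const DA(1) that x0)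
    moreover have "continuous (at x0 within U) (\<lambda>x. coord (w x) i)" for i
      using Ck_imp_continuous_on[OF Usub wk] x0
      by (intro bounded_linear.continuous[OF bounded_linear_lookup]) (auto simp: continuous_on_eq_continuous_within)
    moreover have "q i x0 = 0" for i by (simp add: q_def linear_0[OF Llin])
    ultimately have "((\<lambda>x. \<Sum>i<n. coord (w x) i *\<^sub>R q i x) has_derivative
        (\<lambda>h. \<Sum>i<n. coord (w x0) i *\<^sub>R L (0 - DA i x0 h))) (at x0 within U)"
      by (intro has_derivative_sum has_derivative_scaleR_vanishing) auto
    from has_derivative_add[OF bounded_linear.has_derivative[OF L(1) Db(1)[OF x0]]
        this[unfolded at_within_coords[OF U x0]]]
    have D: "((\<lambda>x. L (A x (w x)) + (\<Sum>i<n. coord (w x) i *\<^sub>R q i x)) has_derivative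
        (\<lambda>h. L (Db x0 h) + (\<Sum>i<n. coord (w x0) i *\<^sub>R L (0 - DA i x0 h)))) (at x0 within coord_space a)" .
    have split: "w x = L (A x (w x)) + (\<Sum>i<n. coord (w x) i *\<^sub>R q i x)" if x: "x \<in> U" for x
      unfolding q_def
      by (rule linear_system_residual[where L = L and ?A0.0 = "A x0" and A = "A x" and w = "w x"])
         (auto intro: Llin L lin x0 x Suc.prems(2))
    show ?thesis
      using has_derivative_transform[OF x0 split D[folded at_within_coords[OF U x0]]]
      unfolding at_within_coords[OF U x0] by blast
  qed
  then obtain Dw where Dw: "\<And>x. x \<in> U \<Longrightarrow> (w has_derivative Dw x) (at x within coord_space a)"
    by metis
  have Dw_n: "Dw x h \<in> coord_space n" if x: "x \<in> U" and h: "h \<in> coord_space a" for x h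
  proof (rule derivative_in_coord_space[OF Dw[OF x] _ Suc.prems(2)[OF x] _ h])
    show "\<forall>\<^sub>F y in at x within coord_space a. w y \<in> coord_space n"
      unfolding at_within_coords[OF U x, symmetric]
      using Suc.prems(2) by (auto simp: eventually_at_filter intro!: always_eventually)
  qed (use x Usub in auto)
  have system: "Db x h - (\<Sum>i<n. coord (w x) i *\<^sub>R DA i x h) = A x (Dw x h)"
    if x: "x \<in> U" and h: "h \<in> coord_space a" for x h
  proof -
    have "((\<lambda>x. \<Sum>i<n. coord (w x) i *\<^sub>R A x (unit_vec i)) has_derivative
        (\<lambda>h. \<Sum>i<n. coord (w x) i *\<^sub>R DA i x h + coord (Dw x h) i *\<^sub>R A x (unit_vec i)))
        (at x within U)"
      unfolding at_within_coords[OF U x]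
      by (intro has_derivative_sum has_derivative_scaleR bounded_linear.has_derivative[OF bounded_linear_lookup]
          Dw[OF x] DA(1)) (auto simp: x)
    then have "((\<lambda>x. A x (w x)) has_derivative
        (\<lambda>h. \<Sum>i<n. coord (w x) i *\<^sub>R DA i x h + coord (Dw x h) i *\<^sub>R A x (unit_vec i)))
        (at x within U)"
      using linear_coord_expand[OF lin Suc.prems(2)]
      by (rule has_derivative_transform[OF x, rotated])
    from has_derivative_coord_space_unique[OF Db(1)[OF x] this[unfolded at_within_coords[OF U x]] _ h]
    show ?thesis
      using x Usub linear_coord_expand[OF lin[OF x] Dw_n[OF x h]] by (auto simp: sum.distrib)
  qed
  show ?case
  proof (rule Ck_SucI[OF Dw])
    fix h assume h: "h \<in> coord_space a"
    show "Ck k a U (\<lambda>x. Dw x h)"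
    proof (rule Suc.IH[OF Asub Dw_n[OF _ h]])
      show "Ck k a U (\<lambda>x. A x (Dw x h))"
        by (rule Ck_cong[OF U system[OF _ h]], assumption)
           (auto intro!: Ck_diff Ck_sum Ck_scaleR[OF Usub] DA(2) Db(2) h
             Ck_bounded_linear[OF bounded_linear_lookup wk])
    qed
  qed
qed

section \<open>Smooth functions and lifts through immersions\<close>

lemma smooth_on_iff_Ck: "smooth_on n U f \<longleftrightarrow> (\<forall>k. Ck k n U f)"
  by (simp add: smooth_on_def Ck_on_eq_Ck)

lemma smooth_on_subset: "smooth_on n U f \<Longrightarrow> V \<subseteq> U \<Longrightarrow> smooth_on n V f"
  by (auto simp: smooth_on_iff_Ck intro: Ck_subset)

lemma smooth_on_cong:
  "open_in_coords n U \<Longrightarrow> (\<And>x. x \<in> U \<Longrightarrow> f x = g x) \<Longrightarrow> smooth_on n U f \<Longrightarrow> smooth_on n U g"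
  by (auto simp: smooth_on_iff_Ck intro: Ck_cong)

lemma smooth_on_local:
  assumes "open_in_coords n U"
    and "\<And>x. x \<in> U \<Longrightarrow> \<exists>V. open_in_coords n V \<and> x \<in> V \<and> smooth_on n V f"
  shows "smooth_on n U f"
  unfolding smooth_on_iff_Ck
proof
  fix k
  show "Ck k n U f"
    by (rule Ck_local[OF assms(1)]) (use assms(2) in \<open>auto simp: smooth_on_iff_Ck\<close>)
qed

lemma smooth_on_compose:
  assumes "open_in_coords n U" "open_in_coords m V" "f ` U \<subseteq> V" "smooth_on n U f" "smooth_on m V g"
  shows "smooth_on n U (\<lambda>x. g (f x))"
  using assms by (auto simp: smooth_on_iff_Ck intro: Ck_compose)

lemma smooth_on_bounded_linear: "bounded_linear L \<Longrightarrow> smooth_on n U L"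
  by (simp add: smooth_on_iff_Ck Ck_linear)

lemma smooth_on_const: "smooth_on n U (\<lambda>x. c)"
  by (simp add: smooth_on_iff_Ck Ck_const)

lemma smooth_on_add: "smooth_on n U f \<Longrightarrow> smooth_on n U g \<Longrightarrow> smooth_on n U (\<lambda>x. f x + g x)"
  by (simp add: smooth_on_iff_Ck Ck_add)

lemma smooth_on_compose_bounded_linear:
  "bounded_linear L \<Longrightarrow> smooth_on n U f \<Longrightarrow> smooth_on n U (\<lambda>x. L (f x))"
  by (simp add: smooth_on_iff_Ck Ck_bounded_linear)

lemma smooth_on_derivative:
  assumes U: "open_in_coords n U" and f: "smooth_on n U f"
  obtains D where "\<And>x. x \<in> U \<Longrightarrow> (f has_derivative D x) (at x within coord_space n)"
    and "\<And>v. v \<in> coord_space n \<Longrightarrow> smooth_on n U (\<lambda>x. D x v)"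
proof -
  have "Ck (Suc 0) n U f" using f by (simp add: smooth_on_iff_Ck del: Ck.simps)
  then obtain D where "\<forall>x\<in>U. (f has_derivative D x) (at x within coord_space n)" by auto
  then show thesis
    using that[of D] Ck_derivative[OF U] f unfolding smooth_on_iff_Ck by blast
qed

text \<open>
  The differential of the lift exists by \<open>has_derivative_lift\<close> and is determined by
  \<open>De(f(x)) \<circ> Df(x) = D(e \<circ> f)(x)\<close>, a linear system whose coefficients are as smooth as \<open>f\<close>. Hence \<open>Df\<close> is
  of class \<open>C\<^sup>k\<close> if \<open>f\<close> is, and the smoothness of \<open>f\<close> improves one degree at a time. This takes the place of
  the inverse function theorem.
\<close>

lemma smooth_on_lift:
  assumes U: "open_in_coords a U" and V: "open_in_coords n V" and fV: "f ` U \<subseteq> V"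
    and f: "continuous_on U f"
    and e: "smooth_on n V e" "e ` V \<subseteq> coord_space m"
    and imm: "\<And>y D. y \<in> V \<Longrightarrow> (e has_derivative D) (at y within coord_space n) \<Longrightarrow> inj_on D (coord_space n)"
    and h: "smooth_on a U (\<lambda>x. e (f x))"
  shows "smooth_on a U f"
proof -
  note Usub = open_in_coords_subset[OF U] and Vsub = open_in_coords_subset[OF V]
  obtain De where De: "\<And>y. y \<in> V \<Longrightarrow> (e has_derivative De y) (at y within coord_space n)"
    "\<And>v. v \<in> coord_space n \<Longrightarrow> smooth_on n V (\<lambda>y. De y v)"
    using smooth_on_derivative[OF V e(1)] by blast
  obtain B where B: "\<And>x. x \<in> U \<Longrightarrow> ((\<lambda>x. e (f x)) has_derivative B x) (at x within coord_space a)"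
    "\<And>v. v \<in> coord_space a \<Longrightarrow> smooth_on a U (\<lambda>x. B x v)"
    using smooth_on_derivative[OF U h] by blast
  have De_m: "De y ` coord_space n \<subseteq> coord_space m" if y: "y \<in> V" for y
  proof safe
    fix v assume "v \<in> coord_space n"
    moreover have "\<forall>\<^sub>F y in at y within coord_space n. e y \<in> coord_space m"
      unfolding at_within_coords[OF V y, symmetric]
      using e(2) by (auto simp: eventually_at_filter intro!: always_eventually)
    ultimately show "De y v \<in> coord_space m"
      using derivative_in_coord_space[OF De(1)[OF y]] e(2) y Vsub by blast
  qed
  have "\<exists>D. (f has_derivative D) (at x within coord_space a)" if x: "x \<in> U" for x
  proof -
    have fx: "f x \<in> V" using x fV by auto
    obtain L where L: "bounded_linear L" "\<And>v. v \<in> coord_space n \<Longrightarrow> L (De (f x) v) = v"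
      using linear_injective_on_coord_space_left_inverse[OF has_derivative_linear[OF De(1)[OF fx]]
          imm[OF fx De(1)[OF fx]] De_m[OF fx]] by blast
    have "(f has_derivative (\<lambda>v. L (B x v))) (at x within U)"
    proof (rule has_derivative_lift[where T = V and A = "De (f x)" and L = L and B = "B x" and e = e])
      show "L (De (f x) (y - f x)) = y - f x" if "y \<in> V" for y
        using that fx Vsub by (intro L(2) subspace_diff subspace_coord_space) auto
    qed (use f x fV B L De fx at_within_coords[OF U x] at_within_coords[OF V fx]
          in \<open>auto simp: continuous_on_eq_continuous_within\<close>)
    then show ?thesis using at_within_coords[OF U x] by metis
  qed
  then obtain Df where Df: "\<And>x. x \<in> U \<Longrightarrow> (f has_derivative Df x) (at x within coord_space a)"
    by metis
  have Df_n: "Df x v \<in> coord_space n" if x: "x \<in> U" and v: "v \<in> coord_space a" for x v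
  proof (rule derivative_in_coord_space[OF Df[OF x] _ _ _ v])
    show "\<forall>\<^sub>F y in at x within coord_space a. f y \<in> coord_space n"
      unfolding at_within_coords[OF U x, symmetric]
      using fV Vsub by (auto simp: eventually_at_filter intro!: always_eventually)
  qed (use x Usub fV Vsub in auto)
  have system: "De (f x) (Df x v) = B x v" if x: "x \<in> U" and v: "v \<in> coord_space a" for x v
  proof -
    have "(e has_derivative De (f x)) (at (f x) within f ` U)"
      using De(1)[of "f x"] x fV Vsub by (blast intro: has_derivative_subset)
    from has_derivative_in_compose[OF Df[OF x, folded at_within_coords[OF U x]] this]
    have "((\<lambda>x. e (f x)) has_derivative (\<lambda>v. De (f x) (Df x v))) (at x within coord_space a)"
      by (simp add: at_within_coords[OF U x])
    from has_derivative_coord_space_unique[OF this B(1)[OF x] _ v] show ?thesis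
      using x Usub by auto
  qed
  have "Ck k a U f" for k
  proof (induction k)
    case 0
    show ?case using f by simp
  next
    case (Suc k)
    show ?case
    proof (rule Ck_SucI[OF Df])
      fix v assume v: "v \<in> coord_space a"
      show "Ck k a U (\<lambda>x. Df x v)"
      proof (rule Ck_linear_system_solution[where A = "\<lambda>x. De (f x)" and n = n and m = m, OF U])
        show "Ck k a U (\<lambda>x. De (f x) u)" if "u \<in> coord_space n" for u
          using Ck_compose[OF U V fV Suc, of "\<lambda>y. De y u"] De(2)[OF that] by (simp add: smooth_on_iff_Ck)
        show "Ck k a U (\<lambda>x. De (f x) (Df x v))"
          by (rule Ck_cong[OF U system[OF _ v, symmetric]]) (use B(2)[OF v] in \<open>auto simp: smooth_on_iff_Ck\<close>)
        show "De (f x) ` coord_space n \<subseteq> coord_space m" if "x \<in> U" for x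
          using De_m that fV by blast
        show "linear (De (f x))" "inj_on (De (f x)) (coord_space n)" if "x \<in> U" for x
          using has_derivative_linear[OF De(1)] imm[OF _ De(1)] that fV by blast+
      qed (rule Df_n[OF _ v])
    qed
  qed
  then show ?thesis by (simp add: smooth_on_iff_Ck)
qed

section \<open>Charts\<close>

text \<open>
  That \<open>g\<close> factors smoothly through the coordinate map \<open>\<phi>\<close> is expressed by the factor \<open>h\<close> rather than by the
  inverse of \<open>\<phi>\<close>, whose domain would change with every restriction of the chart.
\<close>

definition smooth_in_coord :: "nat \<Rightarrow> ('a \<Rightarrow> rvec) \<Rightarrow> 'a set \<Rightarrow> ('a \<Rightarrow> rvec) \<Rightarrow> bool" where
  "smooth_in_coord n \<phi> W g \<longleftrightarrow> (\<exists>h. smooth_on n (\<phi> ` W) h \<and> (\<forall>p\<in>W. g p = h (\<phi> p)))"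

lemma smooth_in_coord_subset: "smooth_in_coord n \<phi> W g \<Longrightarrow> W' \<subseteq> W \<Longrightarrow> smooth_in_coord n \<phi> W' g"
  unfolding smooth_in_coord_def by (meson image_mono smooth_on_subset subsetD)

lemma smooth_in_coord_cong:
  "smooth_in_coord n \<phi> W g \<Longrightarrow> (\<And>p. p \<in> W \<Longrightarrow> g p = g' p) \<Longrightarrow> smooth_in_coord n \<phi> W g'"
  unfolding smooth_in_coord_def by fastforce

lemma smooth_in_coord_self: "smooth_in_coord n \<phi> W \<phi>"
  unfolding smooth_in_coord_def by (auto intro!: exI[of _ "\<lambda>x. x"] smooth_on_bounded_linear bounded_linear_ident)

lemma smooth_in_coord_const: "smooth_in_coord n \<phi> W (\<lambda>_. c)"
  unfolding smooth_in_coord_def by (auto intro!: exI[of _ "\<lambda>x. c"] smooth_on_const)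

lemma smooth_in_coord_add:
  "smooth_in_coord n \<phi> W f \<Longrightarrow> smooth_in_coord n \<phi> W g \<Longrightarrow> smooth_in_coord n \<phi> W (\<lambda>p. f p + g p)"
  unfolding smooth_in_coord_def
proof (elim exE conjE)
  fix h k assume "smooth_on n (\<phi> ` W) h" "\<forall>p\<in>W. f p = h (\<phi> p)"
    "smooth_on n (\<phi> ` W) k" "\<forall>p\<in>W. g p = k (\<phi> p)"
  then show "\<exists>h. smooth_on n (\<phi> ` W) h \<and> (\<forall>p\<in>W. f p + g p = h (\<phi> p))"
    by (intro exI[of _ "\<lambda>x. h x + k x"]) (auto intro: smooth_on_add)
qed

lemma smooth_in_coord_bounded_linear:
  "bounded_linear L \<Longrightarrow> smooth_in_coord n \<phi> W f \<Longrightarrow> smooth_in_coord n \<phi> W (\<lambda>p. L (f p))"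
  unfolding smooth_in_coord_def
  by (elim exE conjE, rule exI, rule conjI, rule smooth_on_compose_bounded_linear) auto

lemma smooth_in_coord_compose:
  assumes W: "open_in_coords n (\<phi> ` W)" and W': "open_in_coords m (\<psi> ` W')"
    and f: "f ` W \<subseteq> W'" "smooth_in_coord n \<phi> W (\<lambda>p. \<psi> (f p))"
    and g: "smooth_in_coord m \<psi> W' g"
  shows "smooth_in_coord n \<phi> W (\<lambda>p. g (f p))"
proof -
  obtain h k where h: "smooth_on n (\<phi> ` W) h" "\<And>p. p \<in> W \<Longrightarrow> \<psi> (f p) = h (\<phi> p)"
    and k: "smooth_on m (\<psi> ` W') k" "\<And>q. q \<in> W' \<Longrightarrow> g q = k (\<psi> q)"
    using f(2) g unfolding smooth_in_coord_def by blast
  have "h ` \<phi> ` W \<subseteq> \<psi> ` W'" using h(2)[symmetric] f(1) by auto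
  from smooth_on_compose[OF W W' this h(1) k(1)] show ?thesis
    unfolding smooth_in_coord_def using h(2) k(2) f(1) by (intro exI[of _ "\<lambda>x. k (h x)"]) (auto simp: image_subset_iff)
qed

lemma is_chartD:
  assumes "is_chart X n (U, \<phi>)"
  shows "openin X U" "U \<subseteq> topspace X" "open_in_coords n (\<phi> ` U)" "\<phi> ` U \<subseteq> coord_space n" "inj_on \<phi> U"
    "homeomorphic_map (subtopology X U) (top_of_set (\<phi> ` U)) \<phi>"
proof -
  show *: "openin X U" "open_in_coords n (\<phi> ` U)"
    "homeomorphic_map (subtopology X U) (top_of_set (\<phi> ` U)) \<phi>"
    using assms by (auto simp: is_chart_def)
  show "U \<subseteq> topspace X" "\<phi> ` U \<subseteq> coord_space n"
    using openin_subset[OF *(1)] open_in_coords_subset[OF *(2)] by auto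
  then show "inj_on \<phi> U"
    using homeomorphic_imp_injective_map[OF *(3)] by (simp add: Int_absorb1)
qed

lemma is_chart_image_open:
  assumes c: "is_chart X n (U, \<phi>)" and W: "openin X W" "W \<subseteq> U"
  shows "open_in_coords n (\<phi> ` W)"
proof -
  have "openin (subtopology X U) W" using W openin_subset_topspace_eq by (simp add: openin_open_subtopology is_chartD(1)[OF c])
  then have "openin (top_of_set (\<phi> ` U)) (\<phi> ` W)"
    using homeomorphic_imp_open_map[OF is_chartD(6)[OF c]] by (simp add: open_map_def)
  then show ?thesis using is_chartD(3)[OF c] by (rule openin_trans)
qed

lemma is_chart_preimage_open:
  assumes c: "is_chart X n (U, \<phi>)" and O': "open_in_coords n O'"
  shows "openin X {p \<in> U. \<phi> p \<in> O'}"
proof -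
  have "openin (top_of_set (\<phi> ` U)) (\<phi> ` U \<inter> O')"
    by (rule openin_subset_trans[OF openin_Int[OF is_chartD(3)[OF c] O']]) (use is_chartD(4)[OF c] in auto)
  from openin_continuous_map_preimage[OF homeomorphic_imp_continuous_map[OF is_chartD(6)[OF c]] this]
  have "openin (subtopology X U) {p \<in> U. \<phi> p \<in> O'}"
    using is_chartD(2)[OF c] by (auto simp: Int_absorb1 elim!: back_subst[of "openin _"])
  then show ?thesis using is_chartD(1)[OF c] by (simp add: openin_open_subtopology)
qed

lemma is_chart_restrict:
  assumes c: "is_chart X n (U, \<phi>)" and W: "openin X W" "W \<subseteq> U"
  shows "is_chart X n (W, \<phi>)"
proof -
  have "homeomorphic_map (subtopology (subtopology X U) W) (subtopology (top_of_set (\<phi> ` U)) (\<phi> ` W)) \<phi>"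
    by (rule homeomorphic_map_subtopologies[OF is_chartD(6)[OF c]])
       (use W is_chartD(2)[OF c] in auto)
  moreover have "U \<inter> W = W" "\<phi> ` U \<inter> \<phi> ` W = \<phi> ` W" using W by auto
  ultimately have "homeomorphic_map (subtopology X W) (top_of_set (\<phi> ` W)) \<phi>"
    by (simp add: subtopology_subtopology)
  then show ?thesis
    using W is_chart_image_open[OF c W] by (auto simp: is_chart_def)
qed

lemma smooth_in_coord_iff_inv_into:
  assumes "is_chart X n (U, \<phi>)" and "openin X W" "W \<subseteq> U"
  shows "smooth_in_coord n \<phi> W g \<longleftrightarrow> smooth_on n (\<phi> ` W) (g \<circ> inv_into U \<phi>)"
proof
  have inv: "inv_into U \<phi> (\<phi> p) = p" if "p \<in> W" for p
    using that assms(3) is_chartD(5)[OF assms(1)] by auto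
  show "smooth_on n (\<phi> ` W) (g \<circ> inv_into U \<phi>)" if "smooth_in_coord n \<phi> W g"
    using that inv unfolding smooth_in_coord_def
    by (auto intro: smooth_on_cong[OF is_chart_image_open[OF assms]])
  show "smooth_in_coord n \<phi> W g" if "smooth_on n (\<phi> ` W) (g \<circ> inv_into U \<phi>)"
    using that inv unfolding smooth_in_coord_def by (intro exI[of _ "g \<circ> inv_into U \<phi>"]) auto
qed

lemma smooth_in_coord_local:
  assumes c: "is_chart X n (U, \<phi>)" and W: "openin X W" "W \<subseteq> U"
    and loc: "\<And>p. p \<in> W \<Longrightarrow> \<exists>W'. openin X W' \<and> p \<in> W' \<and> W' \<subseteq> W \<and> smooth_in_coord n \<phi> W' g"
  shows "smooth_in_coord n \<phi> W g"
  unfolding smooth_in_coord_iff_inv_into[OF c W]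
proof (rule smooth_on_local[OF is_chart_image_open[OF c W]])
  fix x assume "x \<in> \<phi> ` W"
  then obtain p where p: "p \<in> W" "x = \<phi> p" by auto
  with loc obtain W' where W': "openin X W'" "p \<in> W'" "W' \<subseteq> W" "smooth_in_coord n \<phi> W' g" by blast
  have "W' \<subseteq> U" using W' W by auto
  with W' p show "\<exists>V. open_in_coords n V \<and> x \<in> V \<and> smooth_on n V (g \<circ> inv_into U \<phi>)"
    using is_chart_image_open[OF c W'(1)] smooth_in_coord_iff_inv_into[OF c W'(1), of g] by blast
qed

lemma smoothly_compatible_iff:
  assumes "is_chart X n (U, \<phi>)" "is_chart X n (V, \<psi>)"
  shows "smoothly_compatible n (U, \<phi>) (V, \<psi>) \<longleftrightarrow>
    smooth_in_coord n \<phi> (U \<inter> V) \<psi> \<and> smooth_in_coord n \<psi> (U \<inter> V) \<phi>"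
  using smooth_in_coord_iff_inv_into[OF assms(1), of "U \<inter> V"]
    smooth_in_coord_iff_inv_into[OF assms(2), of "U \<inter> V"] is_chartD(1)[OF assms(1)] is_chartD(1)[OF assms(2)]
  by (simp add: smoothly_compatible_def openin_Int)

text \<open>
  A map that is smooth in charts is continuous, because coordinate maps are homeomorphisms.
\<close>

lemma smooth_in_coord_open_preimage:
  assumes c: "is_chart X n (U, \<phi>)" and d: "is_chart Y m (V, \<psi>)"
    and f: "f ` U \<subseteq> V" "smooth_in_coord n \<phi> U (\<lambda>p. \<psi> (f p))" and W: "openin Y W"
  shows "openin X {p \<in> U. f p \<in> W}"
proof -
  obtain h where h: "smooth_on n (\<phi> ` U) h" "\<And>p. p \<in> U \<Longrightarrow> \<psi> (f p) = h (\<phi> p)"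
    using f(2) by (auto simp: smooth_in_coord_def)
  have "continuous_on (\<phi> ` U) h" using h(1) by (auto simp: smooth_on_def dest: spec[of _ 0])
  moreover have hV: "h ` \<phi> ` U \<subseteq> coord_space m" using h(2)[symmetric] f(1) is_chartD(4)[OF d] by auto
  moreover have "open_in_coords m (\<psi> ` (V \<inter> W))"
    by (rule is_chart_image_open[OF d]) (auto simp: W is_chartD(1)[OF d] openin_Int)
  ultimately have "openin (top_of_set (\<phi> ` U)) (\<phi> ` U \<inter> h -` (\<psi> ` (V \<inter> W)))"
    by (intro continuous_openin_preimage[where T = "coord_space m"]) auto
  then have "open_in_coords n (\<phi> ` U \<inter> h -` (\<psi> ` (V \<inter> W)))"
    using is_chartD(3)[OF c] by (rule openin_trans)
  from is_chart_preimage_open[OF c this]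
  have "openin X {p \<in> U. \<phi> p \<in> \<phi> ` U \<inter> h -` (\<psi> ` (V \<inter> W))}" .
  moreover have "h (\<phi> p) \<in> \<psi> ` (V \<inter> W) \<longleftrightarrow> f p \<in> W" if "p \<in> U" for p
    using h(2)[OF that, symmetric] f(1) that is_chartD(5)[OF d] by (auto simp: inj_on_image_mem_iff image_subset_iff dest: inj_onD)
  ultimately show ?thesis by (auto elim!: back_subst[of "openin X"])
qed


section \<open>Smooth structures\<close>

text \<open>
  Smoothness of maps is a property of the maximal atlases alone. Products with the circle therefore
  only have to be shown to carry one; subspaces of a manifold inherit the separation and countability
  axioms from it.
\<close>

definition smooth_structure :: "'a manifold \<Rightarrow> bool" where
  "smooth_structure M \<longleftrightarrow> smooth_atlas (mtop M) (mdim M) (mcharts M) \<and>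
     (\<forall>c. is_chart (mtop M) (mdim M) c \<and>
          (\<forall>d\<in>mcharts M. smoothly_compatible (mdim M) c d) \<longrightarrow> c \<in> mcharts M)"

lemma smooth_manifold_iff:
  "smooth_manifold M \<longleftrightarrow> Hausdorff_space (mtop M) \<and> second_countable (mtop M) \<and> smooth_structure M"
  by (auto simp: smooth_manifold_def smooth_structure_def)

lemma smooth_manifold_imp_structure: "smooth_manifold M \<Longrightarrow> smooth_structure M"
  by (simp add: smooth_manifold_iff)

lemma smooth_structureD:
  assumes "smooth_structure M"
  shows "c \<in> mcharts M \<Longrightarrow> is_chart (mtop M) (mdim M) c"
    and "c \<in> mcharts M \<Longrightarrow> d \<in> mcharts M \<Longrightarrow> smoothly_compatible (mdim M) c d"
    and "p \<in> mspace M \<Longrightarrow> \<exists>U \<phi>. (U, \<phi>) \<in> mcharts M \<and> p \<in> U"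
    and "is_chart (mtop M) (mdim M) c \<Longrightarrow> (\<And>d. d \<in> mcharts M \<Longrightarrow> smoothly_compatible (mdim M) c d) \<Longrightarrow> c \<in> mcharts M"
proof -
  from assms have M: "\<forall>c\<in>mcharts M. is_chart (mtop M) (mdim M) c"
    "(\<Union>c\<in>mcharts M. fst c) = mspace M"
    "\<forall>c\<in>mcharts M. \<forall>d\<in>mcharts M. smoothly_compatible (mdim M) c d"
    and max: "\<forall>c. is_chart (mtop M) (mdim M) c \<and> (\<forall>d\<in>mcharts M. smoothly_compatible (mdim M) c d) \<longrightarrow>
      c \<in> mcharts M"
    unfolding smooth_structure_def smooth_atlas_def by blast+
  show "c \<in> mcharts M \<Longrightarrow> is_chart (mtop M) (mdim M) c" using M(1) by blast
  show "c \<in> mcharts M \<Longrightarrow> d \<in> mcharts M \<Longrightarrow> smoothly_compatible (mdim M) c d" using M(3) by blast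
  show "\<exists>U \<phi>. (U, \<phi>) \<in> mcharts M \<and> p \<in> U" if "p \<in> mspace M"
  proof -
    from that have "p \<in> (\<Union>c\<in>mcharts M. fst c)" by (simp only: M(2))
    then obtain c where "c \<in> mcharts M" "p \<in> fst c" by blast
    then show ?thesis by (intro exI[of _ "fst c"] exI[of _ "snd c"]) simp
  qed
  show "is_chart (mtop M) (mdim M) c \<Longrightarrow> (\<And>d. d \<in> mcharts M \<Longrightarrow> smoothly_compatible (mdim M) c d) \<Longrightarrow> c \<in> mcharts M"
    using max by blast
qed

lemmas chartD = is_chartD[OF smooth_structureD(1)]

lemma chart_transition:
  assumes "smooth_structure M" "(U, \<phi>) \<in> mcharts M" "(V, \<psi>) \<in> mcharts M"
  shows "smooth_in_coord (mdim M) \<phi> (U \<inter> V) \<psi>"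
  using smooth_structureD(2)[OF assms]
    smoothly_compatible_iff[OF smooth_structureD(1)[OF assms(1,2)] smooth_structureD(1)[OF assms(1,3)]]
  by simp

lemma chart_restrict:
  assumes M: "smooth_structure M" and c: "(U, \<phi>) \<in> mcharts M" and W: "openin (mtop M) W" "W \<subseteq> U"
  shows "(W, \<phi>) \<in> mcharts M"
proof (rule smooth_structureD(4)[OF M])
  note cc = smooth_structureD(1)[OF M c]
  show ch: "is_chart (mtop M) (mdim M) (W, \<phi>)" by (rule is_chart_restrict[OF cc W])
  fix d assume d: "d \<in> mcharts M"
  obtain V \<psi> where d_eq: "d = (V, \<psi>)" by (cases d)
  have "smooth_in_coord (mdim M) \<phi> (U \<inter> V) \<psi>" "smooth_in_coord (mdim M) \<psi> (U \<inter> V) \<phi>"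
    using chart_transition[OF M c d[unfolded d_eq]] chart_transition[OF M d[unfolded d_eq] c]
    by (simp_all add: Int_commute)
  then show "smoothly_compatible (mdim M) (W, \<phi>) d"
    unfolding d_eq smoothly_compatible_iff[OF ch smooth_structureD(1)[OF M d, unfolded d_eq]]
    using W(2) by (auto elim!: smooth_in_coord_subset)
qed

text \<open>Compatibility with an atlas is transitive: between two charts compatible with it, pass through
  a chart of the atlas near each point.\<close>

lemma transition_via_atlas:
  assumes at: "smooth_atlas X n \<A>"
    and c: "is_chart X n (U, \<phi>)" "\<And>a. a \<in> \<A> \<Longrightarrow> smoothly_compatible n (U, \<phi>) a"
    and d: "is_chart X n (V, \<psi>)" "\<And>a. a \<in> \<A> \<Longrightarrow> smoothly_compatible n (V, \<psi>) a"
  shows "smooth_in_coord n \<phi> (U \<inter> V) \<psi>"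
proof (rule smooth_in_coord_local[OF c(1)])
  show UV: "openin X (U \<inter> V)" using is_chartD(1)[OF c(1)] is_chartD(1)[OF d(1)] by (rule openin_Int)
  fix p assume p: "p \<in> U \<inter> V"
  then have "p \<in> topspace X" using is_chartD(2)[OF c(1)] by auto
  then obtain a where a: "a \<in> \<A>" "p \<in> fst a" using at unfolding smooth_atlas_def by blast
  obtain W \<theta> where a_eq: "a = (W, \<theta>)" by (cases a)
  have ch: "is_chart X n (W, \<theta>)" using at a a_eq by (auto simp: smooth_atlas_def)
  define O' where "O' = U \<inter> V \<inter> W"
  have O': "openin X O'" unfolding O'_def by (intro openin_Int UV is_chartD(1)[OF ch])
  have "smooth_in_coord n \<phi> (U \<inter> W) \<theta>" "smooth_in_coord n \<theta> (V \<inter> W) \<psi>"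
    using c(2)[OF a(1)] d(2)[OF a(1)] unfolding a_eq smoothly_compatible_iff[OF c(1) ch] smoothly_compatible_iff[OF d(1) ch]
    by auto
  then have "smooth_in_coord n \<phi> O' \<theta>" "smooth_in_coord n \<theta> O' \<psi>"
    by (auto simp: O'_def elim!: smooth_in_coord_subset)
  moreover have "open_in_coords n (\<phi> ` O')" "open_in_coords n (\<theta> ` O')"
    using is_chart_image_open[OF c(1) O'] is_chart_image_open[OF ch O'] O'_def by blast+
  ultimately have "smooth_in_coord n \<phi> O' \<psi>"
    using smooth_in_coord_compose[where f = "\<lambda>p. p" and W = O' and W' = O' and \<psi> = \<theta> and n = n
        and m = n and \<phi> = \<phi> and g = \<psi>] by simp
  then show "\<exists>W'. openin X W' \<and> p \<in> W' \<and> W' \<subseteq> U \<inter> V \<and> smooth_in_coord n \<phi> W' \<psi>"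
    using O' p a(2) a_eq by (intro exI[of _ O']) (auto simp: O'_def)
qed simp

lemma manifold_of_atlas_simps [simp]:
  "mtop (manifold_of_atlas X n \<A>) = X" "mdim (manifold_of_atlas X n \<A>) = n"
  by (simp_all add: manifold_of_atlas_def)

lemma smooth_structure_manifold_of_atlas:
  assumes at: "smooth_atlas X n \<A>"
  shows "smooth_structure (manifold_of_atlas X n \<A>)" and "\<A> \<subseteq> mcharts (manifold_of_atlas X n \<A>)"
proof -
  show sub: "\<A> \<subseteq> mcharts (manifold_of_atlas X n \<A>)"
    using at by (auto simp: smooth_atlas_def manifold_of_atlas_def)
  have compat: "smoothly_compatible n c d"
    if "c \<in> mcharts (manifold_of_atlas X n \<A>)" "d \<in> mcharts (manifold_of_atlas X n \<A>)" for c d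
  proof -
    obtain U \<phi> V \<psi> where eq: "c = (U, \<phi>)" "d = (V, \<psi>)" by (cases c, cases d)
    have c: "is_chart X n (U, \<phi>)" "\<And>a. a \<in> \<A> \<Longrightarrow> smoothly_compatible n (U, \<phi>) a"
      and d: "is_chart X n (V, \<psi>)" "\<And>a. a \<in> \<A> \<Longrightarrow> smoothly_compatible n (V, \<psi>) a"
      using that by (auto simp: manifold_of_atlas_def eq)
    show ?thesis
      unfolding eq smoothly_compatible_iff[OF c(1) d(1)]
      using transition_via_atlas[OF at c d] transition_via_atlas[OF at d c] by (simp add: Int_commute)
  qed
  show "smooth_structure (manifold_of_atlas X n \<A>)"
    unfolding smooth_structure_def smooth_atlas_def manifold_of_atlas_simps
  proof (intro conjI ballI allI impI)
    show "(\<Union>c\<in>mcharts (manifold_of_atlas X n \<A>). fst c) = topspace X"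
    proof
      show "(\<Union>c\<in>mcharts (manifold_of_atlas X n \<A>). fst c) \<subseteq> topspace X"
        using is_chartD(2) by (fastforce simp: manifold_of_atlas_def)
      show "topspace X \<subseteq> (\<Union>c\<in>mcharts (manifold_of_atlas X n \<A>). fst c)"
        using at sub unfolding smooth_atlas_def by blast
    qed
    show "is_chart X n c" if "c \<in> mcharts (manifold_of_atlas X n \<A>)" for c
      using that by (auto simp: manifold_of_atlas_def)
    fix c assume "is_chart X n c \<and> (\<forall>d\<in>mcharts (manifold_of_atlas X n \<A>). smoothly_compatible n c d)"
    then show "c \<in> mcharts (manifold_of_atlas X n \<A>)"
      using sub by (auto simp: manifold_of_atlas_def)
  qed (rule compat)
qed

lemma open_submanifold_simps [simp]:
  "mtop (open_submanifold M W) = subtopology (mtop M) W" "mdim (open_submanifold M W) = mdim M"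
  "mcharts (open_submanifold M W) = {c \<in> mcharts M. fst c \<subseteq> W}"
  by (simp_all add: open_submanifold_def)

lemma is_chart_subtopology_iff:
  assumes W: "openin X W" and U: "U \<subseteq> W"
  shows "is_chart (subtopology X W) n (U, \<phi>) \<longleftrightarrow> is_chart X n (U, \<phi>)"
  using assms by (simp add: is_chart_def openin_open_subtopology subtopology_subtopology Int_absorb1)

lemma smooth_structure_open_submanifold:
  assumes M: "smooth_structure M" and W: "openin (mtop M) W"
  shows "smooth_structure (open_submanifold M W)"
  unfolding smooth_structure_def smooth_atlas_def
proof (intro conjI ballI allI impI)
  show "is_chart (mtop (open_submanifold M W)) (mdim (open_submanifold M W)) c"
    if "c \<in> mcharts (open_submanifold M W)" for c
    using that smooth_structureD(1)[OF M] is_chart_subtopology_iff[OF W] by (cases c) auto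
  show "smoothly_compatible (mdim (open_submanifold M W)) c d"
    if "c \<in> mcharts (open_submanifold M W)" "d \<in> mcharts (open_submanifold M W)" for c d
    using that smooth_structureD(2)[OF M] by simp
  show "(\<Union>c\<in>mcharts (open_submanifold M W). fst c) = topspace (mtop (open_submanifold M W))"
  proof safe
    fix c p assume "c \<in> mcharts (open_submanifold M W)" "p \<in> fst c"
    then show "p \<in> topspace (mtop (open_submanifold M W))"
      using is_chartD(2)[OF smooth_structureD(1)[OF M, of "(fst c, snd c)"]] by auto
  next
    fix p assume p: "p \<in> topspace (mtop (open_submanifold M W))"
    then obtain U \<phi> where U: "(U, \<phi>) \<in> mcharts M" "p \<in> U"
      using smooth_structureD(3)[OF M, of p] by auto
    have "openin (mtop M) (U \<inter> W)"
      using chartD(1)[OF M U(1)] W by (rule openin_Int)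
    then have "(U \<inter> W, \<phi>) \<in> mcharts (open_submanifold M W)"
      using chart_restrict[OF M U(1)] by auto
    then show "p \<in> (\<Union>c\<in>mcharts (open_submanifold M W). fst c)"
      using U(2) p by (intro UN_I[of "(U \<inter> W, \<phi>)"]) auto
  qed
next
  fix c assume c: "is_chart (mtop (open_submanifold M W)) (mdim (open_submanifold M W)) c \<and>
    (\<forall>d\<in>mcharts (open_submanifold M W). smoothly_compatible (mdim (open_submanifold M W)) c d)"
  obtain U \<phi> where eq: "c = (U, \<phi>)" by (cases c)
  have "U \<subseteq> W" using is_chartD(2)[of "subtopology (mtop M) W" "mdim M" U \<phi>] c eq by auto
  then have ch: "is_chart (mtop M) (mdim M) (U, \<phi>)"
    using c is_chart_subtopology_iff[OF W] by (simp add: eq)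
  have "c \<in> mcharts M"
    unfolding eq
  proof (rule smooth_structureD(4)[OF M ch])
    fix d assume d: "d \<in> mcharts M"
    obtain V \<psi> where d_eq: "d = (V, \<psi>)" by (cases d)
    have V: "is_chart (mtop M) (mdim M) (V, \<psi>)" using smooth_structureD(1)[OF M d] d_eq by simp
    have "openin (mtop M) (V \<inter> W)" using is_chartD(1)[OF V] W by (rule openin_Int)
    then have d': "(V \<inter> W, \<psi>) \<in> mcharts M" using chart_restrict[OF M] d d_eq by auto
    then have "smoothly_compatible (mdim M) (U, \<phi>) (V \<inter> W, \<psi>)" using c eq by auto
    moreover have "U \<inter> (V \<inter> W) = U \<inter> V" using \<open>U \<subseteq> W\<close> by auto
    ultimately show "smoothly_compatible (mdim M) (U, \<phi>) d"
      unfolding d_eq smoothly_compatible_iff[OF ch V]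
        smoothly_compatible_iff[OF ch smooth_structureD(1)[OF M d']] by simp
  qed
  then show "c \<in> mcharts (open_submanifold M W)" using \<open>U \<subseteq> W\<close> eq by simp
qed

section \<open>Smoothness at a point\<close>

text \<open>
  The condition that \<^const>\<open>smooth_map\<close> imposes at each point. It depends on \<open>f\<close> near \<open>p\<close> only, so that maps
  defined on open subsets can be composed and paired without restricting the manifolds.
\<close>

definition smooth_at :: "'a manifold \<Rightarrow> 'b manifold \<Rightarrow> ('a \<Rightarrow> 'b) \<Rightarrow> 'a \<Rightarrow> bool" where
  "smooth_at M N f p \<longleftrightarrow> (\<exists>U \<phi> V \<psi>.
     (U, \<phi>) \<in> mcharts M \<and> p \<in> U \<and> (V, \<psi>) \<in> mcharts N \<and> f ` U \<subseteq> V \<and>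
     smooth_on (mdim M) (\<phi> ` U) (\<psi> \<circ> f \<circ> inv_into U \<phi>))"

lemma smooth_map_iff:
  "smooth_map M N f \<longleftrightarrow> f ` mspace M \<subseteq> mspace N \<and> (\<forall>p\<in>mspace M. smooth_at M N f p)"
  by (simp add: smooth_map_def smooth_at_def)

lemma smooth_at_alt:
  assumes M: "smooth_structure M"
  shows "smooth_at M N f p \<longleftrightarrow> (\<exists>U \<phi> V \<psi>. (U, \<phi>) \<in> mcharts M \<and> p \<in> U \<and> (V, \<psi>) \<in> mcharts N \<and>
    f ` U \<subseteq> V \<and> smooth_in_coord (mdim M) \<phi> U (\<lambda>q. \<psi> (f q)))"
proof -
  have "smooth_on (mdim M) (\<phi> ` U) (\<psi> \<circ> f \<circ> inv_into U \<phi>) \<longleftrightarrow>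
      smooth_in_coord (mdim M) \<phi> U (\<lambda>q. \<psi> (f q))" if "(U, \<phi>) \<in> mcharts M" for U \<phi> \<psi>
    using smooth_in_coord_iff_inv_into[OF smooth_structureD(1)[OF M that], of U "\<lambda>q. \<psi> (f q)"]
      chartD(1)[OF M that]
    by (simp add: o_def)
  then show ?thesis unfolding smooth_at_def by blast
qed

lemma smooth_atI:
  assumes M: "smooth_structure M"
    and c: "(U, \<phi>) \<in> mcharts M" and d: "(V, \<psi>) \<in> mcharts N"
    and W: "openin (mtop M) W" "W \<subseteq> U" "p \<in> W"
    and f: "f ` W \<subseteq> V" "smooth_in_coord (mdim M) \<phi> W (\<lambda>q. \<psi> (f q))"
  shows "smooth_at M N f p"
  unfolding smooth_at_alt[OF M] using chart_restrict[OF M c W(1,2)] d W(3) f by blast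

lemma smooth_at_imp_mspace:
  assumes "smooth_structure M" "smooth_structure N" "smooth_at M N f p"
  shows "p \<in> mspace M" "f p \<in> mspace N"
proof -
  obtain U \<phi> V \<psi> where c: "(U, \<phi>) \<in> mcharts M" "p \<in> U" "(V, \<psi>) \<in> mcharts N" "f ` U \<subseteq> V"
    using assms(3) unfolding smooth_at_def by blast
  show "p \<in> mspace M" using chartD(2)[OF assms(1) c(1)] c(2) by blast
  show "f p \<in> mspace N" using chartD(2)[OF assms(2) c(3)] c(2,4) by blast
qed

lemma smooth_at_open_preimage:
  assumes M: "smooth_structure M" and N: "smooth_structure N" and f: "smooth_at M N f p"
    and W: "openin (mtop N) W" "f p \<in> W"
  obtains O' where "openin (mtop M) O'" "p \<in> O'" "f ` O' \<subseteq> W"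
proof -
  obtain U \<phi> V \<psi> where c: "(U, \<phi>) \<in> mcharts M" "p \<in> U" "(V, \<psi>) \<in> mcharts N" "f ` U \<subseteq> V"
    "smooth_in_coord (mdim M) \<phi> U (\<lambda>q. \<psi> (f q))"
    using f unfolding smooth_at_alt[OF M] by blast
  have "openin (mtop M) {q \<in> U. f q \<in> W}"
    by (rule smooth_in_coord_open_preimage[OF smooth_structureD(1)[OF M c(1)]
          smooth_structureD(1)[OF N c(3)] c(4,5) W(1)])
  then show thesis using that c(2) W(2) by blast
qed

lemma smooth_map_imp_continuous_map:
  assumes M: "smooth_structure M" and N: "smooth_structure N" and f: "smooth_map M N f"
  shows "continuous_map (mtop M) (mtop N) f"
proof -
  have "openin (mtop M) {p \<in> mspace M. f p \<in> W}" if W: "openin (mtop N) W" for W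
  proof (subst openin_subopen, intro ballI)
    fix p assume p: "p \<in> {p \<in> mspace M. f p \<in> W}"
    then have "smooth_at M N f p" using f by (simp add: smooth_map_iff)
    then obtain O' where "openin (mtop M) O'" "p \<in> O'" "f ` O' \<subseteq> W"
      using smooth_at_open_preimage[OF M N _ W] p by blast
    then show "\<exists>T. openin (mtop M) T \<and> p \<in> T \<and> T \<subseteq> {p \<in> mspace M. f p \<in> W}"
      using openin_subset[of "mtop M" O'] by blast
  qed
  then show ?thesis using f by (auto simp: continuous_map_def smooth_map_iff)
qed

text \<open>Smoothness at a point can be tested in any charts: the transition maps are smooth.\<close>

lemma smooth_at_in_charts:
  assumes M: "smooth_structure M" and N: "smooth_structure N" and f: "smooth_at M N f p"
    and c: "(U, \<phi>) \<in> mcharts M" "p \<in> U" and d: "(V, \<psi>) \<in> mcharts N" "f p \<in> V"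
  obtains W where "openin (mtop M) W" "p \<in> W" "W \<subseteq> U" "f ` W \<subseteq> V"
    "smooth_in_coord (mdim M) \<phi> W (\<lambda>q. \<psi> (f q))"
proof -
  obtain U0 \<phi>0 V0 \<psi>0 where c0: "(U0, \<phi>0) \<in> mcharts M" "p \<in> U0" "(V0, \<psi>0) \<in> mcharts N" "f ` U0 \<subseteq> V0"
    "smooth_in_coord (mdim M) \<phi>0 U0 (\<lambda>q. \<psi>0 (f q))"
    using f unfolding smooth_at_alt[OF M] by blast
  note ch = smooth_structureD(1)[OF M] and ch' = smooth_structureD(1)[OF N]
  obtain O' where O': "openin (mtop M) O'" "p \<in> O'" "f ` O' \<subseteq> V"
    using smooth_at_open_preimage[OF M N f is_chartD(1)[OF ch'[OF d(1)]] d(2)] by blast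
  define W where "W = U \<inter> U0 \<inter> O'"
  have W: "openin (mtop M) W" "W \<subseteq> U" "W \<subseteq> U0"
    unfolding W_def by (auto intro!: openin_Int O' is_chartD(1)[OF ch[OF c(1)]] is_chartD(1)[OF ch[OF c0(1)]])
  have fW: "f ` W \<subseteq> V \<inter> V0" using O'(3) c0(4) by (auto simp: W_def)
  have VV: "openin (mtop N) (V \<inter> V0)"
    using is_chartD(1)[OF ch'[OF d(1)]] is_chartD(1)[OF ch'[OF c0(3)]] by (rule openin_Int)
  have "smooth_in_coord (mdim M) \<phi> W \<phi>0"
    using chart_transition[OF M c(1) c0(1)] by (rule smooth_in_coord_subset) (auto simp: W_def)
  then have "smooth_in_coord (mdim M) \<phi> W (\<lambda>q. \<psi>0 (f q))"
    using smooth_in_coord_compose[where f = "\<lambda>q. q" and W = W and W' = W and \<psi> = \<phi>0 and \<phi> = \<phi>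
        and n = "mdim M" and m = "mdim M" and g = "\<lambda>q. \<psi>0 (f q)"]
      is_chart_image_open[OF ch[OF c(1)] W(1,2)] is_chart_image_open[OF ch[OF c0(1)] W(1,3)]
      smooth_in_coord_subset[OF c0(5) W(3)] by simp
  moreover have "smooth_in_coord (mdim N) \<psi>0 (V \<inter> V0) \<psi>"
    using chart_transition[OF N c0(3) d(1)] by (simp add: Int_commute)
  moreover have "open_in_coords (mdim N) (\<psi>0 ` (V \<inter> V0))"
    by (rule is_chart_image_open[OF ch'[OF c0(3)] VV]) simp
  ultimately have "smooth_in_coord (mdim M) \<phi> W (\<lambda>q. \<psi> (f q))"
    using smooth_in_coord_compose[where f = f and W = W and W' = "V \<inter> V0" and \<psi> = \<psi>0 and \<phi> = \<phi>
        and n = "mdim M" and m = "mdim N" and g = \<psi>] is_chart_image_open[OF ch[OF c(1)] W(1,2)] fW by blast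
  then show thesis using that[OF W(1) _ W(2)] c(2) c0(2) O'(2) fW by (auto simp: W_def)
qed

lemma smooth_at_compose:
  assumes M: "smooth_structure M" and N: "smooth_structure N" and K: "smooth_structure K"
    and f: "smooth_at M N f p" and g: "smooth_at N K g (f p)"
  shows "smooth_at M K (\<lambda>q. g (f q)) p"
proof -
  obtain V \<psi> W \<theta> where g': "(V, \<psi>) \<in> mcharts N" "f p \<in> V" "(W, \<theta>) \<in> mcharts K" "g ` V \<subseteq> W"
    "smooth_in_coord (mdim N) \<psi> V (\<lambda>q. \<theta> (g q))"
    using g unfolding smooth_at_alt[OF N] by blast
  obtain U \<phi> where c: "(U, \<phi>) \<in> mcharts M" "p \<in> U"
    using smooth_structureD(3)[OF M smooth_at_imp_mspace(1)[OF M N f]] by blast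
  obtain O' where O': "openin (mtop M) O'" "p \<in> O'" "O' \<subseteq> U" "f ` O' \<subseteq> V"
    "smooth_in_coord (mdim M) \<phi> O' (\<lambda>q. \<psi> (f q))"
    using smooth_at_in_charts[OF M N f c g'(1,2)] by blast
  show ?thesis
  proof (rule smooth_atI[OF M c(1) g'(3) O'(1,3,2)])
    show "smooth_in_coord (mdim M) \<phi> O' (\<lambda>q. \<theta> (g (f q)))"
      using is_chart_image_open[OF smooth_structureD(1)[OF M c(1)] O'(1,3)]
        chartD(3)[OF N g'(1)] O'(4,5) g'(5)
      by (rule smooth_in_coord_compose)
  qed (use O'(4) g'(4) in auto)
qed

lemma smooth_at_cong:
  assumes M: "smooth_structure M" and f: "smooth_at M N f p"
    and W: "openin (mtop M) W" "p \<in> W" "\<And>q. q \<in> W \<Longrightarrow> f q = g q"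
  shows "smooth_at M N g p"
proof -
  obtain U \<phi> V \<psi> where c: "(U, \<phi>) \<in> mcharts M" "p \<in> U" "(V, \<psi>) \<in> mcharts N" "f ` U \<subseteq> V"
    "smooth_in_coord (mdim M) \<phi> U (\<lambda>q. \<psi> (f q))"
    using f unfolding smooth_at_alt[OF M] by blast
  have "smooth_in_coord (mdim M) \<phi> (U \<inter> W) (\<lambda>q. \<psi> (g q))"
    by (rule smooth_in_coord_cong[OF smooth_in_coord_subset[OF c(5)]]) (use W(3) in auto)
  then show ?thesis
    using c(2,4) W by (intro smooth_atI[OF M c(1,3), of "U \<inter> W"] openin_Int
        chartD(1)[OF M c(1)]) force+
qed

lemma smooth_at_id:
  assumes M: "smooth_structure M" and p: "p \<in> mspace M"
  shows "smooth_at M M (\<lambda>q. q) p"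
  using smooth_structureD(3)[OF M p] smooth_in_coord_self unfolding smooth_at_alt[OF M] by fastforce

lemma smooth_at_const:
  assumes M: "smooth_structure M" and N: "smooth_structure N" and p: "p \<in> mspace M" and c: "c \<in> mspace N"
  shows "smooth_at M N (\<lambda>_. c) p"
proof -
  obtain U \<phi> V \<psi> where "(U, \<phi>) \<in> mcharts M" "p \<in> U" "(V, \<psi>) \<in> mcharts N" "c \<in> V"
    using smooth_structureD(3)[OF M p] smooth_structureD(3)[OF N c] by blast
  then show ?thesis unfolding smooth_at_alt[OF M] using smooth_in_coord_const by blast
qed

lemma smooth_at_open_submanifold_domain:
  assumes M: "smooth_structure M" and W: "openin (mtop M) W" "p \<in> W"
  shows "smooth_at (open_submanifold M W) N f p \<longleftrightarrow> smooth_at M N f p"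
proof
  show "smooth_at (open_submanifold M W) N f p \<Longrightarrow> smooth_at M N f p"
    unfolding smooth_at_def by auto
  assume "smooth_at M N f p"
  then obtain U \<phi> V \<psi> where c: "(U, \<phi>) \<in> mcharts M" "p \<in> U" "(V, \<psi>) \<in> mcharts N" "f ` U \<subseteq> V"
    "smooth_in_coord (mdim M) \<phi> U (\<lambda>q. \<psi> (f q))"
    unfolding smooth_at_alt[OF M] by blast
  have "openin (mtop M) (U \<inter> W)"
    using chartD(1)[OF M c(1)] W(1) by (rule openin_Int)
  then have "(U \<inter> W, \<phi>) \<in> mcharts (open_submanifold M W)"
    using chart_restrict[OF M c(1)] by auto
  then show "smooth_at (open_submanifold M W) N f p"
    unfolding smooth_at_alt[OF smooth_structure_open_submanifold[OF M W(1)]]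
    using c W(2) smooth_in_coord_subset[OF c(5), of "U \<inter> W"]
    by (intro exI[of _ "U \<inter> W"] exI[of _ \<phi>] exI[of _ V] exI[of _ \<psi>]) auto
qed

lemma smooth_at_open_submanifold_codomain:
  assumes M: "smooth_structure M" and N: "smooth_structure N" and W: "openin (mtop N) W" "f p \<in> W"
  shows "smooth_at M (open_submanifold N W) f p \<longleftrightarrow> smooth_at M N f p"
proof
  show "smooth_at M (open_submanifold N W) f p \<Longrightarrow> smooth_at M N f p"
    unfolding smooth_at_def by auto
  assume f: "smooth_at M N f p"
  obtain U \<phi> V \<psi> where c: "(U, \<phi>) \<in> mcharts M" "p \<in> U" "(V, \<psi>) \<in> mcharts N" "f p \<in> V"
    using smooth_structureD(3)[OF M smooth_at_imp_mspace(1)[OF M N f]]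
      smooth_structureD(3)[OF N smooth_at_imp_mspace(2)[OF M N f]] by blast
  have "openin (mtop N) (V \<inter> W)"
    using chartD(1)[OF N c(3)] W(1) by (rule openin_Int)
  then have d: "(V \<inter> W, \<psi>) \<in> mcharts N" by (rule chart_restrict[OF N c(3)]) auto
  have fp: "f p \<in> V \<inter> W" using c(4) W(2) by auto
  obtain O' where "openin (mtop M) O'" "p \<in> O'" "O' \<subseteq> U" "f ` O' \<subseteq> V \<inter> W"
    "smooth_in_coord (mdim M) \<phi> O' (\<lambda>q. \<psi> (f q))"
    using smooth_at_in_charts[OF M N f c(1,2) d fp] by blast
  then show "smooth_at M (open_submanifold N W) f p"
    using d by (intro smooth_atI[OF M c(1), of "V \<inter> W" \<psi>]) auto
qed


section \<open>Differentials\<close>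

lemma differential_exists:
  assumes M: "smooth_structure M" and N: "smooth_structure N" and f: "smooth_at M N f p"
    and c: "(U, \<phi>) \<in> mcharts M" "p \<in> U" and d: "(V, \<psi>) \<in> mcharts N" "f p \<in> V"
  obtains D where "differential_in_charts M f p (U, \<phi>) (V, \<psi>) D" "D ` coord_space (mdim M) \<subseteq> coord_space (mdim N)"
proof -
  obtain W where W: "openin (mtop M) W" "p \<in> W" "W \<subseteq> U" "f ` W \<subseteq> V"
    "smooth_in_coord (mdim M) \<phi> W (\<lambda>q. \<psi> (f q))"
    using smooth_at_in_charts[OF assms] by blast
  note ch = smooth_structureD(1)[OF M c(1)] and ch' = smooth_structureD(1)[OF N d(1)]
  let ?F = "\<psi> \<circ> f \<circ> inv_into U \<phi>"
  have op: "open_in_coords (mdim M) (\<phi> ` W)" by (rule is_chart_image_open[OF ch W(1,3)])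
  have "smooth_on (mdim M) (\<phi> ` W) ?F"
    using W(5) unfolding smooth_in_coord_iff_inv_into[OF ch W(1,3)] by (simp add: o_def)
  then obtain D where D: "(?F has_derivative D x) (at x within coord_space (mdim M))" if "x \<in> \<phi> ` W" for x
    using smooth_on_derivative[OF op] by metis
  have D: "(?F has_derivative D (\<phi> p)) (at (\<phi> p) within coord_space (mdim M))" using D W(2) by blast
  have F: "?F x \<in> coord_space (mdim N)" if "x \<in> \<phi> ` W" for x
    using that W(3,4) is_chartD(4)[OF ch'] is_chartD(5)[OF ch] by (auto simp: subset_iff image_subset_iff)
  have "D (\<phi> p) v \<in> coord_space (mdim N)" if "v \<in> coord_space (mdim M)" for v
  proof (rule derivative_in_coord_space[OF D _ _ _ that])
    have p: "\<phi> p \<in> \<phi> ` W" using W(2) by blast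
    show "\<forall>\<^sub>F y in at (\<phi> p) within coord_space (mdim M). ?F y \<in> coord_space (mdim N)"
      unfolding at_within_coords[OF op p, symmetric] eventually_at_filter
      using F by (intro always_eventually) blast
    show "?F (\<phi> p) \<in> coord_space (mdim N)" using F p by blast
    show "\<phi> p \<in> coord_space (mdim M)" using is_chartD(4)[OF ch] c(2) by blast
  qed
  with D show thesis by (intro that) (auto simp: differential_in_charts_def)
qed

lemma differential_unique:
  assumes M: "smooth_structure M" and c: "(U, \<phi>) \<in> mcharts M" "p \<in> U"
    and D: "differential_in_charts M f p (U, \<phi>) d D" "differential_in_charts M f p (U, \<phi>) d D'"
    and v: "v \<in> coord_space (mdim M)"
  shows "D v = D' v"
proof (cases d)
  case (Pair V \<psi>)
  have "\<phi> p \<in> coord_space (mdim M)" using chartD(4)[OF M c(1)] c(2) by blast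
  then show ?thesis
    using has_derivative_coord_space_unique[OF D[unfolded differential_in_charts_def Pair prod.case] _ v] by blast
qed

lemma differential_cong:
  assumes M: "smooth_structure M" and c: "(U, \<phi>) \<in> mcharts M"
    and W: "openin (mtop M) W" "p \<in> W" "W \<subseteq> U" "\<And>q. q \<in> W \<Longrightarrow> f q = g q"
    and D: "differential_in_charts M f p (U, \<phi>) (V, \<psi>) D"
  shows "differential_in_charts M g p (U, \<phi>) (V, \<psi>) D"
proof -
  note ch = smooth_structureD(1)[OF M c]
  have op: "open_in_coords (mdim M) (\<phi> ` W)" by (rule is_chart_image_open[OF ch W(1,3)])
  have p: "\<phi> p \<in> \<phi> ` W" using W(2) by blast
  have inv: "inv_into U \<phi> (\<phi> q) = q" if "q \<in> W" for q
    using that W(3) is_chartD(5)[OF ch] by auto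
  have "(\<psi> \<circ> f \<circ> inv_into U \<phi> has_derivative D) (at (\<phi> p) within \<phi> ` W)"
    using D by (simp add: differential_in_charts_def at_within_coords[OF op p])
  then have "(\<psi> \<circ> g \<circ> inv_into U \<phi> has_derivative D) (at (\<phi> p) within \<phi> ` W)"
    by (rule has_derivative_transform[OF p, rotated]) (auto simp: inv W(4))
  then show ?thesis
    by (simp add: differential_in_charts_def at_within_coords[OF op p])
qed

lemma differential_compose:
  assumes M: "smooth_structure M" and N: "smooth_structure N" and f: "smooth_at M N f p"
    and c: "(U, \<phi>) \<in> mcharts M" "p \<in> U" and d: "(V, \<psi>) \<in> mcharts N" "f p \<in> V"
    and D: "differential_in_charts M f p (U, \<phi>) (V, \<psi>) D"
    and D': "differential_in_charts N g (f p) (V, \<psi>) (W, \<theta>) D'"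
  shows "differential_in_charts M (\<lambda>q. g (f q)) p (U, \<phi>) (W, \<theta>) (\<lambda>v. D' (D v))"
proof -
  obtain O' where O': "openin (mtop M) O'" "p \<in> O'" "O' \<subseteq> U" "f ` O' \<subseteq> V"
    "smooth_in_coord (mdim M) \<phi> O' (\<lambda>q. \<psi> (f q))"
    using smooth_at_in_charts[OF M N f c d] by blast
  note ch = smooth_structureD(1)[OF M c(1)] and ch' = smooth_structureD(1)[OF N d(1)]
  let ?F = "\<psi> \<circ> f \<circ> inv_into U \<phi>" and ?G = "\<theta> \<circ> g \<circ> inv_into V \<psi>"
  have op: "open_in_coords (mdim M) (\<phi> ` O')" by (rule is_chart_image_open[OF ch O'(1,3)])
  have p: "\<phi> p \<in> \<phi> ` O'" using O'(2) by blast
  have inv: "inv_into U \<phi> (\<phi> q) = q" if "q \<in> O'" for q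
    using that O'(3) is_chartD(5)[OF ch] by auto
  have inv': "inv_into V \<psi> (\<psi> (f q)) = f q" if "q \<in> O'" for q
    using that O'(4) is_chartD(5)[OF ch'] by auto
  have F: "(?F has_derivative D) (at (\<phi> p) within \<phi> ` O')"
    using D by (simp add: differential_in_charts_def at_within_coords[OF op p])
  have Fp: "?F (\<phi> p) = \<psi> (f p)" using inv[OF O'(2)] by simp
  have "?F ` \<phi> ` O' \<subseteq> coord_space (mdim N)"
    using inv O'(4) is_chartD(4)[OF ch'] by (auto simp: image_subset_iff)
  then have "(?G has_derivative D') (at (?F (\<phi> p)) within ?F ` \<phi> ` O')"
    using D' unfolding Fp differential_in_charts_def by (auto intro: has_derivative_subset)
  from has_derivative_in_compose[OF F this]
  have "((\<theta> \<circ> (\<lambda>q. g (f q)) \<circ> inv_into U \<phi>) has_derivative (\<lambda>v. D' (D v))) (at (\<phi> p) within \<phi> ` O')"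
    by (rule has_derivative_transform[OF p, rotated]) (use inv inv' in auto)
  then show ?thesis
    by (simp add: differential_in_charts_def at_within_coords[OF op p])
qed

text \<open>By the chain rule, a local left inverse of \<open>f\<close> has a differential that is left inverse to
  that of \<open>f\<close>.\<close>

lemma differential_left_inverse:
  assumes M: "smooth_structure M" and N: "smooth_structure N"
    and f: "smooth_at M N f p" and g: "smooth_at N M g (f p)"
    and W: "openin (mtop M) W" "p \<in> W" "\<And>q. q \<in> W \<Longrightarrow> g (f q) = q"
    and c: "(U, \<phi>) \<in> mcharts M" "p \<in> U" and d: "(V, \<psi>) \<in> mcharts N" "f p \<in> V"
    and D: "differential_in_charts M f p (U, \<phi>) (V, \<psi>) D"
    and D': "differential_in_charts N g (f p) (V, \<psi>) (U, \<phi>) D'"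
    and v: "v \<in> coord_space (mdim M)"
  shows "D' (D v) = v"
proof -
  note ch = smooth_structureD(1)[OF M c(1)]
  have "differential_in_charts M (\<lambda>q. g (f q)) p (U, \<phi>) (U, \<phi>) (\<lambda>v. D' (D v))"
    by (rule differential_compose[OF M N f c d D D'])
  then have 1: "differential_in_charts M (\<lambda>q. q) p (U, \<phi>) (U, \<phi>) (\<lambda>v. D' (D v))"
    by (rule differential_cong[OF M c(1) openin_Int[OF W(1) is_chartD(1)[OF ch]], rotated 3])
       (use W c in auto)
  have p: "\<phi> p \<in> \<phi> ` U" using c(2) by blast
  have "(\<phi> \<circ> (\<lambda>q. q) \<circ> inv_into U \<phi> has_derivative (\<lambda>v. v)) (at (\<phi> p) within \<phi> ` U)"
    by (rule has_derivative_transform[OF p _ has_derivative_ident]) (auto simp: f_inv_into_f)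
  then have "differential_in_charts M (\<lambda>q. q) p (U, \<phi>) (U, \<phi>) (\<lambda>v. v)"
    by (simp add: differential_in_charts_def at_within_coords[OF is_chartD(3)[OF ch] p])
  from differential_unique[OF M c 1 this v] show ?thesis .
qed

lemma immersion_if_local_left_inverses:
  assumes M: "smooth_structure M" and N: "smooth_structure N" and f: "smooth_map M N f"
    and inv: "\<And>p. p \<in> mspace M \<Longrightarrow> \<exists>g W. smooth_at N M g (f p) \<and> openin (mtop M) W \<and> p \<in> W \<and>
      (\<forall>q\<in>W. g (f q) = q)"
  shows "immersion M N f"
  unfolding immersion_def
proof (intro conjI f ballI impI)
  fix p c d assume p: "p \<in> mspace M" and cd: "c \<in> mcharts M" "d \<in> mcharts N" "p \<in> fst c \<and> f p \<in> fst d"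
  obtain U \<phi> V \<psi> where eq: "c = (U, \<phi>)" "d = (V, \<psi>)" by (cases c, cases d)
  note c = cd(1)[unfolded eq] and d = cd(2)[unfolded eq]
  have in_U: "p \<in> U" "f p \<in> V" using cd(3) eq by auto
  have fp: "smooth_at M N f p" using f p by (simp add: smooth_map_iff)
  obtain g W where g: "smooth_at N M g (f p)" "openin (mtop M) W" "p \<in> W" "\<And>q. q \<in> W \<Longrightarrow> g (f q) = q"
    using inv[OF p] by blast
  from differential_exists[OF M N fp c in_U(1) d in_U(2)]
  obtain D where D: "differential_in_charts M f p (U, \<phi>) (V, \<psi>) D"
    "D ` coord_space (mdim M) \<subseteq> coord_space (mdim N)" by blast
  have "g (f p) \<in> U" using g(3,4) in_U by simp
  from differential_exists[OF N M g(1) d in_U(2) c this]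
  obtain D' where D': "differential_in_charts N g (f p) (V, \<psi>) (U, \<phi>) D'"
    "D' ` coord_space (mdim N) \<subseteq> coord_space (mdim M)" by blast
  have "inj_on D (coord_space (mdim M))"
    using differential_left_inverse[OF M N fp g c in_U(1) d in_U(2) D(1) D'(1)] by (rule inj_on_inverseI)
  with D(1) show "\<exists>D. differential_in_charts M f p c d D \<and> inj_on D (coord_space (mdim M))"
    unfolding eq by blast
qed

text \<open>
  If \<open>s\<close> is a local section through \<open>p\<close>, the differential of \<open>f\<close> is a left inverse of that of \<open>s\<close>, hence onto.
\<close>

lemma submersion_if_local_sections:
  assumes M: "smooth_structure M" and N: "smooth_structure N" and f: "smooth_map M N f"
    and sec: "\<And>p. p \<in> mspace M \<Longrightarrow> \<exists>s W. smooth_at N M s (f p) \<and> s (f p) = p \<and>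
      openin (mtop N) W \<and> f p \<in> W \<and> (\<forall>q\<in>W. f (s q) = q)"
  shows "submersion M N f"
  unfolding submersion_def
proof (intro conjI f ballI impI)
  fix p c d assume p: "p \<in> mspace M" and cd: "c \<in> mcharts M" "d \<in> mcharts N" "p \<in> fst c \<and> f p \<in> fst d"
  obtain U \<phi> V \<psi> where eq: "c = (U, \<phi>)" "d = (V, \<psi>)" by (cases c, cases d)
  note c = cd(1)[unfolded eq] and d = cd(2)[unfolded eq]
  have in_U: "p \<in> U" "f p \<in> V" using cd(3) eq by auto
  have fp: "smooth_at M N f p" using f p by (simp add: smooth_map_iff)
  obtain s W where s: "smooth_at N M s (f p)" "s (f p) = p"
    "openin (mtop N) W" "f p \<in> W" "\<And>q. q \<in> W \<Longrightarrow> f (s q) = q"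
    using sec[OF p] by blast
  obtain D where D: "differential_in_charts M f p (U, \<phi>) (V, \<psi>) D" "D ` coord_space (mdim M) \<subseteq> coord_space (mdim N)"
    using differential_exists[OF M N fp c in_U(1) d in_U(2)] by blast
  obtain D' where D': "differential_in_charts N s (f p) (V, \<psi>) (U, \<phi>) D'"
      "D' ` coord_space (mdim N) \<subseteq> coord_space (mdim M)"
    using differential_exists[OF N M s(1) d in_U(2) c] s(2) in_U(1) by metis
  have "D (D' v) = v" if "v \<in> coord_space (mdim N)" for v
    by (rule differential_left_inverse[OF N M s(1) _ s(3,4,5) d in_U(2) c _ D'(1) _ that])
       (simp_all add: s(2) fp in_U D)
  then have "coord_space (mdim N) \<subseteq> D ` coord_space (mdim M)"
    using D'(2) by (metis image_subset_iff image_eqI subsetI)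
  with D show "\<exists>D. differential_in_charts M f p c d D \<and> D ` coord_space (mdim M) = coord_space (mdim N)"
    unfolding eq by blast
qed

lemma submersion_compose:
  assumes M: "smooth_structure M" and N: "smooth_structure N" and K: "smooth_structure K"
    and f: "submersion M N f" and g: "submersion N K g"
  shows "submersion M K (\<lambda>p. g (f p))"
  unfolding submersion_def
proof (intro conjI ballI impI)
  have sf: "smooth_map M N f" and sg: "smooth_map N K g" using f g by (auto simp: submersion_def)
  show "smooth_map M K (\<lambda>p. g (f p))"
    using sf sg smooth_at_compose[OF M N K] by (auto simp: smooth_map_iff image_subset_iff)
  fix p c e assume p: "p \<in> mspace M" and ce: "c \<in> mcharts M" "e \<in> mcharts K" "p \<in> fst c \<and> g (f p) \<in> fst e"
  have fp: "f p \<in> mspace N" "smooth_at M N f p" using sf p by (auto simp: smooth_map_iff)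
  obtain V \<psi> where d: "(V, \<psi>) \<in> mcharts N" "f p \<in> V" using smooth_structureD(3)[OF N fp(1)] by blast
  obtain U \<phi> W \<theta> where eq: "c = (U, \<phi>)" "e = (W, \<theta>)" by (cases c, cases e)
  obtain D where D: "differential_in_charts M f p (U, \<phi>) (V, \<psi>) D" "D ` coord_space (mdim M) = coord_space (mdim N)"
    using f p ce d eq unfolding submersion_def by fastforce
  obtain D' where D': "differential_in_charts N g (f p) (V, \<psi>) (W, \<theta>) D'" "D' ` coord_space (mdim N) = coord_space (mdim K)"
    using g fp(1) ce d eq unfolding submersion_def by fastforce
  have "differential_in_charts M (\<lambda>p. g (f p)) p (U, \<phi>) (W, \<theta>) (\<lambda>v. D' (D v))"
    by (rule differential_compose[OF M N fp(2) _ _ d D(1) D'(1)]) (use ce eq in auto)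
  moreover have "(\<lambda>v. D' (D v)) ` coord_space (mdim M) = coord_space (mdim K)"
    using D(2) D'(2) by (metis image_image)
  ultimately show "\<exists>D. differential_in_charts M (\<lambda>p. g (f p)) p c e D \<and>
      D ` coord_space (mdim M) = coord_space (mdim K)"
    unfolding eq by blast
qed

lemma diffeomorphism_imp_submersion:
  assumes M: "smooth_structure M" and N: "smooth_structure N" and f: "diffeomorphism M N f"
  shows "submersion M N f"
proof (rule submersion_if_local_sections[OF M N])
  show "smooth_map M N f" using f by (simp add: diffeomorphism_def)
  fix p assume p: "p \<in> mspace M"
  have bij: "bij_betw f (mspace M) (mspace N)" using f by (simp add: diffeomorphism_def)
  then have fp: "f p \<in> mspace N" using p by (auto simp: bij_betw_def)
  have "smooth_at N M (inv_into (mspace M) f) (f p)"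
    using f fp by (simp add: diffeomorphism_def smooth_map_iff)
  then show "\<exists>s W. smooth_at N M s (f p) \<and> s (f p) = p \<and>
      openin (mtop N) W \<and> f p \<in> W \<and> (\<forall>q\<in>W. f (s q) = q)"
    using bij p fp
    by (intro exI[of _ "inv_into (mspace M) f"] exI[of _ "mspace N"])
       (auto simp: bij_betw_def f_inv_into_f)
qed

lemma submersion_cong:
  assumes M: "smooth_structure M" and eq: "\<And>p. p \<in> mspace M \<Longrightarrow> f p = g p" and f: "submersion M N f"
  shows "submersion M N g"
  unfolding submersion_def
proof (intro conjI ballI impI)
  show "smooth_map M N g"
    using f eq smooth_at_cong[OF M _ openin_topspace, of N f _ g] by (auto simp: submersion_def smooth_map_iff)
  fix p c d assume p: "p \<in> mspace M" and cd: "c \<in> mcharts M" "d \<in> mcharts N" "p \<in> fst c \<and> g p \<in> fst d"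
  obtain U \<phi> V \<psi> where cd_eq: "c = (U, \<phi>)" "d = (V, \<psi>)" by (cases c, cases d)
  note ch = smooth_structureD(1)[OF M cd(1)[unfolded cd_eq]]
  have "p \<in> fst c \<and> f p \<in> fst d" using cd(3) eq[OF p] by simp
  then obtain D where D: "differential_in_charts M f p c d D" "D ` coord_space (mdim M) = coord_space (mdim N)"
    using f p cd unfolding submersion_def by blast
  have "differential_in_charts M g p (U, \<phi>) (V, \<psi>) D"
    by (rule differential_cong[OF M cd(1)[unfolded cd_eq] is_chartD(1)[OF ch] _ _ eq D(1)[unfolded cd_eq]])
       (use cd is_chartD(2)[OF ch] in \<open>auto simp: cd_eq\<close>)
  with D(2) show "\<exists>D. differential_in_charts M g p c d D \<and> D ` coord_space (mdim M) = coord_space (mdim N)"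
    unfolding cd_eq by blast
qed

section \<open>Products\<close>

text \<open>
  On pairs from \<^term>\<open>coord_space m\<close> and \<^term>\<open>coord_space n\<close>, \<^term>\<open>coord_append m\<close> and the two components
  of its inverse agree with the following maps, which are bounded linear on the whole ambient space.
\<close>

definition take_coords :: "nat \<Rightarrow> rvec \<Rightarrow> rvec" where
  "take_coords m w = (\<Sum>i<m. coord w i *\<^sub>R unit_vec i)"

definition drop_coords :: "nat \<Rightarrow> nat \<Rightarrow> rvec \<Rightarrow> rvec" where
  "drop_coords m n w = (\<Sum>j<n. coord w (m + j) *\<^sub>R unit_vec j)"

definition shift_coords :: "nat \<Rightarrow> nat \<Rightarrow> rvec \<Rightarrow> rvec" where
  "shift_coords m n v = (\<Sum>j<n. coord v j *\<^sub>R unit_vec (m + j))"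

lemma bounded_linear_coords:
  "bounded_linear (take_coords m)" "bounded_linear (drop_coords m n)" "bounded_linear (shift_coords m n)"
  unfolding take_coords_def[abs_def] drop_coords_def[abs_def] shift_coords_def[abs_def]
  by (intro bounded_linear_sum bounded_linear_scaleR_const bounded_linear_lookup)+

lemma lookup_take_coords: "coord (take_coords m w) i = (if i < m then coord w i else 0)"
  by (simp add: take_coords_def lookup_sum lookup_single when_def if_distrib[of "\<lambda>t. _ * t"] cong: if_cong)

lemma lookup_drop_coords:
  "coord (drop_coords m n w) i = (if i < n then coord w (m + i) else 0)"
  by (simp add: drop_coords_def lookup_sum lookup_single when_def if_distrib[of "\<lambda>t. _ * t"] cong: if_cong)

lemma lookup_shift_coords:
  "coord (shift_coords m n v) i = (if m \<le> i \<and> i < m + n then coord v (i - m) else 0)"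
proof -
  have "coord (shift_coords m n v) i = (\<Sum>j<n. if m + j = i then coord v j else 0)"
    by (simp add: shift_coords_def lookup_sum lookup_single when_def if_distrib[of "\<lambda>t. _ * t"] cong: if_cong)
  also have "\<dots> = (\<Sum>j<n. if j = i - m then (if m \<le> i then coord v (i - m) else 0) else 0)"
    by (intro sum.cong) auto
  finally show ?thesis by (auto simp: sum.delta)
qed

lemma lookup_coord_append:
  "coord (coord_append m u v) i =
    (if i < m then coord u i else coord v (i - m))"
proof -
  have "finite {i. (if i < m then coord u i else coord v (i - m)) \<noteq> 0}"
  proof (rule finite_subset)
    show "{i. (if i < m then coord u i else coord v (i - m)) \<noteq> 0} \<subseteq>
        {..<m} \<union> (\<lambda>j. j + m) ` Poly_Mapping.keys v"
    proof
      fix i assume i: "i \<in> {i. (if i < m then coord u i else coord v (i - m)) \<noteq> 0}"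
      show "i \<in> {..<m} \<union> (\<lambda>j. j + m) ` Poly_Mapping.keys v"
      proof (cases "i < m")
        case False
        then have "i = (i - m) + m" "i - m \<in> Poly_Mapping.keys v" using i by (auto simp: in_keys_iff)
        then show ?thesis by blast
      qed simp
    qed
  qed auto
  then show ?thesis by (simp add: coord_append_def)
qed

lemma coord_append_eq:
  assumes "u \<in> coord_space m" "v \<in> coord_space n"
  shows "coord_append m u v = u + shift_coords m n v" "coord_append m u v \<in> coord_space (m + n)"
    "take_coords m (coord_append m u v) = u" "drop_coords m n (coord_append m u v) = v"
  using assms
  by (auto intro!: poly_mapping_eqI
      simp: lookup_coord_append lookup_add lookup_take_coords lookup_drop_coords lookup_shift_coords coord_space_iff)

lemma coord_append_take_drop:
  assumes "w \<in> coord_space (m + n)"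
  shows "coord_append m (take_coords m w) (drop_coords m n w) = w"
  by (rule poly_mapping_eqI)
     (use assms in \<open>auto simp: lookup_coord_append lookup_take_coords lookup_drop_coords coord_space_iff\<close>)

lemma take_drop_in_coord_space: "take_coords m w \<in> coord_space m" "drop_coords m n w \<in> coord_space n"
  by (auto simp: coord_space_iff lookup_take_coords lookup_drop_coords)

lemma continuous_on_coords:
  "continuous_on S (take_coords m)" "continuous_on S (drop_coords m n)" "continuous_on S (shift_coords m n)"
  using bounded_linear_coords linear_continuous_on by blast+

abbreviation product_coord :: "nat \<Rightarrow> ('a \<Rightarrow> rvec) \<Rightarrow> ('b \<Rightarrow> rvec) \<Rightarrow> 'a \<times> 'b \<Rightarrow> rvec" where
  "product_coord m \<phi> \<psi> \<equiv> \<lambda>(x, y). coord_append m (\<phi> x) (\<psi> y)"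

text \<open>
  The image of a product chart is cut out of the coordinate space by the conditions that the first \<open>m\<close> and
  the last \<open>n\<close> coordinates lie in the images of the factors, which are open conditions.
\<close>

lemma is_chart_product:
  assumes c: "is_chart X m (U, \<phi>)" and d: "is_chart Y n (V, \<psi>)"
  shows "is_chart (prod_topology X Y) (m + n) (U \<times> V, product_coord m \<phi> \<psi>)"
proof -
  note U = is_chartD[OF c] and V = is_chartD[OF d]
  let ?F = "product_coord m \<phi> \<psi>"
  let ?I = "{w \<in> coord_space (m + n). take_coords m w \<in> \<phi> ` U \<and> drop_coords m n w \<in> \<psi> ` V}"
  have phi: "\<phi> x \<in> coord_space m" if "x \<in> U" for x using U(4) that by blast
  have psi: "\<psi> y \<in> coord_space n" if "y \<in> V" for y using V(4) that by blast
  have img: "?F ` (U \<times> V) = ?I"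
  proof safe
    fix w x y assume w: "w \<in> coord_space (m + n)" "take_coords m w = \<phi> x" "x \<in> U" "drop_coords m n w = \<psi> y" "y \<in> V"
    show "w \<in> ?F ` (U \<times> V)"
      by (rule image_eqI[of _ _ "(x, y)"]) (use coord_append_take_drop[OF w(1)] w in auto)
  qed (auto simp: coord_append_eq(2-4)[OF phi psi])
  have op: "open_in_coords (m + n) (?F ` (U \<times> V))"
  proof -
    have "open_in_coords (m + n) (coord_space (m + n) \<inter> take_coords m -` (\<phi> ` U))"
      by (rule continuous_openin_preimage[OF continuous_on_coords(1) _ U(3)]) (auto simp: take_drop_in_coord_space)
    moreover have "open_in_coords (m + n) (coord_space (m + n) \<inter> drop_coords m n -` (\<psi> ` V))"
      by (rule continuous_openin_preimage[OF continuous_on_coords(2) _ V(3)]) (auto simp: take_drop_in_coord_space)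
    ultimately have "open_in_coords (m + n) ((coord_space (m + n) \<inter> take_coords m -` (\<phi> ` U)) \<inter>
        (coord_space (m + n) \<inter> drop_coords m n -` (\<psi> ` V)))" by (rule openin_Int)
    then show ?thesis unfolding img by (rule back_subst[of "openin _"]) auto
  qed
  obtain \<phi>' where \<phi>': "homeomorphic_maps (subtopology X U) (top_of_set (\<phi> ` U)) \<phi> \<phi>'"
    using U(6) homeomorphic_map_maps by blast
  obtain \<psi>' where \<psi>': "homeomorphic_maps (subtopology Y V) (top_of_set (\<psi> ` V)) \<psi> \<psi>'"
    using V(6) homeomorphic_map_maps by blast
  have U': "U \<inter> topspace X = U" "topspace X \<inter> U = U" "V \<inter> topspace Y = V" "topspace Y \<inter> V = V"
    using U(2) V(2) by auto
  have "homeomorphic_maps (subtopology (prod_topology X Y) (U \<times> V)) (top_of_set (?F ` (U \<times> V))) ?F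
      (\<lambda>w. (\<phi>' (take_coords m w), \<psi>' (drop_coords m n w)))"
    unfolding homeomorphic_maps_def subtopology_Times
  proof (intro conjI ballI)
    let ?XY = "prod_topology (subtopology X U) (subtopology Y V)"
    have "continuous_map ?XY euclidean (\<lambda>p. \<phi> (fst p) + shift_coords m n (\<psi> (snd p)))"
    proof (rule continuous_map_add)
      have "continuous_map (subtopology X U) euclidean \<phi>" "continuous_map (subtopology Y V) euclidean \<psi>"
        using \<phi>' \<psi>' by (auto simp: homeomorphic_maps_def intro: continuous_map_into_fulltopology)
      then show "continuous_map ?XY euclidean (\<lambda>p. \<phi> (fst p))"
        and "continuous_map ?XY euclidean (\<lambda>p. shift_coords m n (\<psi> (snd p)))"
        using continuous_on_coords(3)[of UNIV]
        by (auto intro: continuous_map_compose[unfolded o_def, OF continuous_map_fst]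
            continuous_map_compose[unfolded o_def, OF continuous_map_compose[unfolded o_def, OF continuous_map_snd]])
    qed
    then have "continuous_map ?XY euclidean ?F"
      by (rule continuous_map_eq) (auto simp: U' coord_append_eq(1)[OF phi psi])
    then show "continuous_map ?XY (top_of_set (?F ` (U \<times> V))) ?F"
      by (auto simp: continuous_map_in_subtopology U')
    have "continuous_map (top_of_set ?I) (subtopology X U) (\<lambda>w. \<phi>' (take_coords m w))"
      by (rule continuous_map_compose[unfolded o_def, where X' = "top_of_set (\<phi> ` U)"])
         (use \<phi>' in \<open>auto simp: homeomorphic_maps_def continuous_on_coords\<close>)
    moreover have "continuous_map (top_of_set ?I) (subtopology Y V) (\<lambda>w. \<psi>' (drop_coords m n w))"
      by (rule continuous_map_compose[unfolded o_def, where X' = "top_of_set (\<psi> ` V)"])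
         (use \<psi>' in \<open>auto simp: homeomorphic_maps_def continuous_on_coords\<close>)
    ultimately show "continuous_map (top_of_set (?F ` (U \<times> V))) ?XY (\<lambda>w. (\<phi>' (take_coords m w), \<psi>' (drop_coords m n w)))"
      unfolding img by (simp add: continuous_map_pairedI)
  next
    fix p assume "p \<in> topspace (prod_topology (subtopology X U) (subtopology Y V))"
    then obtain x y where "p = (x, y)" "x \<in> U" "y \<in> V" by auto
    then show "(\<phi>' (take_coords m (?F p)), \<psi>' (drop_coords m n (?F p))) = p"
      using \<phi>' \<psi>' by (simp add: coord_append_eq(3,4)[OF phi psi] homeomorphic_maps_def U')
  next
    fix w assume "w \<in> topspace (top_of_set (?F ` (U \<times> V)))"
    then have "w \<in> ?I" unfolding img by simp
    then show "?F (\<phi>' (take_coords m w), \<psi>' (drop_coords m n w)) = w"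
      using \<phi>' \<psi>' coord_append_take_drop[of w m n] by (auto simp: homeomorphic_maps_def)
  qed
  then have "homeomorphic_map (subtopology (prod_topology X Y) (U \<times> V)) (top_of_set (?F ` (U \<times> V))) ?F"
    using homeomorphic_map_maps by blast
  then show ?thesis
    using op U(1) V(1) by (simp add: is_chart_def openin_prod_Times_iff)
qed

lemma smooth_in_product_coord:
  assumes "\<And>x. x \<in> U \<Longrightarrow> \<phi> x \<in> coord_space m" "\<And>y. y \<in> V \<Longrightarrow> \<psi> y \<in> coord_space n"
  shows "smooth_in_coord N (product_coord m \<phi> \<psi>) (U \<times> V) (\<lambda>p. \<phi> (fst p))"
    and "smooth_in_coord N (product_coord m \<phi> \<psi>) (U \<times> V) (\<lambda>p. \<psi> (snd p))"
proof -
  let ?F = "product_coord m \<phi> \<psi>"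
  have "smooth_in_coord N ?F (U \<times> V) (\<lambda>p. take_coords m (?F p))"
    by (rule smooth_in_coord_bounded_linear[OF bounded_linear_coords(1) smooth_in_coord_self])
  then show "smooth_in_coord N ?F (U \<times> V) (\<lambda>p. \<phi> (fst p))"
    by (rule smooth_in_coord_cong) (auto simp: coord_append_eq(3,4)[OF assms])
  have "smooth_in_coord N ?F (U \<times> V) (\<lambda>p. drop_coords m n (?F p))"
    by (rule smooth_in_coord_bounded_linear[OF bounded_linear_coords(2) smooth_in_coord_self])
  then show "smooth_in_coord N ?F (U \<times> V) (\<lambda>p. \<psi> (snd p))"
    by (rule smooth_in_coord_cong) (auto simp: coord_append_eq(3,4)[OF assms])
qed

lemma smooth_in_coord_append:
  assumes "\<And>p. p \<in> W \<Longrightarrow> f p \<in> coord_space m" "\<And>p. p \<in> W \<Longrightarrow> g p \<in> coord_space n"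
    and "smooth_in_coord N \<phi> W f" "smooth_in_coord N \<phi> W g"
  shows "smooth_in_coord N \<phi> W (\<lambda>p. coord_append m (f p) (g p))"
  by (rule smooth_in_coord_cong[OF smooth_in_coord_add[OF assms(3)
        smooth_in_coord_bounded_linear[OF bounded_linear_coords(3)[of m n] assms(4)]]])
     (simp add: coord_append_eq[OF assms(1,2)])

definition product_atlas :: "'a manifold \<Rightarrow> 'b manifold \<Rightarrow> ('a \<times> 'b) chart set" where
  "product_atlas M N = {(U \<times> V, product_coord (mdim M) \<phi> \<psi>) | U \<phi> V \<psi>. (U, \<phi>) \<in> mcharts M \<and> (V, \<psi>) \<in> mcharts N}"

lemma product_manifold_eq:
  "product_manifold M N = manifold_of_atlas (prod_topology (mtop M) (mtop N)) (mdim M + mdim N) (product_atlas M N)"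
  by (simp add: product_manifold_def product_atlas_def)

lemma product_transition:
  assumes M: "smooth_structure M" and N: "smooth_structure N"
    and c: "(U, \<phi>) \<in> mcharts M" "(U', \<phi>') \<in> mcharts M" and d: "(V, \<psi>) \<in> mcharts N" "(V', \<psi>') \<in> mcharts N"
  shows "smooth_in_coord (mdim M + mdim N) (product_coord (mdim M) \<phi> \<psi>) ((U \<inter> U') \<times> (V \<inter> V'))
    (product_coord (mdim M) \<phi>' \<psi>')"
proof -
  note ch = smooth_structureD(1)[OF M] and ch' = smooth_structureD(1)[OF N]
  let ?F = "product_coord (mdim M) \<phi> \<psi>" and ?W = "(U \<inter> U') \<times> (V \<inter> V')"
  have UU: "openin (mtop M) (U \<inter> U')" by (intro openin_Int is_chartD(1)[OF ch[OF c(1)]] is_chartD(1)[OF ch[OF c(2)]])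
  have VV: "openin (mtop N) (V \<inter> V')" by (intro openin_Int is_chartD(1)[OF ch'[OF d(1)]] is_chartD(1)[OF ch'[OF d(2)]])
  have phi: "\<phi> x \<in> coord_space (mdim M)" "\<phi>' x \<in> coord_space (mdim M)" if "x \<in> U \<inter> U'" for x
    using is_chartD(4)[OF ch[OF c(1)]] is_chartD(4)[OF ch[OF c(2)]] that by auto
  have psi: "\<psi> x \<in> coord_space (mdim N)" "\<psi>' x \<in> coord_space (mdim N)" if "x \<in> V \<inter> V'" for x
    using is_chartD(4)[OF ch'[OF d(1)]] is_chartD(4)[OF ch'[OF d(2)]] that by auto
  have op: "open_in_coords (mdim M + mdim N) (?F ` ?W)"
    by (rule is_chart_image_open[OF is_chart_product[OF ch[OF c(1)] ch'[OF d(1)]]])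
       (auto simp: openin_prod_Times_iff UU VV)
  have op1: "open_in_coords (mdim M) (\<phi> ` (U \<inter> U'))" by (rule is_chart_image_open[OF ch[OF c(1)] UU]) simp
  have op2: "open_in_coords (mdim N) (\<psi> ` (V \<inter> V'))" by (rule is_chart_image_open[OF ch'[OF d(1)] VV]) simp
  have "smooth_in_coord (mdim M + mdim N) ?F ?W (\<lambda>p. \<phi>' (fst p))"
    by (rule smooth_in_coord_compose[where f = fst and g = \<phi>', OF op op1 _ smooth_in_product_coord(1)
          chart_transition[OF M c]]) (use phi psi in auto)
  moreover have "smooth_in_coord (mdim M + mdim N) ?F ?W (\<lambda>p. \<psi>' (snd p))"
    by (rule smooth_in_coord_compose[where f = snd and g = \<psi>', OF op op2 _ smooth_in_product_coord(2)
          chart_transition[OF N d]]) (use phi psi in auto)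
  ultimately show ?thesis
    unfolding case_prod_beta
    by (intro smooth_in_coord_append[where n = "mdim N"]) (use phi psi in auto)
qed

lemma smooth_atlas_product:
  assumes M: "smooth_structure M" and N: "smooth_structure N"
  shows "smooth_atlas (prod_topology (mtop M) (mtop N)) (mdim M + mdim N) (product_atlas M N)"
  unfolding smooth_atlas_def
proof (intro conjI ballI)
  note ch = smooth_structureD(1)[OF M] and ch' = smooth_structureD(1)[OF N]
  show cha: "is_chart (prod_topology (mtop M) (mtop N)) (mdim M + mdim N) c" if "c \<in> product_atlas M N" for c
    using that ch ch' by (auto simp: product_atlas_def intro: is_chart_product)
  show "(\<Union>c\<in>product_atlas M N. fst c) = topspace (prod_topology (mtop M) (mtop N))"
  proof
    show "(\<Union>c\<in>product_atlas M N. fst c) \<subseteq> topspace (prod_topology (mtop M) (mtop N))"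
      using is_chartD(2)[OF cha] by fastforce
    show "topspace (prod_topology (mtop M) (mtop N)) \<subseteq> (\<Union>c\<in>product_atlas M N. fst c)"
    proof
      fix p assume "p \<in> topspace (prod_topology (mtop M) (mtop N))"
      then obtain x y where p: "p = (x, y)" "x \<in> mspace M" "y \<in> mspace N" by auto
      obtain U \<phi> V \<psi> where "(U, \<phi>) \<in> mcharts M" "x \<in> U" "(V, \<psi>) \<in> mcharts N" "y \<in> V"
        using smooth_structureD(3)[OF M p(2)] smooth_structureD(3)[OF N p(3)] by blast
      then show "p \<in> (\<Union>c\<in>product_atlas M N. fst c)"
        unfolding p(1) product_atlas_def by (intro UN_I[of "(U \<times> V, product_coord (mdim M) \<phi> \<psi>)"]) auto
    qed
  qed
  fix c d assume cd: "c \<in> product_atlas M N" "d \<in> product_atlas M N"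
  obtain U \<phi> V \<psi> where c: "c = (U \<times> V, product_coord (mdim M) \<phi> \<psi>)" "(U, \<phi>) \<in> mcharts M" "(V, \<psi>) \<in> mcharts N"
    using cd(1) by (auto simp: product_atlas_def)
  obtain U' \<phi>' V' \<psi>' where d: "d = (U' \<times> V', product_coord (mdim M) \<phi>' \<psi>')" "(U', \<phi>') \<in> mcharts M" "(V', \<psi>') \<in> mcharts N"
    using cd(2) by (auto simp: product_atlas_def)
  show "smoothly_compatible (mdim M + mdim N) c d"
    using product_transition[OF M N c(2) d(2) c(3) d(3)] product_transition[OF M N d(2) c(2) d(3) c(3)]
    unfolding c(1) d(1) smoothly_compatible_iff[OF cha[OF cd(1), unfolded c(1)] cha[OF cd(2), unfolded d(1)]]
    by (simp add: Times_Int_Times Int_commute)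
qed

lemma product_manifold_simps [simp]:
  "mtop (product_manifold M N) = prod_topology (mtop M) (mtop N)"
  "mdim (product_manifold M N) = mdim M + mdim N"
  by (simp_all add: product_manifold_eq)

lemma smooth_structure_product:
  assumes "smooth_structure M" "smooth_structure N"
  shows "smooth_structure (product_manifold M N)"
  unfolding product_manifold_eq by (rule smooth_structure_manifold_of_atlas(1)[OF smooth_atlas_product[OF assms]])

lemma product_chart:
  assumes M: "smooth_structure M" and N: "smooth_structure N" and c: "(U, \<phi>) \<in> mcharts M" and d: "(V, \<psi>) \<in> mcharts N"
  shows "(U \<times> V, product_coord (mdim M) \<phi> \<psi>) \<in> mcharts (product_manifold M N)"
proof -
  have "(U \<times> V, product_coord (mdim M) \<phi> \<psi>) \<in> product_atlas M N"
    using c d unfolding product_atlas_def by blast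
  then show ?thesis
    unfolding product_manifold_eq using smooth_structure_manifold_of_atlas(2)[OF smooth_atlas_product[OF M N]] by blast
qed

lemma smooth_at_fst_snd:
  assumes M: "smooth_structure M" and N: "smooth_structure N" and p: "p \<in> mspace M \<times> mspace N"
  shows "smooth_at (product_manifold M N) M fst p" "smooth_at (product_manifold M N) N snd p"
proof -
  obtain U \<phi> V \<psi> where c: "(U, \<phi>) \<in> mcharts M" "fst p \<in> U" and d: "(V, \<psi>) \<in> mcharts N" "snd p \<in> V"
    using smooth_structureD(3)[OF M, of "fst p"] smooth_structureD(3)[OF N, of "snd p"] p by (auto simp: mem_Times_iff)
  note ch = chartD(4)[OF M c(1)] and ch' = chartD(4)[OF N d(1)]
  have "\<And>x. x \<in> U \<Longrightarrow> \<phi> x \<in> coord_space (mdim M)" "\<And>y. y \<in> V \<Longrightarrow> \<psi> y \<in> coord_space (mdim N)"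
    using ch ch' by auto
  note sm = smooth_in_product_coord[where \<phi> = \<phi> and \<psi> = \<psi>, OF this]
  show "smooth_at (product_manifold M N) M fst p"
    unfolding smooth_at_alt[OF smooth_structure_product[OF M N]]
    using product_chart[OF M N c(1) d(1)] c d sm(1)
    by (intro exI[of _ "U \<times> V"] exI[of _ "product_coord (mdim M) \<phi> \<psi>"] exI[of _ U] exI[of _ \<phi>])
       (auto simp: mem_Times_iff)
  show "smooth_at (product_manifold M N) N snd p"
    unfolding smooth_at_alt[OF smooth_structure_product[OF M N]]
    using product_chart[OF M N c(1) d(1)] c d sm(2)
    by (intro exI[of _ "U \<times> V"] exI[of _ "product_coord (mdim M) \<phi> \<psi>"] exI[of _ V] exI[of _ \<psi>])
       (auto simp: mem_Times_iff)
qed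

lemma smooth_at_Pair:
  assumes K: "smooth_structure K" and M: "smooth_structure M" and N: "smooth_structure N"
    and f: "smooth_at K M f p" and g: "smooth_at K N g p"
  shows "smooth_at K (product_manifold M N) (\<lambda>q. (f q, g q)) p"
proof -
  obtain A \<theta> U \<phi> V \<psi> where a: "(A, \<theta>) \<in> mcharts K" "p \<in> A" and c: "(U, \<phi>) \<in> mcharts M" "f p \<in> U"
    and d: "(V, \<psi>) \<in> mcharts N" "g p \<in> V"
    using smooth_structureD(3)[OF K smooth_at_imp_mspace(1)[OF K M f]]
      smooth_structureD(3)[OF M smooth_at_imp_mspace(2)[OF K M f]]
      smooth_structureD(3)[OF N smooth_at_imp_mspace(2)[OF K N g]] by blast
  obtain W where W: "openin (mtop K) W" "p \<in> W" "W \<subseteq> A" "f ` W \<subseteq> U" "smooth_in_coord (mdim K) \<theta> W (\<lambda>q. \<phi> (f q))"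
    using smooth_at_in_charts[OF K M f a c] by blast
  obtain W' where W': "openin (mtop K) W'" "p \<in> W'" "W' \<subseteq> A" "g ` W' \<subseteq> V" "smooth_in_coord (mdim K) \<theta> W' (\<lambda>q. \<psi> (g q))"
    using smooth_at_in_charts[OF K N g a d] by blast
  note ch = chartD(4)[OF M c(1)] and ch' = chartD(4)[OF N d(1)]
  show ?thesis
  proof (rule smooth_atI[OF K a(1) product_chart[OF M N c(1) d(1)] openin_Int[OF W(1) W'(1)]])
    have "smooth_in_coord (mdim K) \<theta> (W \<inter> W') (\<lambda>q. coord_append (mdim M) (\<phi> (f q)) (\<psi> (g q)))"
      by (rule smooth_in_coord_append[where n = "mdim N", OF _ _ smooth_in_coord_subset[OF W(5)] smooth_in_coord_subset[OF W'(5)]])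
         (use W(4) W'(4) ch ch' in blast)+
    then show "smooth_in_coord (mdim K) \<theta> (W \<inter> W') (\<lambda>q. product_coord (mdim M) \<phi> \<psi> (f q, g q))" by simp
  qed (use W W' in auto)
qed

section \<open>The circle\<close>

definition arc :: "real \<Rightarrow> complex set" where
  "arc a = cis ` {a<..<a + 2 * pi}"

text \<open>
  The argument of \<open>z\<close> that lies in \<open>[a, a + 2\<pi>)\<close>; it is continuous on the arc, where \<open>a\<close> itself is excluded.
\<close>

definition arc_angle :: "real \<Rightarrow> complex \<Rightarrow> real" where
  "arc_angle a z = a + Arg2pi (z * cis (- a))"

lemma arc_angle_cis: "t \<in> {a<..<a + 2 * pi} \<Longrightarrow> arc_angle a (cis t) = t"
proof -
  assume t: "t \<in> {a<..<a + 2 * pi}"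
  have "Arg2pi (cis t * cis (- a)) = t - a"
    by (rule Arg2pi_unique[of 1]) (use t in \<open>auto simp: cis_mult simp flip: cis_conv_exp of_real_diff\<close>)
  then show ?thesis by (simp add: arc_angle_def)
qed

lemma cis_arc_angle: "z \<in> circle \<Longrightarrow> cis (arc_angle a z) = z"
proof -
  assume z: "z \<in> circle"
  then have "norm (z * cis (- a)) = 1" by (simp add: norm_mult)
  then have "cis (Arg2pi (z * cis (- a))) = z * cis (- a)"
    using Arg2pi_eq[of "z * cis (- a)"] by (simp add: cis_conv_exp)
  then show ?thesis by (simp add: arc_angle_def cis_mult[symmetric] ac_simps) (simp add: cis_mult)
qed

lemma arc_eq: "arc a = circle - {cis a}"
proof safe
  fix z assume "z \<in> arc a"
  then show "z \<in> circle" by (auto simp: arc_def)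
next
  assume "cis a \<in> arc a"
  then obtain t where t: "t \<in> {a<..<a + 2 * pi}" "cis a = cis t" by (auto simp: arc_def)
  have "Arg2pi 1 = 0" by (rule Arg2pi_unique[of 1]) auto
  then have "arc_angle a (cis a) = a" by (simp add: arc_angle_def cis_mult)
  with arc_angle_cis[OF t(1)] t show False by simp
next
  fix z assume z: "z \<in> circle" "z \<notin> arc a"
  have "arc_angle a z \<in> {a..<a + 2 * pi}" using Arg2pi[of "z * cis (- a)"] by (simp add: arc_angle_def)
  moreover have "arc_angle a z \<notin> {a<..<a + 2 * pi}"
    using z cis_arc_angle[OF z(1), of a] by (metis arc_def imageI)
  ultimately show "z = cis a" using cis_arc_angle[OF z(1), of a] by (cases "arc_angle a z = a") auto
qed

lemma arc_open: "openin (top_of_set circle) (arc a)"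
  unfolding arc_eq by (rule openin_diff) auto

lemma continuous_on_arc_angle: "continuous_on (arc a) (arc_angle a)"
proof (intro continuous_at_imp_continuous_on ballI)
  fix z assume "z \<in> arc a"
  then obtain t where t: "t \<in> {a<..<a + 2 * pi}" "z = cis t" by (auto simp: arc_def)
  have "z * cis (- a) \<notin> \<real>\<^sub>\<ge>\<^sub>0"
  proof
    assume "z * cis (- a) \<in> \<real>\<^sub>\<ge>\<^sub>0"
    then have "Arg2pi (z * cis (- a)) = 0"
      by (metis Arg2pi_eq_0 Reals_of_real complex_nonneg_Reals_iff complex_is_Real_iff)
    then show False using arc_angle_cis[OF t(1)] t by (simp add: arc_angle_def)
  qed
  then show "isCont (arc_angle a) z"
    unfolding arc_angle_def
    by (intro continuous_intros isCont_o2[OF _ continuous_at_Arg2pi]) auto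
qed

lemma bounded_linear_single: "bounded_linear (\<lambda>t::real. Poly_Mapping.single 0 t :: rvec)"
proof -
  have "(\<lambda>t::real. Poly_Mapping.single 0 t :: rvec) = (\<lambda>t. t *\<^sub>R unit_vec 0)"
    by (intro ext poly_mapping_eqI) (auto simp: lookup_single lookup_one when_def)
  then show ?thesis by (simp add: bounded_linear_scaleR_left)
qed

lemma single_in_coord_space_1: "(Poly_Mapping.single 0 t :: rvec) \<in> coord_space 1"
  by (auto simp: coord_space_iff lookup_single when_def)

lemma is_chart_arc:
  assumes \<phi>: "\<And>t. t \<in> {a<..<a + 2 * pi} \<Longrightarrow> \<phi> (cis t) = Poly_Mapping.single 0 t"
  shows "is_chart (top_of_set circle) 1 (arc a, \<phi>)"
proof -
  have phi: "\<phi> z = Poly_Mapping.single 0 (arc_angle a z)" if "z \<in> arc a" for z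
    using that \<phi> arc_angle_cis by (auto simp: arc_def)
  have img: "\<phi> ` arc a = {v \<in> coord_space 1. coord v 0 \<in> {a<..<a + 2 * pi}}"
  proof safe
    fix z assume "z \<in> arc a"
    then obtain t where t: "t \<in> {a<..<a + 2 * pi}" "z = cis t" by (auto simp: arc_def)
    then show "\<phi> z \<in> coord_space 1" "coord (\<phi> z) 0 \<in> {a<..<a + 2 * pi}"
      using single_in_coord_space_1 by (auto simp: \<phi>)
  next
    fix v :: rvec assume v: "v \<in> coord_space 1" "coord v 0 \<in> {a<..<a + 2 * pi}"
    have "v = Poly_Mapping.single 0 (coord v 0)"
      by (rule poly_mapping_eqI) (use v(1) in \<open>auto simp: coord_space_iff lookup_single when_def\<close>)
    then have "v = \<phi> (cis (coord v 0))" using \<phi>[OF v(2)] by simp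
    then show "v \<in> \<phi> ` arc a" using v(2) unfolding arc_def by blast
  qed
  have cl: "continuous_on S (\<lambda>v::rvec. coord v 0)" for S
    by (rule linear_continuous_on[OF bounded_linear_lookup])
  have "open_in_coords 1 (coord_space 1 \<inter> (\<lambda>v. coord v 0) -` {a<..<a + 2 * pi})"
    by (rule continuous_openin_preimage_gen[OF cl]) simp
  then have op: "open_in_coords 1 (\<phi> ` arc a)" unfolding img by (rule back_subst[of "openin _"]) auto
  have "homeomorphic_maps (top_of_set (arc a)) (top_of_set (\<phi> ` arc a)) \<phi> (\<lambda>v. cis (coord v 0))"
    unfolding homeomorphic_maps_def
  proof (intro conjI ballI)
    have "continuous_on (arc a) (\<lambda>z. Poly_Mapping.single 0 (arc_angle a z) :: rvec)"
      by (rule bounded_linear.continuous_on[OF bounded_linear_single continuous_on_arc_angle])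
    then have "continuous_on (arc a) \<phi>" using phi by (simp cong: continuous_on_cong)
    then show "continuous_map (top_of_set (arc a)) (top_of_set (\<phi> ` arc a)) \<phi>" by auto
    have "continuous_on (\<phi> ` arc a) (\<lambda>v. cis (coord v 0))" by (intro continuous_intros cl)
    then show "continuous_map (top_of_set (\<phi> ` arc a)) (top_of_set (arc a)) (\<lambda>v. cis (coord v 0))"
      unfolding img by (auto simp: arc_def)
  qed (auto simp: arc_def \<phi>)
  then have "homeomorphic_map (top_of_set (arc a)) (top_of_set (\<phi> ` arc a)) \<phi>"
    using homeomorphic_map_maps by blast
  moreover have "circle \<inter> arc a = arc a" by (auto simp: arc_eq)
  ultimately show ?thesis
    using op arc_open by (simp add: is_chart_def subtopology_subtopology)
qed

text \<open>Two angular coordinates differ by a multiple of \<open>2\<pi>\<close>, which is locally constant.\<close>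

lemma arc_transition:
  assumes \<phi>: "\<And>t. t \<in> {a<..<a + 2 * pi} \<Longrightarrow> \<phi> (cis t) = Poly_Mapping.single 0 t"
    and \<psi>: "\<And>t. t \<in> {b<..<b + 2 * pi} \<Longrightarrow> \<psi> (cis t) = Poly_Mapping.single 0 t"
  shows "smooth_in_coord 1 \<phi> (arc a \<inter> arc b) \<psi>"
proof (rule smooth_in_coord_local[OF is_chart_arc[OF \<phi>]])
  show AB: "openin (top_of_set circle) (arc a \<inter> arc b)" by (intro openin_Int arc_open)
  fix p assume p: "p \<in> arc a \<inter> arc b"
  then obtain s0 t0 where s0: "s0 \<in> {a<..<a + 2 * pi}" "p = cis s0" and t0: "t0 \<in> {b<..<b + 2 * pi}" "p = cis t0"
    by (auto simp: arc_def)
  define c where "c = t0 - s0"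
  have "cis c = 1" using s0(2) t0(2) by (simp add: c_def flip: cis_divide)
  then have shift: "cis (s + c) = cis s" for s by (simp flip: cis_mult)
  let ?O = "coord_space 1 \<inter> (\<lambda>v. coord v 0) -` {b - c<..<b - c + 2 * pi}"
  define W where "W = (arc a \<inter> arc b) \<inter> {z \<in> arc a. \<phi> z \<in> ?O}"
  have "open_in_coords 1 ?O"
    by (rule continuous_openin_preimage_gen[OF linear_continuous_on[OF bounded_linear_lookup]]) simp
  then have W: "openin (top_of_set circle) W"
    unfolding W_def by (intro openin_Int[OF AB] is_chart_preimage_open[where n = 1] is_chart_arc \<phi>)
  have "smooth_in_coord 1 \<phi> W (\<lambda>z. \<phi> z + Poly_Mapping.single 0 c)"
    by (intro smooth_in_coord_add smooth_in_coord_self smooth_in_coord_const)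
  then have "smooth_in_coord 1 \<phi> W \<psi>"
  proof (rule smooth_in_coord_cong)
    fix z assume z: "z \<in> W"
    then obtain s where s: "s \<in> {a<..<a + 2 * pi}" "z = cis s" by (auto simp: W_def arc_def)
    then have "s + c \<in> {b<..<b + 2 * pi}" using z \<phi>[OF s(1)] by (auto simp: W_def)
    then have "\<psi> z = Poly_Mapping.single 0 (s + c)" using \<psi>[of "s + c"] s(2) shift[of s] by simp
    then show "\<phi> z + Poly_Mapping.single 0 c = \<psi> z" using \<phi>[OF s(1)] s(2) by (simp add: single_add)
  qed
  moreover have "p \<in> W"
    using p \<phi>[OF s0(1)] s0(2) t0(1) single_in_coord_space_1 by (auto simp: W_def c_def)
  ultimately show "\<exists>W'. openin (top_of_set circle) W' \<and> p \<in> W' \<and> W' \<subseteq> arc a \<inter> arc b \<and> smooth_in_coord 1 \<phi> W' \<psi>"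
    using W by (intro exI[of _ W]) (auto simp: W_def)
qed auto

lemma circle_manifold_eq:
  "circle_manifold = manifold_of_atlas (top_of_set circle) 1
     {(arc a, \<phi>) | a \<phi>. \<forall>t\<in>{a<..<a + 2 * pi}. \<phi> (cis t) = Poly_Mapping.single 0 t}"
  by (simp add: circle_manifold_def arc_def)

lemma smooth_atlas_circle:
  "smooth_atlas (top_of_set circle) 1
     {(arc a, \<phi>) | a \<phi>. \<forall>t\<in>{a<..<a + 2 * pi}. \<phi> (cis t) = Poly_Mapping.single 0 t}"
  (is "smooth_atlas _ _ ?A")
  unfolding smooth_atlas_def
proof (intro conjI ballI)
  show charts: "is_chart (top_of_set circle) 1 c" if "c \<in> ?A" for c
    using that is_chart_arc by blast
  show "(\<Union>c\<in>?A. fst c) = topspace (top_of_set circle)"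
  proof
    show "(\<Union>c\<in>?A. fst c) \<subseteq> topspace (top_of_set circle)"
      by (auto simp: arc_def)
    show "topspace (top_of_set circle) \<subseteq> (\<Union>c\<in>?A. fst c)"
    proof
      fix z assume "z \<in> topspace (top_of_set circle)"
      then have z: "z \<in> circle" by simp
      define a where "a = Arg2pi z - pi"
      have "z = cis (Arg2pi z)" using Arg2pi_eq[of z] z by (simp add: cis_conv_exp)
      then have "z \<in> arc a" unfolding arc_def by (rule image_eqI) (simp add: a_def)
      then show "z \<in> (\<Union>c\<in>?A. fst c)"
        by (intro UN_I[of "(arc a, \<lambda>z. Poly_Mapping.single 0 (arc_angle a z))"]) (auto simp: arc_angle_cis)
    qed
  qed
  fix c d assume cd: "c \<in> ?A" "d \<in> ?A"
  then obtain a \<phi> b \<psi> where c: "c = (arc a, \<phi>)" "\<And>t. t \<in> {a<..<a + 2 * pi} \<Longrightarrow> \<phi> (cis t) = Poly_Mapping.single 0 t"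
    and d: "d = (arc b, \<psi>)" "\<And>t. t \<in> {b<..<b + 2 * pi} \<Longrightarrow> \<psi> (cis t) = Poly_Mapping.single 0 t"
    by auto
  have "smooth_in_coord 1 \<phi> (arc a \<inter> arc b) \<psi>" by (rule arc_transition) (simp_all add: c(2) d(2))
  moreover have "smooth_in_coord 1 \<psi> (arc b \<inter> arc a) \<phi>" by (rule arc_transition) (simp_all add: c(2) d(2))
  ultimately show "smoothly_compatible 1 c d"
    using smoothly_compatible_iff[OF charts[OF cd(1), unfolded c(1)] charts[OF cd(2), unfolded d(1)]]
    unfolding c(1) d(1) by (simp only: Int_commute)
qed

lemma smooth_structure_circle: "smooth_structure circle_manifold"
  unfolding circle_manifold_eq by (rule smooth_structure_manifold_of_atlas(1)[OF smooth_atlas_circle])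

lemma circle_manifold_simps [simp]: "mtop circle_manifold = top_of_set circle" "mdim circle_manifold = 1"
  by (simp_all add: circle_manifold_eq)

lemma smooth_at_circle_inverse:
  assumes z: "z \<in> circle"
  shows "smooth_at circle_manifold circle_manifold inverse z"
proof -
  define s where "s = Arg2pi z"
  define a where "a = s - pi"
  let ?ch = "\<lambda>a z. Poly_Mapping.single 0 (arc_angle a z) :: rvec"
  have chart: "(arc a, ?ch a) \<in> mcharts circle_manifold" for a
  proof -
    have "(arc a, ?ch a) \<in> {(arc a, \<phi>) | a \<phi>. \<forall>t\<in>{a<..<a + 2 * pi}. \<phi> (cis t) = Poly_Mapping.single 0 t}"
      by (auto simp: arc_angle_cis)
    then show ?thesis
      unfolding circle_manifold_eq by (rule subsetD[OF smooth_structure_manifold_of_atlas(2)[OF smooth_atlas_circle]])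
  qed
  have "z = cis s" using Arg2pi_eq[of z] z by (simp add: s_def cis_conv_exp)
  then have z_arc: "z \<in> arc a" unfolding arc_def by (rule image_eqI) (simp add: a_def)
  \<comment> \<open>Inversion carries the arc centred at angle \<open>s\<close> to the arc centred at \<open>-s\<close>, by \<open>t \<mapsto> -t\<close>.\<close>
  have inv: "inverse w \<in> arc (- a - 2 * pi) \<and> ?ch (- a - 2 * pi) (inverse w) = - ?ch a w" if w: "w \<in> arc a" for w
  proof -
    obtain t where t: "t \<in> {a<..<a + 2 * pi}" "w = cis t" using w by (auto simp: arc_def)
    then have "- t \<in> {- a - 2 * pi<..<- a - 2 * pi + 2 * pi}" by auto
    from arc_angle_cis[OF this] arc_angle_cis[OF t(1)] this t(2) show ?thesis
      by (auto simp: arc_def single_uminus)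
  qed
  have "smooth_in_coord (mdim circle_manifold) (?ch a) (arc a) (\<lambda>w. - ?ch a w)"
    by (intro smooth_in_coord_bounded_linear[where L = uminus] smooth_in_coord_self bounded_linear_minus bounded_linear_ident)
  then have "smooth_in_coord (mdim circle_manifold) (?ch a) (arc a) (\<lambda>w. ?ch (- a - 2 * pi) (inverse w))"
    by (rule smooth_in_coord_cong) (simp add: inv)
  then show ?thesis
    unfolding smooth_at_alt[OF smooth_structure_circle]
    using chart[of a] chart[of "- a - 2 * pi"] z_arc inv by blast
qed


section \<open>Embedded submanifolds\<close>

lemma embedded_structureD:
  assumes "embedded_structure P S N"
  shows "smooth_structure N" "mspace N = S" "mtop N = subtopology (mtop P) S" "immersion N P (\<lambda>x. x)"
    "smooth_map N P (\<lambda>x. x)"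
proof -
  show "smooth_structure N" "mspace N = S" "immersion N P (\<lambda>x. x)"
    using assms by (auto simp: embedded_structure_def smooth_embedding_def smooth_manifold_imp_structure)
  then show "smooth_map N P (\<lambda>x. x)" by (simp add: immersion_def)
  have h: "homeomorphic_map (mtop N) (subtopology (mtop P) S) (\<lambda>x. x)"
    using assms by (auto simp: embedded_structure_def smooth_embedding_def embedding_map_def)
  show "mtop N = subtopology (mtop P) S"
  proof (rule topology_eq[THEN iffD2], intro allI)
    fix A
    show "openin (mtop N) A \<longleftrightarrow> openin (subtopology (mtop P) S) A"
    proof (cases "A \<subseteq> mspace N")
      case True
      then show ?thesis using homeomorphic_map_openness[OF h True] by simp
    next
      case False
      moreover have "mspace N = topspace (subtopology (mtop P) S)"
        using homeomorphic_imp_surjective_map[OF h] by simp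
      ultimately show ?thesis using openin_subset by metis
    qed
  qed
qed

text \<open>
  The universal property of embedded submanifolds: since \<open>N\<close> has the subspace topology, \<open>f\<close> is continuous
  into \<open>N\<close>, and in charts it is then a continuous lift of a smooth map through the immersion given by the
  inclusion.
\<close>

lemma smooth_at_into_embedded:
  assumes A: "smooth_structure A" and P: "smooth_structure P" and N: "embedded_structure P S N"
    and f: "smooth_at A P f p" and W: "openin (mtop A) W" "p \<in> W" "f ` W \<subseteq> S"
  shows "smooth_at A N f p"
proof -
  note eN = embedded_structureD[OF N]
  have fp: "f p \<in> S" using W by auto
  have "f p \<in> mspace N" "f p \<in> mspace P"
    using fp eN(2) smooth_at_imp_mspace(2)[OF A P f] by auto
  then obtain V \<psi> V' \<theta> where d: "(V, \<psi>) \<in> mcharts N" "f p \<in> V" and d': "(V', \<theta>) \<in> mcharts P" "f p \<in> V'"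
    using smooth_structureD(3)[OF eN(1)] smooth_structureD(3)[OF P] by meson
  obtain U \<phi> where c: "(U, \<phi>) \<in> mcharts A" "p \<in> U"
    using smooth_structureD(3)[OF A smooth_at_imp_mspace(1)[OF A P f]] by blast
  note chA = smooth_structureD(1)[OF A c(1)] and chN = smooth_structureD(1)[OF eN(1) d(1)]
    and chP = smooth_structureD(1)[OF P d'(1)]
  have incl: "smooth_at N P (\<lambda>x. x) (f p)" using eN(5) \<open>f p \<in> mspace N\<close> by (simp add: smooth_map_iff)
  obtain Q where Q: "openin (mtop N) Q" "f p \<in> Q" "Q \<subseteq> V" "(\<lambda>x. x) ` Q \<subseteq> V'"
    "smooth_in_coord (mdim N) \<psi> Q (\<lambda>x. \<theta> x)"
    using smooth_at_in_charts[OF eN(1) P incl d d'] by blast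
  obtain h where h: "smooth_on (mdim N) (\<psi> ` Q) h" "\<And>q. q \<in> Q \<Longrightarrow> \<theta> q = h (\<psi> q)"
    using Q(5) by (auto simp: smooth_in_coord_def)
  obtain T where T: "openin (mtop P) T" "Q = T \<inter> S"
    using Q(1) unfolding eN(3) openin_subtopology by blast
  obtain B where B: "openin (mtop A) B" "p \<in> B" "B \<subseteq> U" "f ` B \<subseteq> V'"
    "smooth_in_coord (mdim A) \<phi> B (\<lambda>q. \<theta> (f q))"
    using smooth_at_in_charts[OF A P f c d'] by blast
  have pre: "openin (mtop A) {q \<in> B. f q \<in> Y}" if "openin (mtop P) Y" for Y
    by (rule smooth_in_coord_open_preimage[OF is_chart_restrict[OF chA B(1,3)] chP B(4,5) that])
  define R where "R = {q \<in> B. f q \<in> T} \<inter> W"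
  have R: "openin (mtop A) R" "p \<in> R" "R \<subseteq> U" "R \<subseteq> B" "f ` R \<subseteq> Q"
    using W T Q(2) B(2,3) unfolding R_def by (auto intro!: openin_Int pre)
  have opR: "open_in_coords (mdim A) (\<phi> ` R)" by (rule is_chart_image_open[OF chA R(1,3)])
  have opQ: "open_in_coords (mdim N) (\<psi> ` Q)" by (rule is_chart_image_open[OF chN Q(1,3)])
  have inv: "inv_into U \<phi> (\<phi> q) = q" if "q \<in> R" for q using that R(3) is_chartD(5)[OF chA] by auto
  let ?F = "\<lambda>x. \<psi> (f (inv_into U \<phi> x))"
  have "smooth_on (mdim A) (\<phi> ` R) ?F"
  proof (rule smooth_on_lift[OF opR opQ, where e = h and m = "mdim P"])
    show "?F ` \<phi> ` R \<subseteq> \<psi> ` Q" using inv R(5) by auto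
    show "h ` \<psi> ` Q \<subseteq> coord_space (mdim P)" using h(2)[symmetric] Q(4) is_chartD(4)[OF chP] by auto
    show "smooth_on (mdim N) (\<psi> ` Q) h" by (rule h(1))
    have "smooth_in_coord (mdim A) \<phi> R (\<lambda>q. \<theta> (f q))" using B(5) R(4) by (rule smooth_in_coord_subset)
    then have "smooth_on (mdim A) (\<phi> ` R) ((\<lambda>q. \<theta> (f q)) \<circ> inv_into U \<phi>)"
      by (simp add: smooth_in_coord_iff_inv_into[OF chA R(1,3)])
    then show "smooth_on (mdim A) (\<phi> ` R) (\<lambda>x. h (?F x))"
      by (rule smooth_on_cong[OF opR, rotated]) (use inv R(5) h(2) in auto)
    show "continuous_on (\<phi> ` R) ?F"
    proof -
      have "openin (top_of_set (\<phi> ` R)) (\<phi> ` R \<inter> ?F -` Y)" if Y: "open_in_coords (mdim N) Y" for Y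
      proof -
        have "openin (mtop N) {q \<in> V. \<psi> q \<in> Y}" by (rule is_chart_preimage_open[OF chN Y])
        then obtain Z where Z: "openin (mtop P) Z" "{q \<in> V. \<psi> q \<in> Y} = Z \<inter> S"
          unfolding eN(3) openin_subtopology by blast
        have "openin (mtop A) (R \<inter> {q \<in> B. f q \<in> Z})" by (intro openin_Int R(1) pre Z(1))
        then have "open_in_coords (mdim A) (\<phi> ` (R \<inter> {q \<in> B. f q \<in> Z}))"
          by (rule is_chart_image_open[OF chA]) (use R(3) in auto)
        moreover have "f q \<in> Z \<longleftrightarrow> \<psi> (f q) \<in> Y" if "q \<in> R" for q
          using that R(5) T(2) Q(3) Z(2) by blast
        then have "\<phi> ` (R \<inter> {q \<in> B. f q \<in> Z}) = \<phi> ` R \<inter> ?F -` Y" using R(4) inv by auto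
        ultimately show ?thesis
          using opR by (metis Int_lower1 openin_subset_trans open_in_coords_subset)
      qed
      moreover have "\<psi> (f q) \<in> coord_space (mdim N)" if "q \<in> R" for q
        using that R(5) Q(3) is_chartD(4)[OF chN] by blast
      then have "?F ` \<phi> ` R \<subseteq> coord_space (mdim N)" using inv by auto
      ultimately show ?thesis by (subst continuous_on_open_gen[where T = "coord_space (mdim N)"]) auto
    qed
  next
    fix y D assume y: "y \<in> \<psi> ` Q" and D: "(h has_derivative D) (at y within coord_space (mdim N))"
    obtain q where q: "q \<in> Q" "y = \<psi> q" using y by auto
    have inv': "inv_into V \<psi> (\<psi> q) = q" if "q \<in> Q" for q using that Q(3) is_chartD(5)[OF chN] by auto
    have "((\<theta> \<circ> (\<lambda>x. x) \<circ> inv_into V \<psi>) has_derivative D) (at y within \<psi> ` Q)"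
      by (rule has_derivative_transform[OF y, where f = h])
         (use inv' h(2) D at_within_coords[OF opQ y] in auto)
    then have D1: "differential_in_charts N (\<lambda>x. x) q (V, \<psi>) (V', \<theta>) D"
      by (simp add: differential_in_charts_def q(2) at_within_coords[OF opQ y[unfolded q(2)]])
    have "q \<in> mspace N" "q \<in> V" "q \<in> V'" using q(1) Q(3,4) is_chartD(2)[OF chN] by auto
    then obtain D' where D': "differential_in_charts N (\<lambda>x. x) q (V, \<psi>) (V', \<theta>) D'"
      "inj_on D' (coord_space (mdim N))"
      using eN(4) d(1) d'(1) unfolding immersion_def by (metis fst_conv)
    have "D v = D' v" if "v \<in> coord_space (mdim N)" for v
      by (rule differential_unique[OF eN(1) d(1) \<open>q \<in> V\<close> D1 D'(1) that])
    then show "inj_on D (coord_space (mdim N))" using D'(2) by (simp cong: inj_on_cong)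
  qed
  then have "smooth_in_coord (mdim A) \<phi> R (\<lambda>q. \<psi> (f q))"
    unfolding smooth_in_coord_iff_inv_into[OF chA R(1,3)] by (simp add: o_def)
  then show ?thesis
    using R(5) Q(3) by (intro smooth_atI[OF A c(1) d(1) R(1,3,2)]) auto
qed

definition push_atlas :: "'a manifold \<Rightarrow> ('a \<Rightarrow> 'b) \<Rightarrow> 'b chart set" where
  "push_atlas A j = {(j ` U, \<phi> \<circ> inv_into (mspace A) j) | U \<phi>. (U, \<phi>) \<in> mcharts A}"

definition push_manifold :: "'a manifold \<Rightarrow> 'b topology \<Rightarrow> ('a \<Rightarrow> 'b) \<Rightarrow> 'b manifold" where
  "push_manifold A X j = manifold_of_atlas X (mdim A) (push_atlas A j)"

lemma push_manifold_simps [simp]: "mtop (push_manifold A X j) = X" "mdim (push_manifold A X j) = mdim A"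
  by (simp_all add: push_manifold_def)

lemma
  assumes A: "smooth_structure A" and j: "homeomorphic_map (mtop A) X j"
  shows smooth_structure_push: "smooth_structure (push_manifold A X j)"
    and smooth_at_push: "a \<in> mspace A \<Longrightarrow> smooth_at A (push_manifold A X j) j a"
    and smooth_at_push_inverse: "a \<in> mspace A \<Longrightarrow> smooth_at (push_manifold A X j) A (inv_into (mspace A) j) (j a)"
proof -
  let ?i = "inv_into (mspace A) j"
  note ch = smooth_structureD(1)[OF A]
  have inj: "inj_on j (mspace A)" and surj: "j ` mspace A = topspace X"
    using homeomorphic_imp_injective_map[OF j] homeomorphic_imp_surjective_map[OF j] by auto
  have i: "?i (j a) = a" if "a \<in> mspace A" for a using that inj by simp
  have sub: "U \<subseteq> mspace A" if "(U, \<phi>) \<in> mcharts A" for U \<phi> using is_chartD(2)[OF ch[OF that]] .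
  have img: "(\<phi> \<circ> ?i) ` j ` W = \<phi> ` W" if "W \<subseteq> mspace A" for W and \<phi> :: "'a \<Rightarrow> rvec"
    unfolding image_image using that i by (intro image_cong) auto
  have chart: "is_chart X (mdim A) (j ` U, \<phi> \<circ> ?i)" if c: "(U, \<phi>) \<in> mcharts A" for U \<phi>
  proof -
    have "openin X (j ` U)"
      using is_chartD(1)[OF ch[OF c]] homeomorphic_map_openness[OF j sub[OF c]] by simp
    obtain k where k: "homeomorphic_maps (mtop A) X j k" using j homeomorphic_map_maps by blast
    have "homeomorphic_map X (mtop A) ?i"
    proof (rule homeomorphic_map_eq[of _ _ k])
      show "homeomorphic_map X (mtop A) k" using k by (simp add: homeomorphic_maps_map)
      show "k y = ?i y" if "y \<in> topspace X" for y
      proof -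
        have "y \<in> j ` mspace A" using that by (simp only: surj)
        then obtain a where a: "a \<in> mspace A" "y = j a" by (rule imageE)
        then show ?thesis using k i[OF a(1)] by (simp add: homeomorphic_maps_def)
      qed
    qed
    then have "homeomorphic_map (subtopology X (j ` U)) (subtopology (mtop A) U) ?i"
    proof (rule homeomorphic_map_subtopologies)
      have "j ` U \<subseteq> topspace X"
        unfolding surj[symmetric] using sub[OF c] by (rule image_mono)
      moreover have "?i ` j ` U = (\<lambda>a. a) ` U"
        unfolding image_image using i sub[OF c] by (intro image_cong) auto
      ultimately have "?i ` j ` U = U" "topspace X \<inter> j ` U = j ` U" "mspace A \<inter> U = U"
        using sub[OF c] by (simp_all add: Int_absorb1)
      then show "?i ` (topspace X \<inter> j ` U) = mspace A \<inter> U" by simp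
    qed
    then have "homeomorphic_map (subtopology X (j ` U)) (top_of_set (\<phi> ` U)) (\<phi> \<circ> ?i)"
      using is_chartD(6)[OF ch[OF c]] by (rule homeomorphic_map_compose)
    then show ?thesis
      using \<open>openin X (j ` U)\<close> is_chartD(3)[OF ch[OF c]] img[OF sub[OF c], of \<phi>] by (simp add: is_chart_def)
  qed
  have push: "smooth_in_coord n (\<phi> \<circ> ?i) (j ` W) (\<lambda>q. g (?i q))"
    if W: "W \<subseteq> mspace A" and g: "smooth_in_coord n \<phi> W g" for n \<phi> W and g :: "'a \<Rightarrow> rvec"
  proof -
    obtain h where "smooth_on n (\<phi> ` W) h" "\<forall>p\<in>W. g p = h (\<phi> p)" using g by (auto simp: smooth_in_coord_def)
    then show ?thesis unfolding smooth_in_coord_def img[OF W] using i W by (intro exI[of _ h]) auto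
  qed
  have atlas: "smooth_atlas X (mdim A) (push_atlas A j)"
    unfolding smooth_atlas_def
  proof (intro conjI ballI)
    show "is_chart X (mdim A) c" if "c \<in> push_atlas A j" for c using that chart by (auto simp: push_atlas_def)
    show "(\<Union>c\<in>push_atlas A j. fst c) = topspace X"
    proof
      show "(\<Union>c\<in>push_atlas A j. fst c) \<subseteq> topspace X"
        using surj sub by (fastforce simp: push_atlas_def)
      show "topspace X \<subseteq> (\<Union>c\<in>push_atlas A j. fst c)"
      proof
        fix y assume "y \<in> topspace X"
        then have "y \<in> j ` mspace A" by (simp only: surj)
        then obtain a where a: "a \<in> mspace A" "y = j a" by (rule imageE)
        obtain U \<phi> where "(U, \<phi>) \<in> mcharts A" "a \<in> U" using smooth_structureD(3)[OF A a(1)] by blast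
        then show "y \<in> (\<Union>c\<in>push_atlas A j. fst c)"
          unfolding push_atlas_def a(2) by (intro UN_I[of "(j ` U, \<phi> \<circ> ?i)"]) auto
      qed
    qed
    fix c d assume "c \<in> push_atlas A j" "d \<in> push_atlas A j"
    then obtain U \<phi> V \<psi> where c: "c = (j ` U, \<phi> \<circ> ?i)" "(U, \<phi>) \<in> mcharts A"
      and d: "d = (j ` V, \<psi> \<circ> ?i)" "(V, \<psi>) \<in> mcharts A" by (auto simp: push_atlas_def)
    have UV: "j ` U \<inter> j ` V = j ` (U \<inter> V)" "U \<inter> V \<subseteq> mspace A"
      using inj sub[OF c(2)] sub[OF d(2)] by (auto simp: inj_on_image_Int)
    show "smoothly_compatible (mdim A) c d"
      unfolding c(1) d(1) smoothly_compatible_iff[OF chart[OF c(2)] chart[OF d(2)]] UV(1)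
      using push[OF UV(2) chart_transition[OF A c(2) d(2)]] push[OF UV(2), of "mdim A" \<psi> \<phi>]
        chart_transition[OF A d(2) c(2)] by (simp add: o_def Int_commute)
  qed
  show str: "smooth_structure (push_manifold A X j)"
    unfolding push_manifold_def by (rule smooth_structure_manifold_of_atlas(1)[OF atlas])
  have pc: "(j ` U, \<phi> \<circ> ?i) \<in> mcharts (push_manifold A X j)" if "(U, \<phi>) \<in> mcharts A" for U \<phi>
  proof -
    have "(j ` U, \<phi> \<circ> ?i) \<in> push_atlas A j" using that unfolding push_atlas_def by blast
    then show ?thesis
      unfolding push_manifold_def using smooth_structure_manifold_of_atlas(2)[OF atlas] by blast
  qed
  assume a: "a \<in> mspace A"
  obtain U \<phi> where c: "(U, \<phi>) \<in> mcharts A" "a \<in> U" using smooth_structureD(3)[OF A a] by blast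
  have "smooth_in_coord (mdim A) \<phi> U (\<lambda>q. (\<phi> \<circ> ?i) (j q))"
    by (rule smooth_in_coord_cong[OF smooth_in_coord_self]) (use sub[OF c(1)] i in auto)
  then show "smooth_at A (push_manifold A X j) j a"
    unfolding smooth_at_alt[OF A] using c pc[OF c(1)] by blast
  have "smooth_in_coord (mdim A) (\<phi> \<circ> ?i) (j ` U) (\<lambda>q. \<phi> (?i q))"
    by (rule push[OF sub[OF c(1)] smooth_in_coord_self])
  moreover have "?i ` j ` U \<subseteq> U" using i sub[OF c(1)] by auto
  ultimately show "smooth_at (push_manifold A X j) A ?i (j a)"
    unfolding smooth_at_alt[OF str] push_manifold_simps using c pc[OF c(1)] by blast
qed

definition local_retraction :: "'a manifold \<Rightarrow> 'b manifold \<Rightarrow> ('a \<Rightarrow> 'b) \<Rightarrow> 'a \<Rightarrow> bool" where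
  "local_retraction A P j a \<longleftrightarrow> (\<exists>\<rho> W. smooth_at P A \<rho> (j a) \<and> openin (mtop P) W \<and> j a \<in> W \<and>
     (\<forall>b\<in>mspace A. j b \<in> W \<longrightarrow> \<rho> (j b) = b))"

text \<open>
  If \<open>j b\<close> is close enough to \<open>j a\<close>, then \<open>b = \<rho> (j b)\<close>. This gives injectivity at once, and openness onto the
  image: when \<open>\<rho> (j b)\<close> lies in an open set \<open>U\<close>, so does \<open>b\<close>.
\<close>

lemma embedding_if_local_retractions:
  assumes A: "smooth_structure A" and P: "smooth_structure P" and j: "smooth_map A P j"
    and ret: "\<And>a. a \<in> mspace A \<Longrightarrow> local_retraction A P j a"
  shows "homeomorphic_map (mtop A) (subtopology (mtop P) (j ` mspace A)) j"
proof (rule bijective_open_imp_homeomorphic_map)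
  have jP: "j ` mspace A \<subseteq> mspace P" using j by (simp add: smooth_map_iff)
  show "continuous_map (mtop A) (subtopology (mtop P) (j ` mspace A)) j"
    using smooth_map_imp_continuous_map[OF A P j] by (auto simp: continuous_map_in_subtopology)
  show "j ` mspace A = topspace (subtopology (mtop P) (j ` mspace A))" using jP by auto
  show "inj_on j (mspace A)"
  proof (rule inj_onI)
    fix a b assume ab: "a \<in> mspace A" "b \<in> mspace A" "j a = j b"
    obtain \<rho> W where "j a \<in> W" "\<And>b. b \<in> mspace A \<Longrightarrow> j b \<in> W \<Longrightarrow> \<rho> (j b) = b"
      using ret[OF ab(1)] unfolding local_retraction_def by blast
    then show "a = b" using ab by metis
  qed
  show "open_map (mtop A) (subtopology (mtop P) (j ` mspace A)) j"
    unfolding open_map_def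
  proof (intro allI impI)
    fix U assume U: "openin (mtop A) U"
    show "openin (subtopology (mtop P) (j ` mspace A)) (j ` U)"
    proof (subst openin_subopen, intro ballI)
      fix y assume "y \<in> j ` U"
      then obtain a where a: "a \<in> U" "y = j a" by auto
      have aA: "a \<in> mspace A" using a(1) openin_subset[OF U] by blast
      obtain \<rho> W where r: "smooth_at P A \<rho> (j a)" "openin (mtop P) W" "j a \<in> W"
        "\<And>b. b \<in> mspace A \<Longrightarrow> j b \<in> W \<Longrightarrow> \<rho> (j b) = b"
        using ret[OF aA] unfolding local_retraction_def by blast
      have "\<rho> (j a) \<in> U" using r(3,4) aA a(1) by simp
      then obtain T where T: "openin (mtop P) T" "j a \<in> T" "\<rho> ` T \<subseteq> U"
        using smooth_at_open_preimage[OF P A r(1) U] by blast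
      have "openin (subtopology (mtop P) (j ` mspace A)) ((T \<inter> W) \<inter> j ` mspace A)"
        using openin_Int[OF T(1) r(2)] by (auto simp: openin_subtopology)
      moreover have "(T \<inter> W) \<inter> j ` mspace A \<subseteq> j ` U"
      proof
        fix z assume "z \<in> (T \<inter> W) \<inter> j ` mspace A"
        then obtain b where b: "b \<in> mspace A" "z = j b" "j b \<in> T" "j b \<in> W" by auto
        then have "b \<in> U" using r(4)[OF b(1,4)] T(3) by (metis image_subset_iff)
        then show "z \<in> j ` U" using b(2) by simp
      qed
      ultimately show "\<exists>T. openin (subtopology (mtop P) (j ` mspace A)) T \<and> y \<in> T \<and> T \<subseteq> j ` U"
        using a(2) T(2) r(3) aA by (intro exI[of _ "(T \<inter> W) \<inter> j ` mspace A"]) auto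
    qed
  qed
qed

text \<open>
  The image receives the structure transported by \<open>j\<close>. Up to this identification the inclusion is \<open>j\<close>
  itself, and \<open>j \<circ> \<rho>\<close> is a local left inverse of it, so it is an immersion.
\<close>

lemma embedded_submanifold_if_local_retractions:
  assumes A: "smooth_structure A" and P: "smooth_manifold P" and j: "smooth_map A P j"
    and ret: "\<And>a. a \<in> mspace A \<Longrightarrow> local_retraction A P j a"
  shows "embedded_submanifold P (j ` mspace A)"
proof -
  note Ps = smooth_manifold_imp_structure[OF P]
  let ?S = "j ` mspace A" and ?i = "inv_into (mspace A) j"
  define X where "X = subtopology (mtop P) ?S"
  define N where "N = push_manifold A X j"
  have hom: "homeomorphic_map (mtop A) X j"
    unfolding X_def by (rule embedding_if_local_retractions[OF A Ps j ret])
  have inj: "inj_on j (mspace A)" by (rule homeomorphic_imp_injective_map[OF hom])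
  have jP: "?S \<subseteq> mspace P" using j by (simp add: smooth_map_iff)
  have N: "smooth_structure N" unfolding N_def by (rule smooth_structure_push[OF A hom])
  have top: "mtop N = X" by (simp add: N_def)
  have sp: "mspace N = ?S" using jP by (auto simp: top X_def)
  have incl_at: "smooth_at N P (\<lambda>x. x) q" if q: "q \<in> mspace N" for q
  proof -
    obtain a where a: "a \<in> mspace A" "q = j a" using q sp by auto
    have inv: "?i (j a) = a" using a(1) inj by simp
    have "smooth_at N P (\<lambda>q. j (?i q)) q"
      unfolding N_def a(2)
      by (rule smooth_at_compose[OF N[unfolded N_def] A Ps smooth_at_push_inverse[OF A hom a(1)]])
         (use j a(1) inv in \<open>simp add: smooth_map_iff\<close>)
    then show ?thesis
      by (rule smooth_at_cong[OF N _ openin_topspace q]) (simp add: sp f_inv_into_f)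
  qed
  have incl: "smooth_map N P (\<lambda>x. x)"
    using incl_at jP by (simp add: smooth_map_iff sp)
  have "immersion N P (\<lambda>x. x)"
  proof (rule immersion_if_local_left_inverses[OF N Ps incl])
    fix q assume q: "q \<in> mspace N"
    obtain a where a: "a \<in> mspace A" "q = j a" using q sp by auto
    obtain \<rho> W where r: "smooth_at P A \<rho> (j a)" "openin (mtop P) W" "j a \<in> W"
      "\<And>b. b \<in> mspace A \<Longrightarrow> j b \<in> W \<Longrightarrow> \<rho> (j b) = b"
      using ret[OF a(1)] unfolding local_retraction_def by blast
    have "\<rho> (j a) = a" by (rule r(4)[OF a(1) r(3)])
    then have "smooth_at A N j (\<rho> (j a))"
      unfolding N_def using smooth_at_push[OF A hom a(1)] by simp
    then have "smooth_at P N (\<lambda>q. j (\<rho> q)) q"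
      unfolding a(2) by (rule smooth_at_compose[OF Ps A N r(1)])
    moreover have "openin (mtop N) (W \<inter> ?S)" using r(2) by (auto simp: top X_def openin_subtopology)
    ultimately show "\<exists>g W. smooth_at P N g q \<and> openin (mtop N) W \<and> q \<in> W \<and> (\<forall>q\<in>W. g q = q)"
      using r(3,4) a by (intro exI[of _ "\<lambda>q. j (\<rho> q)"] exI[of _ "W \<inter> ?S"]) auto
  qed
  moreover have "embedding_map (mtop N) (mtop P) (\<lambda>x. x)"
  proof -
    have "homeomorphic_maps X X (\<lambda>x. x) (\<lambda>x. x)" by (simp add: homeomorphic_maps_def)
    then have "homeomorphic_map X X (\<lambda>x. x)" using homeomorphic_map_maps by blast
    moreover have "subtopology (mtop P) ((\<lambda>x. x) ` mspace N) = X" by (simp add: sp X_def)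
    ultimately show ?thesis unfolding embedding_map_def top by simp
  qed
  moreover have "smooth_manifold N"
    using N P unfolding smooth_manifold_iff top X_def
    by (simp add: Hausdorff_space_subtopology second_countable_subtopology)
  ultimately show ?thesis
    unfolding embedded_submanifold_def embedded_structure_def smooth_embedding_def using sp by blast
qed

text \<open>
  The map \<open>j\<close> is smooth into \<open>N\<close> by the universal property of embedded submanifolds, and its inverse is
  locally the restriction of \<open>\<rho>\<close>.
\<close>

lemma diffeomorphism_onto_embedded:
  assumes A: "smooth_structure A" and P: "smooth_structure P" and j: "smooth_map A P j"
    and ret: "\<And>a. a \<in> mspace A \<Longrightarrow> local_retraction A P j a"
    and N: "embedded_structure P (j ` mspace A) N"
  shows "diffeomorphism A N j"
  unfolding diffeomorphism_def
proof (intro conjI)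
  note eN = embedded_structureD[OF N]
  have inj: "inj_on j (mspace A)"
    by (rule homeomorphic_imp_injective_map[OF embedding_if_local_retractions[OF A P j ret]])
  then show "bij_betw j (mspace A) (mspace N)" by (simp add: bij_betw_def eN(2))
  show "smooth_map A N j"
    unfolding smooth_map_iff
  proof (intro conjI ballI)
    fix a assume a: "a \<in> mspace A"
    show "smooth_at A N j a"
      by (rule smooth_at_into_embedded[OF A P N _ openin_topspace a])
         (use j a in \<open>simp_all add: smooth_map_iff\<close>)
  qed (simp add: eN(2))
  show "smooth_map N A (inv_into (mspace A) j)"
    unfolding smooth_map_iff
  proof (intro conjI ballI)
    show "inv_into (mspace A) j ` mspace N \<subseteq> mspace A" using inj by (auto simp: eN(2))
    fix q assume q: "q \<in> mspace N"
    then obtain a where a: "a \<in> mspace A" "q = j a" using eN(2) by auto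
    obtain \<rho> W where r: "smooth_at P A \<rho> (j a)" "openin (mtop P) W" "j a \<in> W"
      "\<And>b. b \<in> mspace A \<Longrightarrow> j b \<in> W \<Longrightarrow> \<rho> (j b) = b"
      using ret[OF a(1)] unfolding local_retraction_def by blast
    have "smooth_at N P (\<lambda>x. x) q" using eN(5) q by (simp add: smooth_map_iff)
    then have "smooth_at N A (\<lambda>x. \<rho> x) q"
      using r(1) a(2) by (intro smooth_at_compose[OF eN(1) P A, where f = "\<lambda>x. x"]) simp_all
    moreover have "openin (mtop N) (W \<inter> j ` mspace A)"
      using r(2) by (auto simp: eN(3) openin_subtopology)
    moreover have "\<rho> y = inv_into (mspace A) j y" if "y \<in> W \<inter> j ` mspace A" for y
      using that r(4) inj by auto
    ultimately show "smooth_at N A (inv_into (mspace A) j) q"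
      using smooth_at_cong[OF eN(1)] r(3) a by blast
  qed
qed

section \<open>The algebra of a twist\<close>

text \<open>
  Groupoid homomorphisms are only required to respect composition; that they map units to units follows
  because units are exactly the idempotents.
\<close>

lemma idempotent_is_unit:
  assumes H: "algebraic_groupoid H" and x: "x \<in> arrows H" "gsource H x = grange H x" "gcomp H x x = x"
  shows "x = grange H x"
proof -
  have ax: "ginv H x \<in> arrows H" "gsource H (ginv H x) = grange H x" "gcomp H (ginv H x) x = gsource H x"
    "gcomp H (grange H x) x = x"
    using H x(1) unfolding algebraic_groupoid_def by blast+
  have assoc: "\<forall>x y z. (x, y) \<in> composable H \<and> (y, z) \<in> composable H \<longrightarrow>
      gcomp H (gcomp H x y) z = gcomp H x (gcomp H y z)"
    using H unfolding algebraic_groupoid_def by (elim conjE)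
  have "(ginv H x, x) \<in> composable H" "(x, x) \<in> composable H"
    using ax x by (simp_all add: composable_def)
  then have "gcomp H (gcomp H (ginv H x) x) x = gcomp H (ginv H x) (gcomp H x x)"
    using assoc by blast
  then show ?thesis using ax x by simp
qed

lemma groupoid_units:
  assumes "algebraic_groupoid H" and "x \<in> arrows H"
  shows "grange H x \<in> arrows H" "gsource H x \<in> arrows H" "grange H (grange H x) = grange H x"
    "gsource H (grange H x) = grange H x" "grange H (gsource H x) = gsource H x"
    "gsource H (gsource H x) = gsource H x" "gcomp H (grange H x) x = x" "gcomp H x (gsource H x) = x"
  using assms unfolding algebraic_groupoid_def by blast+

locale twist =
  fixes G :: "'g groupoid" and E :: "'e groupoid" and \<iota> :: "complex \<times> 'g \<Rightarrow> 'e" and \<pi> :: "'e \<Rightarrow> 'g"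
  assumes twist: "topological_twist G E \<iota> \<pi>" and groupoid: "algebraic_groupoid G"
begin

lemma algE: "algebraic_groupoid E"
  using twist by (simp add: topological_twist_def topological_groupoid_def)

lemmas grpE = groupoid_units[OF algE] and grpG = groupoid_units[OF groupoid]

lemma compE:
  assumes "e \<in> arrows E" "f \<in> arrows E" "gsource E e = grange E f"
  shows "gcomp E e f \<in> arrows E"
proof -
  have "\<forall>(e, f)\<in>composable E. gcomp E e f \<in> arrows E \<and>
      grange E (gcomp E e f) = grange E e \<and> gsource E (gcomp E e f) = gsource E f"
    using algE unfolding algebraic_groupoid_def by (elim conjE)
  moreover have "(e, f) \<in> composable E" using assms by (simp add: composable_def)
  ultimately show ?thesis by auto
qed

lemma units_subset: "units G \<subseteq> arrows G" "units E \<subseteq> arrows E"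
  using grpG(1) grpE(1) by (auto simp: units_def)

lemma unit_range_source:
  assumes "x \<in> units G"
  shows "grange G x = x" "gsource G x = x"
  using assms grpG by (auto simp: units_def)

lemma unitE_range_source:
  assumes "e \<in> units E"
  shows "grange E e = e" "gsource E e = e"
  using assms grpE by (auto simp: units_def)

lemma range_source_units:
  "x \<in> arrows G \<Longrightarrow> grange G x \<in> units G" "x \<in> arrows G \<Longrightarrow> gsource G x \<in> units G"
  "e \<in> arrows E \<Longrightarrow> grange E e \<in> units E" "e \<in> arrows E \<Longrightarrow> gsource E e \<in> units E"
  by (auto simp: units_def) (metis grpG(2,5) grpE(2,5) imageI)+

lemma pi_arrow: "e \<in> arrows E \<Longrightarrow> \<pi> e \<in> arrows G"
  using twist by (auto simp: topological_twist_def)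

lemma pi_comp:
  assumes "e \<in> arrows E" "f \<in> arrows E" "gsource E e = grange E f"
  shows "gsource G (\<pi> e) = grange G (\<pi> f)" "\<pi> (gcomp E e f) = gcomp G (\<pi> e) (\<pi> f)"
proof -
  have "groupoid_hom E G \<pi>" using twist by (simp add: topological_twist_def)
  moreover have "(e, f) \<in> composable E" using assms by (simp add: composable_def)
  ultimately have "(\<pi> e, \<pi> f) \<in> composable G \<and> \<pi> (gcomp E e f) = gcomp G (\<pi> e) (\<pi> f)"
    unfolding groupoid_hom_def by blast
  then show "gsource G (\<pi> e) = grange G (\<pi> f)" "\<pi> (gcomp E e f) = gcomp G (\<pi> e) (\<pi> f)"
    by (auto simp: composable_def)
qed

lemma pi_unit:
  assumes u: "u \<in> units E"
  shows "\<pi> u \<in> units G"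
proof -
  have uE: "u \<in> arrows E" using u units_subset by auto
  have "gsource G (\<pi> u) = grange G (\<pi> u)" "gcomp G (\<pi> u) (\<pi> u) = \<pi> u"
    using pi_comp[OF uE uE] unitE_range_source[OF u] grpE(7)[OF uE] by auto
  then have "\<pi> u = grange G (\<pi> u)" by (intro idempotent_is_unit groupoid pi_arrow uE)
  then show ?thesis using pi_arrow[OF uE] unfolding units_def by (rule image_eqI)
qed

lemma pi_range_source:
  assumes e: "e \<in> arrows E"
  shows "\<pi> (grange E e) = grange G (\<pi> e)" "\<pi> (gsource E e) = gsource G (\<pi> e)"
proof -
  have "gsource G (\<pi> (grange E e)) = grange G (\<pi> e)"
    by (rule pi_comp(1)) (use e grpE in auto)
  then show "\<pi> (grange E e) = grange G (\<pi> e)"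
    using unit_range_source pi_unit range_source_units(3)[OF e] by metis
  have "gsource G (\<pi> e) = grange G (\<pi> (gsource E e))"
    by (rule pi_comp(1)) (use e grpE in auto)
  then show "\<pi> (gsource E e) = gsource G (\<pi> e)"
    using unit_range_source pi_unit range_source_units(4)[OF e] by metis
qed

lemma trivial_arrows: "arrows (trivial_circle_bundle G) = circle \<times> units G"
  using units_subset by (auto simp: trivial_circle_bundle_def)

lemma iota_arrow: "z \<in> circle \<Longrightarrow> y \<in> units G \<Longrightarrow> \<iota> (z, y) \<in> arrows E"
  using twist trivial_arrows by (auto simp: topological_twist_def groupoid_hom_def image_subset_iff)

lemma iota_comp:
  assumes "z \<in> circle" "w \<in> circle" "y \<in> units G"
  shows "gsource E (\<iota> (z, y)) = grange E (\<iota> (w, y))"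
    and "gcomp E (\<iota> (z, y)) (\<iota> (w, y)) = \<iota> (z * w, y)"
proof -
  have "groupoid_hom (trivial_circle_bundle G) E \<iota>" using twist by (simp add: topological_twist_def)
  moreover have "((z, y), (w, y)) \<in> composable (trivial_circle_bundle G)"
    unfolding composable_def trivial_arrows using assms by (simp add: trivial_circle_bundle_def)
  ultimately have "(\<iota> (z, y), \<iota> (w, y)) \<in> composable E \<and>
      \<iota> (gcomp (trivial_circle_bundle G) (z, y) (w, y)) = gcomp E (\<iota> (z, y)) (\<iota> (w, y))"
    unfolding groupoid_hom_def by blast
  then show "gsource E (\<iota> (z, y)) = grange E (\<iota> (w, y))" "gcomp E (\<iota> (z, y)) (\<iota> (w, y)) = \<iota> (z * w, y)"
    by (auto simp: composable_def trivial_circle_bundle_def)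
qed

lemma iota_image: "\<iota> ` (circle \<times> units G) = preim E \<pi> (units G)" and iota_inj: "inj_on \<iota> (circle \<times> units G)"
proof -
  have h: "homeomorphic_map (gtop (trivial_circle_bundle G)) (subtopology (gtop E) (preim E \<pi> (units G))) \<iota>"
    using twist by (simp add: topological_twist_def)
  show "\<iota> ` (circle \<times> units G) = preim E \<pi> (units G)"
    using homeomorphic_imp_surjective_map[OF h] unfolding trivial_arrows by (auto simp: preim_def)
  show "inj_on \<iota> (circle \<times> units G)"
    using homeomorphic_imp_injective_map[OF h] unfolding trivial_arrows .
qed

lemma iota_pi_unit: "u \<in> units E \<Longrightarrow> \<iota> (1, \<pi> u) = u"
  using twist by (simp add: topological_twist_def)

text \<open>
  Being idempotent, \<open>\<iota>(1, y)\<close> is a unit \<open>u\<close>, so \<open>\<iota>(1, \<pi>(u)) = u = \<iota>(1, y)\<close> and injectivity of \<open>\<iota>\<close> gives \<open>\<pi>(u) = y\<close>.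
\<close>

lemma iota_unit:
  assumes y: "y \<in> units G"
  shows "\<iota> (1, y) \<in> units E" "\<pi> (\<iota> (1, y)) = y"
proof -
  have e: "\<iota> (1, y) \<in> arrows E" by (rule iota_arrow) (use y in auto)
  have "\<iota> (1, y) = grange E (\<iota> (1, y))"
    by (rule idempotent_is_unit[OF algE e]) (use iota_comp[of 1 1 y] y in auto)
  then show u: "\<iota> (1, y) \<in> units E" using e unfolding units_def by (rule image_eqI)
  have "\<iota> (1, \<pi> (\<iota> (1, y))) = \<iota> (1, y)" by (rule iota_pi_unit[OF u])
  then show "\<pi> (\<iota> (1, y)) = y" using inj_onD[OF iota_inj, of "(1, \<pi> (\<iota> (1, y)))" "(1, y)"] y pi_unit[OF u] by auto
qed

lemma iota_range:
  assumes z: "z \<in> circle" and y: "y \<in> units G"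
  shows "grange E (\<iota> (z, y)) = \<iota> (1, y)" "\<pi> (\<iota> (z, y)) = y"
proof -
  show r: "grange E (\<iota> (z, y)) = \<iota> (1, y)"
    using iota_comp(1)[of 1 z y] z y unitE_range_source(2)[OF iota_unit(1)[OF y]] by simp
  have "\<iota> (z, y) \<in> preim E \<pi> (units G)" unfolding iota_image[symmetric] using z y by blast
  then have "\<pi> (\<iota> (z, y)) \<in> units G" by (simp add: preim_def)
  then show "\<pi> (\<iota> (z, y)) = y"
    using pi_range_source(1)[OF iota_arrow[OF z y]] r iota_unit(2)[OF y] unit_range_source(1) by metis
qed

lemma units_E_eq: "units E = (\<lambda>y. \<iota> (1, y)) ` units G"
proof
  show "units E \<subseteq> (\<lambda>y. \<iota> (1, y)) ` units G"
  proof
    fix u assume u: "u \<in> units E"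
    show "u \<in> (\<lambda>y. \<iota> (1, y)) ` units G"
      by (rule image_eqI[where x = "\<pi> u"]) (simp_all add: iota_pi_unit[OF u] pi_unit[OF u])
  qed
qed (use iota_unit(1) in auto)

lemma range_source_E_eq:
  assumes e: "e \<in> arrows E"
  shows "grange E e = \<iota> (1, grange G (\<pi> e))" "gsource E e = \<iota> (1, gsource G (\<pi> e))"
  using iota_pi_unit[OF range_source_units(3)[OF e]] iota_pi_unit[OF range_source_units(4)[OF e]]
    pi_range_source[OF e] by simp_all

abbreviation act :: "complex \<Rightarrow> 'e \<Rightarrow> 'e" where
  "act \<equiv> twist_action E \<iota> \<pi>"

lemma act_iota:
  assumes "z \<in> circle" "w \<in> circle" "y \<in> units G"
  shows "act z (\<iota> (w, y)) = \<iota> (z * w, y)"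
  using iota_range(1)[OF assms(2,3)] iota_unit(2)[OF assms(3)] iota_comp(2)[OF assms]
  by (simp add: twist_action_def)

lemma act_arrow:
  assumes z: "z \<in> circle" and e: "e \<in> arrows E"
  shows "act z e \<in> arrows E" "\<pi> (act z e) = \<pi> e"
proof -
  let ?y = "\<pi> (grange E e)"
  have y: "?y \<in> units G" by (rule pi_unit[OF range_source_units(3)[OF e]])
  have i: "\<iota> (z, ?y) \<in> arrows E" by (rule iota_arrow[OF z y])
  have "gsource E (\<iota> (z, ?y)) = grange E (\<iota> (1, ?y))" by (rule iota_comp(1)) (use z y in auto)
  then have c: "gsource E (\<iota> (z, ?y)) = grange E e"
    using iota_pi_unit[OF range_source_units(3)[OF e]] grpE(3)[OF e] by simp
  show "act z e \<in> arrows E"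
    unfolding twist_action_def by (rule compE[OF i e c])
  have "\<pi> (act z e) = gcomp G ?y (\<pi> e)"
    unfolding twist_action_def pi_comp(2)[OF i e c] iota_range(2)[OF z y] ..
  then show "\<pi> (act z e) = \<pi> e"
    using grpG(7)[OF pi_arrow[OF e]] by (simp add: pi_range_source(1)[OF e])
qed

end

section \<open>Smooth twists\<close>

locale smooth_twist = twist G E \<iota> \<pi>
  for G :: "'g groupoid" and E :: "'e groupoid" and \<iota> :: "complex \<times> 'g \<Rightarrow> 'e" and \<pi> :: "'e \<Rightarrow> 'g" +
  fixes M M\<^sub>0 :: "'g manifold" and P :: "'e manifold"
    and I :: "'i set" and U :: "'i \<Rightarrow> 'g set" and \<sigma> :: "'i \<Rightarrow> 'g \<Rightarrow> 'e"
  assumes lie: "lie_groupoid G M M\<^sub>0"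
    and top_P: "mtop P = gtop E"
    and principal: "smooth_principal_circle_bundle P M \<pi> (twist_action E \<iota> \<pi>)"
    and open_U: "\<And>\<alpha>. \<alpha> \<in> I \<Longrightarrow> openin (mtop M) (U \<alpha>)"
    and cover: "(\<Union>\<alpha>\<in>I. U \<alpha>) = arrows G"
    and sections: "\<And>\<alpha>. \<alpha> \<in> I \<Longrightarrow> smooth_section M P \<pi> (U \<alpha>) (\<sigma> \<alpha>)"
    and cond_U: "cond_U G M\<^sub>0 \<iota> I U \<sigma>"
begin

lemma M: "smooth_structure M" and top_M: "mtop M = gtop G"
  using lie by (auto simp: lie_groupoid_def smooth_manifold_imp_structure)

lemma Pm: "smooth_manifold P" and P: "smooth_structure P"
  using principal by (auto simp: smooth_principal_circle_bundle_def smooth_manifold_imp_structure)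

lemma emb0: "embedded_structure M (units G) M\<^sub>0"
  using lie by (simp add: lie_groupoid_def)

lemmas M0 = embedded_structureD(1)[OF emb0] and space_M0 = embedded_structureD(2)[OF emb0]
  and top_M0 = embedded_structureD(3)[OF emb0]

lemmas C = smooth_structure_circle

abbreviation CM\<^sub>0 :: "(complex \<times> 'g) manifold" where
  "CM\<^sub>0 \<equiv> product_manifold circle_manifold M\<^sub>0"

lemma CM0: "smooth_structure CM\<^sub>0"
  by (rule smooth_structure_product[OF C M0])

lemma smooth_incl0: "y \<in> units G \<Longrightarrow> smooth_at M\<^sub>0 M (\<lambda>y. y) y"
  using embedded_structureD(5)[OF emb0] by (simp add: smooth_map_iff space_M0)

lemma sub_r: "submersion M M\<^sub>0 (grange G)" and sub_s: "submersion M M\<^sub>0 (gsource G)"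
  using lie by (auto simp: lie_groupoid_def)

lemma smooth_r: "\<gamma> \<in> arrows G \<Longrightarrow> smooth_at M M\<^sub>0 (grange G) \<gamma>"
  using sub_r by (simp add: submersion_def smooth_map_iff top_M)

lemma smooth_map_pi: "smooth_map P M \<pi>"
  using principal by (simp add: smooth_principal_circle_bundle_def)

lemma smooth_pi: "e \<in> arrows E \<Longrightarrow> smooth_at P M \<pi> e"
  using smooth_map_pi by (simp add: smooth_map_iff top_P)

lemma smooth_act:
  assumes K: "smooth_structure K" and f: "smooth_at K circle_manifold f p" and g: "smooth_at K P g p"
  shows "smooth_at K P (\<lambda>q. act (f q) (g q)) p"
proof -
  note CP = smooth_structure_product[OF C P]
  have fg: "smooth_at K (product_manifold circle_manifold P) (\<lambda>q. (f q, g q)) p"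
    by (rule smooth_at_Pair[OF K C P f g])
  have "smooth_map (product_manifold circle_manifold P) P (\<lambda>(z, e). act z e)"
    using principal by (simp add: smooth_principal_circle_bundle_def)
  then have "smooth_at (product_manifold circle_manifold P) P (\<lambda>(z, e). act z e) (f p, g p)"
    using smooth_at_imp_mspace(2)[OF K CP fg] by (simp add: smooth_map_iff)
  from smooth_at_compose[OF K CP P fg this] show ?thesis by simp
qed

lemma smooth_inverse:
  assumes K: "smooth_structure K" and f: "smooth_at K circle_manifold f p"
  shows "smooth_at K circle_manifold (\<lambda>q. inverse (f q)) p"
  using smooth_at_imp_mspace(2)[OF K C f]
  by (intro smooth_at_compose[OF K C C f] smooth_at_circle_inverse) simp

lemma open_preim: "openin (gtop G) V \<Longrightarrow> openin (mtop P) {e \<in> arrows E. \<pi> e \<in> V}"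
  using twist openin_continuous_map_preimage by (fastforce simp: topological_twist_def top_P)

lemma smooth_section_iff:
  assumes V: "openin (gtop G) V"
  shows "smooth_section M P \<pi> V \<tau> \<longleftrightarrow> (\<forall>\<gamma>\<in>V. smooth_at M P \<tau> \<gamma> \<and> \<pi> (\<tau> \<gamma>) = \<gamma>)"
proof -
  let ?Q = "{e \<in> mspace P. \<pi> e \<in> V}"
  have VM: "openin (mtop M) V" using V by (simp add: top_M)
  note MV = smooth_structure_open_submanifold[OF M VM]
  have Q: "openin (mtop P) ?Q" using open_preim[OF V] by (simp add: top_P)
  have sub: "V \<subseteq> mspace M" by (rule openin_subset[OF VM])
  have space: "mspace (open_submanifold M V) = V" using sub by auto
  have at_iff: "smooth_at (open_submanifold M V) (open_submanifold P ?Q) \<tau> \<gamma> \<longleftrightarrow> smooth_at M P \<tau> \<gamma>"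
    if "\<gamma> \<in> V" "\<tau> \<gamma> \<in> ?Q" for \<gamma>
    using smooth_at_open_submanifold_codomain[where f = \<tau> and p = \<gamma>, OF MV P Q that(2)]
      smooth_at_open_submanifold_domain[OF M VM that(1)] by simp
  show ?thesis
  proof
    assume s: "smooth_section M P \<pi> V \<tau>"
    then have "\<tau> ` V \<subseteq> ?Q" unfolding smooth_section_def smooth_map_iff space by auto
    then show "\<forall>\<gamma>\<in>V. smooth_at M P \<tau> \<gamma> \<and> \<pi> (\<tau> \<gamma>) = \<gamma>"
      using s at_iff unfolding smooth_section_def smooth_map_iff space by blast
  next
    assume t: "\<forall>\<gamma>\<in>V. smooth_at M P \<tau> \<gamma> \<and> \<pi> (\<tau> \<gamma>) = \<gamma>"
    then have "\<tau> \<gamma> \<in> ?Q" if "\<gamma> \<in> V" for \<gamma>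
      using smooth_at_imp_mspace(2)[OF M P] that by auto
    then show "smooth_section M P \<pi> V \<tau>"
      using t at_iff unfolding smooth_section_def smooth_map_iff space by auto
  qed
qed

text \<open>
  Multiplying \<open>\<sigma>\<^sub>\<alpha>\<close> by the inverse of \<open>k\<^sub>\<alpha> \<circ> r\<close> normalises it on the units. Composing with
  the range map is what extends \<open>k\<^sub>\<alpha>\<close> smoothly from the units to a neighbourhood.
\<close>

lemma normalised_section:
  assumes x: "x \<in> units G"
  obtains V \<tau> where "openin (gtop G) V" "x \<in> V" "\<And>\<gamma>. \<gamma> \<in> V \<Longrightarrow> smooth_at M P \<tau> \<gamma>"
    "\<And>\<gamma>. \<gamma> \<in> V \<Longrightarrow> \<pi> (\<tau> \<gamma>) = \<gamma>" "\<And>y. y \<in> V \<inter> units G \<Longrightarrow> \<tau> y = \<iota> (1, y)"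
proof -
  have "x \<in> (\<Union>\<alpha>\<in>I. U \<alpha>)" using x units_subset cover by auto
  then obtain \<alpha> where \<alpha>: "\<alpha> \<in> I" "x \<in> U \<alpha>" by blast
  have Uop: "openin (gtop G) (U \<alpha>)" using open_U[OF \<alpha>(1)] by (simp add: top_M)
  have \<sigma>: "smooth_at M P (\<sigma> \<alpha>) \<gamma>" "\<pi> (\<sigma> \<alpha> \<gamma>) = \<gamma>" if "\<gamma> \<in> U \<alpha>" for \<gamma>
    using sections[OF \<alpha>(1)] that unfolding smooth_section_iff[OF Uop] by auto
  obtain k where k: "smooth_map (open_submanifold M\<^sub>0 (U \<alpha> \<inter> units G)) circle_manifold k"
    "\<And>y. y \<in> U \<alpha> \<inter> units G \<Longrightarrow> \<sigma> \<alpha> y = \<iota> (k y, y)"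
    using cond_U \<alpha>(1) unfolding cond_U_def by blast
  have U0: "openin (mtop M\<^sub>0) (U \<alpha> \<inter> units G)"
    unfolding top_M0 by (rule openin_subtopology_Int[OF open_U[OF \<alpha>(1)]])
  have space: "mspace (open_submanifold M\<^sub>0 (U \<alpha> \<inter> units G)) = U \<alpha> \<inter> units G"
    using space_M0 by auto
  have k_at: "smooth_at M\<^sub>0 circle_manifold k y" and k_circle: "k y \<in> circle" if y: "y \<in> U \<alpha> \<inter> units G" for y
  proof -
    show "k y \<in> circle" using k(1) y unfolding smooth_map_iff space by auto
    have "smooth_at (open_submanifold M\<^sub>0 (U \<alpha> \<inter> units G)) circle_manifold k y"
      using k(1) y unfolding smooth_map_iff space by blast
    then show "smooth_at M\<^sub>0 circle_manifold k y"
      by (simp only: smooth_at_open_submanifold_domain[OF M0 U0 y])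
  qed
  define V where "V = U \<alpha> \<inter> {\<gamma> \<in> arrows G. grange G \<gamma> \<in> U \<alpha> \<inter> units G}"
  define \<tau> where "\<tau> \<gamma> = act (inverse (k (grange G \<gamma>))) (\<sigma> \<alpha> \<gamma>)" for \<gamma>
  have "continuous_map (mtop M) (mtop M\<^sub>0) (grange G)"
    using sub_r by (intro smooth_map_imp_continuous_map M M0) (simp add: submersion_def)
  from openin_continuous_map_preimage[OF this U0]
  have V: "openin (gtop G) V" unfolding V_def using Uop by (auto simp: top_M intro: openin_Int)
  have gr: "grange G \<gamma> \<in> U \<alpha> \<inter> units G" "\<gamma> \<in> U \<alpha>" "\<gamma> \<in> arrows G" if "\<gamma> \<in> V" for \<gamma>
    using that by (auto simp: V_def)
  show thesis
  proof (rule that[OF V, of \<tau>])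
    show "x \<in> V" using \<alpha>(2) x units_subset unit_range_source(1)[OF x] by (auto simp: V_def)
    show "smooth_at M P \<tau> \<gamma>" if g: "\<gamma> \<in> V" for \<gamma>
      unfolding \<tau>_def
      by (intro smooth_act[OF M] smooth_inverse[OF M] \<sigma> gr[OF g] smooth_at_compose[OF M M0 C smooth_r k_at])
    show "\<pi> (\<tau> \<gamma>) = \<gamma>" if g: "\<gamma> \<in> V" for \<gamma>
    proof -
      have "inverse (k (grange G \<gamma>)) \<in> circle" using k_circle[OF gr(1)[OF g]] by (simp add: norm_inverse)
      moreover have "\<sigma> \<alpha> \<gamma> \<in> arrows E"
        using smooth_at_imp_mspace(2)[OF M P \<sigma>(1)[OF gr(2)[OF g]]] by (simp add: top_P)
      ultimately show ?thesis unfolding \<tau>_def using act_arrow(2) \<sigma>(2)[OF gr(2)[OF g]] by simp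
    qed
    show "\<tau> y = \<iota> (1, y)" if y: "y \<in> V \<inter> units G" for y
    proof -
      have y': "y \<in> U \<alpha> \<inter> units G" "grange G y = y" using y gr unit_range_source(1) by auto
      have "k y \<in> circle" by (rule k_circle[OF y'(1)])
      then have "k y \<noteq> 0" "inverse (k y) \<in> circle" by (auto simp: norm_inverse)
      then show ?thesis
        using act_iota[of "inverse (k y)" "k y" y] k(2)[OF y'(1)] \<open>k y \<in> circle\<close> y' by (simp add: \<tau>_def)
    qed
  qed
qed

text \<open>
  Locally the map is the restriction of a normalised section to the units.
\<close>

lemma smooth_unit_map: "smooth_map M\<^sub>0 P (\<lambda>y. \<iota> (1, y))"
  unfolding smooth_map_iff space_M0
proof (intro conjI ballI)
  show "(\<lambda>y. \<iota> (1, y)) ` units G \<subseteq> mspace P" using iota_arrow by (auto simp: top_P)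
  fix x assume x: "x \<in> units G"
  obtain V \<tau> where V: "openin (gtop G) V" "x \<in> V" "\<And>\<gamma>. \<gamma> \<in> V \<Longrightarrow> smooth_at M P \<tau> \<gamma>"
    "\<And>\<gamma>. \<gamma> \<in> V \<Longrightarrow> \<pi> (\<tau> \<gamma>) = \<gamma>" "\<And>y. y \<in> V \<inter> units G \<Longrightarrow> \<tau> y = \<iota> (1, y)"
    by (rule normalised_section[OF x]) blast
  have "smooth_at M\<^sub>0 P (\<lambda>y. \<tau> y) x"
    by (rule smooth_at_compose[OF M0 M P smooth_incl0[OF x] V(3)[OF V(2)]])
  moreover have "openin (mtop M\<^sub>0) (V \<inter> units G)"
    unfolding top_M0 top_M by (rule openin_subtopology_Int[OF V(1)])
  ultimately show "smooth_at M\<^sub>0 P (\<lambda>y. \<iota> (1, y)) x"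
    by (rule smooth_at_cong[OF M0]) (use x V(2,5) in auto)
qed

lemma smooth_range_pi: "e \<in> arrows E \<Longrightarrow> smooth_at P M\<^sub>0 (\<lambda>e. grange G (\<pi> e)) e"
  by (intro smooth_at_compose[OF P M M0] smooth_pi smooth_r pi_arrow)

lemma unit_map_retraction:
  assumes "y \<in> mspace M\<^sub>0"
  shows "local_retraction M\<^sub>0 P (\<lambda>y. \<iota> (1, y)) y"
proof -
  have "\<iota> (1, y) \<in> arrows E" using iota_arrow assms by (simp add: space_M0)
  moreover have "grange G (\<pi> (\<iota> (1, b))) = b" if "b \<in> mspace M\<^sub>0" for b
    using iota_unit(2) unit_range_source(1) that by (simp add: space_M0)
  ultimately show ?thesis
    unfolding local_retraction_def using smooth_range_pi
    by (intro exI[of _ "\<lambda>e. grange G (\<pi> e)"] exI[of _ "mspace P"]) (auto simp: top_P)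
qed

text \<open>
  The map \<open>f\<close> is the circle coordinate of an equivariant trivialisation. The section through \<open>e\<close> is the slice on
  which the circle coordinate has the constant value \<open>f e\<close>.
\<close>

lemma local_trivialisation:
  assumes p: "p \<in> arrows G"
  obtains V f where "openin (gtop G) V" "p \<in> V"
    "\<And>e. e \<in> arrows E \<Longrightarrow> \<pi> e \<in> V \<Longrightarrow> smooth_at P circle_manifold f e"
    "\<And>e z. e \<in> arrows E \<Longrightarrow> \<pi> e \<in> V \<Longrightarrow> z \<in> circle \<Longrightarrow> f (act z e) = z * f e"
    "\<And>e. e \<in> arrows E \<Longrightarrow> \<pi> e \<in> V \<Longrightarrow>
      \<exists>s. smooth_at M P s (\<pi> e) \<and> s (\<pi> e) = e \<and> (\<forall>\<gamma>\<in>V. \<pi> (s \<gamma>) = \<gamma>)"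
proof -
  have charts: "\<forall>p\<in>mspace M. \<exists>V \<Phi>. openin (mtop M) V \<and> p \<in> V \<and>
      diffeomorphism (open_submanifold P {e \<in> mspace P. \<pi> e \<in> V})
        (product_manifold circle_manifold (open_submanifold M V)) \<Phi> \<and>
      (\<forall>e\<in>mspace P. \<pi> e \<in> V \<longrightarrow> snd (\<Phi> e) = \<pi> e \<and>
        (\<forall>z\<in>circle. \<Phi> (act z e) = (z * fst (\<Phi> e), \<pi> e)))"
    using principal unfolding smooth_principal_circle_bundle_def by (elim conjE)
  have "p \<in> mspace M" using p by (simp add: top_M)
  from bspec[OF charts this] obtain V \<Phi> where V: "openin (mtop M) V" "p \<in> V"
    and diff: "diffeomorphism (open_submanifold P {e \<in> mspace P. \<pi> e \<in> V})
      (product_manifold circle_manifold (open_submanifold M V)) \<Phi>"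
    and eq: "\<forall>e\<in>mspace P. \<pi> e \<in> V \<longrightarrow> snd (\<Phi> e) = \<pi> e \<and>
      (\<forall>z\<in>circle. \<Phi> (act z e) = (z * fst (\<Phi> e), \<pi> e))"
    by (elim exE conjE) simp_all
  have eqv: "\<And>e. e \<in> mspace P \<Longrightarrow> \<pi> e \<in> V \<Longrightarrow> snd (\<Phi> e) = \<pi> e"
    "\<And>e z. e \<in> mspace P \<Longrightarrow> \<pi> e \<in> V \<Longrightarrow> z \<in> circle \<Longrightarrow> \<Phi> (act z e) = (z * fst (\<Phi> e), \<pi> e)"
    using eq by blast+
  let ?Q = "{e \<in> mspace P. \<pi> e \<in> V}"
  define PQ where "PQ = open_submanifold P ?Q"
  define MV where "MV = open_submanifold M V"
  define CMV where "CMV = product_manifold circle_manifold MV"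
  have VG: "openin (gtop G) V" using V(1) by (simp add: top_M)
  have Q: "openin (mtop P) ?Q" using open_preim[OF VG] by (simp add: top_P)
  have PQ: "smooth_structure PQ" unfolding PQ_def by (rule smooth_structure_open_submanifold[OF P Q])
  have MV: "smooth_structure MV" unfolding MV_def by (rule smooth_structure_open_submanifold[OF M V(1)])
  have CMV: "smooth_structure CMV" unfolding CMV_def by (rule smooth_structure_product[OF C MV])
  have sPQ: "mspace PQ = ?Q" and sMV: "mspace MV = V"
    using openin_subset[OF V(1)] by (auto simp: PQ_def MV_def)
  have sCMV: "mspace CMV = circle \<times> V" by (simp add: CMV_def sMV)
  have bij: "bij_betw \<Phi> ?Q (circle \<times> V)" and sm: "smooth_map PQ CMV \<Phi>" and sm': "smooth_map CMV PQ (inv_into ?Q \<Phi>)"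
    using diff unfolding diffeomorphism_def PQ_def[symmetric] MV_def[symmetric] CMV_def[symmetric] sPQ sCMV by auto
  have \<Phi>: "\<Phi> e \<in> circle \<times> V" if "e \<in> ?Q" for e using bij that by (auto simp: bij_betw_def)
  show thesis
  proof (rule that[OF VG V(2)])
    fix e assume e: "e \<in> arrows E" "\<pi> e \<in> V"
    then have eQ: "e \<in> ?Q" by (simp add: top_P)
    have "smooth_at PQ CMV \<Phi> e" using sm eQ by (simp add: smooth_map_iff sPQ)
    then have "smooth_at PQ circle_manifold (\<lambda>e. fst (\<Phi> e)) e"
      using smooth_at_compose[OF PQ CMV C _ smooth_at_fst_snd(1)[OF C MV, folded CMV_def]] \<Phi>[OF eQ] by (simp add: sMV)
    then show "smooth_at P circle_manifold (\<lambda>e. fst (\<Phi> e)) e"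
      unfolding PQ_def by (simp only: smooth_at_open_submanifold_domain[OF P Q eQ])
    show "fst (\<Phi> (act z e)) = z * fst (\<Phi> e)" if "z \<in> circle" for z
      using eqv(2)[of e z] eQ that by simp
    let ?c = "fst (\<Phi> e)" and ?i = "inv_into ?Q \<Phi>"
    have c: "?c \<in> circle" using \<Phi>[OF eQ] by (auto simp: mem_Times_iff)
    have \<Phi>e: "(?c, \<pi> e) = \<Phi> e" using eqv(1)[of e] eQ by (metis (no_types, lifting) mem_Collect_eq prod.collapse)
    have s: "?i (?c, \<pi> e) = e" unfolding \<Phi>e using bij eQ by (simp add: bij_betw_def)
    have "smooth_at MV CMV (\<lambda>\<gamma>. (?c, \<gamma>)) (\<pi> e)"
      unfolding CMV_def
      by (intro smooth_at_Pair MV C smooth_at_const smooth_at_id) (use c e(2) sMV in auto)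
    moreover have "smooth_at CMV PQ ?i (?c, \<pi> e)"
      using sm' c e(2) by (simp add: smooth_map_iff sCMV)
    ultimately have "smooth_at MV PQ (\<lambda>\<gamma>. ?i (?c, \<gamma>)) (\<pi> e)" by (rule smooth_at_compose[OF MV CMV PQ])
    then have "smooth_at MV P (\<lambda>\<gamma>. ?i (?c, \<gamma>)) (\<pi> e)"
      using smooth_at_open_submanifold_codomain[OF MV P Q, of "\<lambda>\<gamma>. ?i (?c, \<gamma>)" "\<pi> e"] eQ
      unfolding s PQ_def by blast
    then have "smooth_at M P (\<lambda>\<gamma>. ?i (?c, \<gamma>)) (\<pi> e)"
      unfolding MV_def by (simp only: smooth_at_open_submanifold_domain[OF M V(1) e(2)])
    moreover have "\<pi> (?i (?c, \<gamma>)) = \<gamma>" if g: "\<gamma> \<in> V" for \<gamma>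
    proof -
      have "(?c, \<gamma>) \<in> \<Phi> ` ?Q" using bij c g by (simp add: bij_betw_def)
      then have "?i (?c, \<gamma>) \<in> ?Q" "\<Phi> (?i (?c, \<gamma>)) = (?c, \<gamma>)" by (rule inv_into_into, rule f_inv_into_f)
      then show ?thesis using eqv(1)[of "?i (?c, \<gamma>)"] by simp
    qed
    ultimately show "\<exists>s. smooth_at M P s (\<pi> e) \<and> s (\<pi> e) = e \<and> (\<forall>\<gamma>\<in>V. \<pi> (s \<gamma>) = \<gamma>)"
      using s by (intro exI[of _ "\<lambda>\<gamma>. ?i (?c, \<gamma>)"]) auto
  qed
qed

text \<open>This rests on \<open>\<iota>(z, y) = z \<cdot> \<iota>(1, y)\<close>.\<close>

lemma smooth_iota: "smooth_map CM\<^sub>0 P \<iota>"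
  unfolding smooth_map_iff
proof (intro conjI ballI)
  have space: "mspace CM\<^sub>0 = circle \<times> units G" by (simp add: space_M0)
  show "\<iota> ` mspace CM\<^sub>0 \<subseteq> mspace P"
    unfolding space using iota_arrow by (auto simp: top_P)
  fix p assume p: "p \<in> mspace CM\<^sub>0"
  note pr = smooth_at_fst_snd[OF C M0, of p]
  have p': "p \<in> mspace circle_manifold \<times> mspace M\<^sub>0" using p by simp
  have "smooth_at M\<^sub>0 P (\<lambda>y. \<iota> (1, y)) (snd p)"
    using smooth_unit_map p' by (simp add: smooth_map_iff mem_Times_iff)
  from smooth_at_compose[OF CM0 M0 P pr(2)[OF p'] this]
  have "smooth_at CM\<^sub>0 P (\<lambda>p. act (fst p) (\<iota> (1, snd p))) p"
    by (rule smooth_act[OF CM0 pr(1)[OF p']])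
  then show "smooth_at CM\<^sub>0 P \<iota> p"
  proof (rule smooth_at_cong[OF CM0 _ openin_topspace p])
    fix q assume "q \<in> mspace CM\<^sub>0"
    then obtain z y where "q = (z, y)" "z \<in> circle" "y \<in> units G" unfolding space by auto
    then show "act (fst q) (\<iota> (1, snd q)) = \<iota> q" using act_iota[of z 1 y] by simp
  qed
qed

text \<open>
  A left inverse near a point of the image is \<open>e \<mapsto> (f(f(\<tau>(\<pi>(e)))\<inverse> \<cdot> e), r(\<pi>(e)))\<close>, where \<open>f\<close> is the circle
  coordinate of a trivialisation and \<open>\<tau>\<close> a normalised section. The factor \<open>f(\<tau>(\<pi>(e)))\<inverse>\<close> replaces \<open>f\<close> by the circle
  coordinate in which \<open>\<tau>\<close> is constant with value 1.
\<close>

lemma iota_retraction: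
  assumes p: "p \<in> mspace CM\<^sub>0"
  shows "local_retraction CM\<^sub>0 P \<iota> p"
proof -
  have space: "mspace CM\<^sub>0 = circle \<times> units G" by (simp add: space_M0)
  obtain z x where zx: "p = (z, x)" "z \<in> circle" "x \<in> units G" using p unfolding space by auto
  obtain V \<tau> where V: "openin (gtop G) V" "x \<in> V" "\<And>\<gamma>. \<gamma> \<in> V \<Longrightarrow> smooth_at M P \<tau> \<gamma>"
    "\<And>\<gamma>. \<gamma> \<in> V \<Longrightarrow> \<pi> (\<tau> \<gamma>) = \<gamma>" "\<And>y. y \<in> V \<inter> units G \<Longrightarrow> \<tau> y = \<iota> (1, y)"
    by (rule normalised_section[OF zx(3)]) blast
  have "x \<in> arrows G" using zx(3) units_subset by auto
  then obtain V' f where V': "openin (gtop G) V'" "x \<in> V'"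
    "\<And>e. e \<in> arrows E \<Longrightarrow> \<pi> e \<in> V' \<Longrightarrow> smooth_at P circle_manifold f e"
    "\<And>e z. e \<in> arrows E \<Longrightarrow> \<pi> e \<in> V' \<Longrightarrow> z \<in> circle \<Longrightarrow> f (act z e) = z * f e"
    by (rule local_trivialisation) blast
  define \<nu> where "\<nu> e = f (act (inverse (f (\<tau> (\<pi> e)))) e)" for e
  define W where "W = {e \<in> arrows E. \<pi> e \<in> V \<inter> V'}"
  have W: "openin (mtop P) W" unfolding W_def by (rule open_preim[OF openin_Int[OF V(1) V'(1)]])
  have e0: "\<iota> p \<in> W" using zx iota_arrow iota_range(2) V(2) V'(2) by (simp add: W_def)
  have \<tau>: "\<tau> \<gamma> \<in> arrows E" if "\<gamma> \<in> V" for \<gamma>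
    using smooth_at_imp_mspace(2)[OF M P V(3)[OF that]] by (simp add: top_P)
  have f_circle: "f e \<in> circle" if "e \<in> arrows E" "\<pi> e \<in> V'" for e
    using smooth_at_imp_mspace(2)[OF P C V'(3)[OF that]] by simp
  have \<nu>: "smooth_at P circle_manifold \<nu> e" if e: "e \<in> W" for e
  proof -
    have e': "e \<in> arrows E" "\<pi> e \<in> V" "\<pi> e \<in> V'" using e by (auto simp: W_def)
    have "\<pi> (\<tau> (\<pi> e)) \<in> V'" using V(4) e' by simp
    then have c: "f (\<tau> (\<pi> e)) \<in> circle" "smooth_at P circle_manifold f (\<tau> (\<pi> e))"
      using \<tau>[OF e'(2)] f_circle V'(3) by auto
    then have c': "inverse (f (\<tau> (\<pi> e))) \<in> circle" by (simp add: norm_inverse)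
    have "smooth_at P P (\<lambda>e. \<tau> (\<pi> e)) e"
      by (rule smooth_at_compose[OF P M P smooth_pi[OF e'(1)] V(3)[OF e'(2)]])
    then have "smooth_at P circle_manifold (\<lambda>e. f (\<tau> (\<pi> e))) e"
      using c(2) by (rule smooth_at_compose[OF P P C])
    then have "smooth_at P circle_manifold (\<lambda>e. inverse (f (\<tau> (\<pi> e)))) e"
      by (rule smooth_inverse[OF P])
    moreover have "smooth_at P P (\<lambda>e. e) e" by (rule smooth_at_id[OF P]) (simp add: top_P e'(1))
    ultimately have "smooth_at P P (\<lambda>e. act (inverse (f (\<tau> (\<pi> e)))) e) e" by (rule smooth_act[OF P])
    moreover have "smooth_at P circle_manifold f (act (inverse (f (\<tau> (\<pi> e)))) e)"
      by (rule V'(3)) (simp_all only: act_arrow[OF c' e'(1)] e'(3))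
    ultimately show ?thesis unfolding \<nu>_def by (rule smooth_at_compose[OF P P C])
  qed
  have "smooth_at P CM\<^sub>0 (\<lambda>e. (\<nu> e, grange G (\<pi> e))) (\<iota> p)"
    using e0 by (intro smooth_at_Pair[OF P C M0] \<nu> smooth_range_pi) (auto simp: W_def)
  moreover have "(\<nu> (\<iota> b), grange G (\<pi> (\<iota> b))) = b"
    if b: "b \<in> mspace CM\<^sub>0" "\<iota> b \<in> W" for b
  proof -
    obtain w y where wy: "b = (w, y)" "w \<in> circle" "y \<in> units G" using b(1) unfolding space by auto
    have pi_b: "\<pi> (\<iota> b) = y" using iota_range(2)[OF wy(2,3)] wy(1) by simp
    then have y: "y \<in> V" "y \<in> V'" using b(2) by (auto simp: W_def)
    have one: "\<iota> (1, y) \<in> arrows E" "\<pi> (\<iota> (1, y)) = y" using iota_arrow iota_unit(2) wy(3) by auto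
    define h where "h = f (\<iota> (1, y))"
    have h: "h \<in> circle" "inverse h \<in> circle" "h \<noteq> 0"
      using f_circle[OF one(1)] one(2) y(2) by (auto simp: h_def norm_inverse)
    have "\<nu> (\<iota> b) = f (act (inverse h) (\<iota> (w, y)))"
      using V(5)[of y] y wy(3) pi_b by (simp add: \<nu>_def h_def wy(1))
    also have "\<dots> = f (act (inverse h * w) (\<iota> (1, y)))"
      using act_iota[OF h(2) wy(2,3)] act_iota[of "inverse h * w" 1 y] h(2) wy(2,3) by (simp add: norm_mult)
    also have "\<dots> = inverse h * w * h"
      using V'(4)[OF one(1), of "inverse h * w"] one(2) y(2) h(2) wy(2) by (simp add: h_def norm_mult)
    also have "\<dots> = w" using h(3) by simp
    finally show ?thesis using pi_b unit_range_source(1)[OF wy(3)] wy(1) by simp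
  qed
  ultimately show ?thesis
    unfolding local_retraction_def using W e0
    by (intro exI[of _ "\<lambda>e. (\<nu> e, grange G (\<pi> e))"] exI[of _ W]) auto
qed

lemma submersion_pi: "submersion P M \<pi>"
proof (rule submersion_if_local_sections[OF P M smooth_map_pi])
  fix e assume "e \<in> mspace P"
  then have e: "e \<in> arrows E" by (simp add: top_P)
  obtain V where V: "openin (gtop G) V" "\<pi> e \<in> V"
    "\<And>e. e \<in> arrows E \<Longrightarrow> \<pi> e \<in> V \<Longrightarrow>
      \<exists>s. smooth_at M P s (\<pi> e) \<and> s (\<pi> e) = e \<and> (\<forall>\<gamma>\<in>V. \<pi> (s \<gamma>) = \<gamma>)"
    by (rule local_trivialisation[OF pi_arrow[OF e]]) blast
  then show "\<exists>s W. smooth_at M P s (\<pi> e) \<and> s (\<pi> e) = e \<and> openin (mtop M) W \<and> \<pi> e \<in> W \<and> (\<forall>q\<in>W. \<pi> (s q) = q)"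
    using V(3)[OF e V(2)] unfolding top_M by blast
qed

text \<open>
  The formula \<open>r(e) = \<iota>(1, r(\<pi>(e)))\<close> exhibits the range map as a composite of the submersions \<open>\<pi>\<close> and \<open>r\<close>
  with the diffeomorphism \<open>y \<mapsto> \<iota>(1, y)\<close> onto the unit space; likewise for the source.
\<close>

lemma submersion_range_source:
  assumes N: "embedded_structure P (units E) N"
  shows "submersion P N (grange E)" "submersion P N (gsource E)"
proof -
  note Ns = embedded_structureD(1)[OF N]
  have "diffeomorphism M\<^sub>0 N (\<lambda>y. \<iota> (1, y))"
    by (rule diffeomorphism_onto_embedded[OF M0 P smooth_unit_map unit_map_retraction])
       (use N in \<open>simp_all add: space_M0 units_E_eq\<close>)
  then have j: "submersion M\<^sub>0 N (\<lambda>y. \<iota> (1, y))" by (rule diffeomorphism_imp_submersion[OF M0 Ns])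
  have "submersion P N (\<lambda>e. \<iota> (1, grange G (\<pi> e)))"
    by (rule submersion_compose[OF P M0 Ns submersion_compose[OF P M M0 submersion_pi sub_r] j])
  then show "submersion P N (grange E)"
    by (rule submersion_cong[OF P, rotated]) (simp add: range_source_E_eq top_P)
  have "submersion P N (\<lambda>e. \<iota> (1, gsource G (\<pi> e)))"
    by (rule submersion_compose[OF P M0 Ns submersion_compose[OF P M M0 submersion_pi sub_s] j])
  then show "submersion P N (gsource E)"
    by (rule submersion_cong[OF P, rotated]) (simp add: range_source_E_eq top_P)
qed

end

theorem proposition4p19:
  fixes G :: "'g groupoid" and M M\<^sub>0 :: "'g manifold"
    and E :: "'e groupoid" and P :: "'e manifold"
    and \<iota> :: "complex \<times> 'g \<Rightarrow> 'e" and \<pi> :: "'e \<Rightarrow> 'g"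
    and I :: "'i set" and U :: "'i \<Rightarrow> 'g set" and \<phi> :: "'i \<Rightarrow> 'g \<Rightarrow> rvec"
    and \<sigma> :: "'i \<Rightarrow> 'g \<Rightarrow> 'e"
  assumes "lie_groupoid G M M\<^sub>0"
    and "topological_twist G E \<iota> \<pi>"
    and "\<forall>\<alpha>\<in>I. (U \<alpha>, \<phi> \<alpha>) \<in> mcharts M" and "(\<Union>\<alpha>\<in>I. U \<alpha>) = arrows G"
    and "\<forall>\<alpha>\<in>I. continuous_section G E \<pi> (U \<alpha>) (\<sigma> \<alpha>)"
    and "cond_S G M M\<^sub>0 E \<iota> I U \<sigma>"
    and "cond_U G M\<^sub>0 \<iota> I U \<sigma>"
    and "mtop P = gtop E"
    and "smooth_principal_circle_bundle P M \<pi> (twist_action E \<iota> \<pi>)"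
    and "\<forall>\<alpha>\<in>I. smooth_section M P \<pi> (U \<alpha>) (\<sigma> \<alpha>)"
  shows
    "(\<forall>x\<in>units G. \<exists>V \<tau>. openin (gtop G) V \<and> x \<in> V \<and> smooth_section M P \<pi> V \<tau> \<and>
        (\<forall>y\<in>V \<inter> units G. \<tau> y = \<iota> (1, y))) \<and>
     embedded_submanifold P (units E) \<and>
     (embedded_submanifold P (preim E \<pi> (units G)) \<and>
      (\<forall>N. embedded_structure P (preim E \<pi> (units G)) N \<longrightarrow>
         diffeomorphism (product_manifold circle_manifold M\<^sub>0) N \<iota>)) \<and>
     ((\<forall>N. embedded_structure P (units E) N \<longrightarrow>
         submersion P N (grange E) \<and> submersion P N (gsource E)) \<and>
      submersion P M \<pi>)"
proof -
  have M: "smooth_structure M" using assms(1) by (simp add: lie_groupoid_def smooth_manifold_imp_structure)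
  interpret smooth_twist G E \<iota> \<pi> M M\<^sub>0 P I U \<sigma>
  proof
    show "algebraic_groupoid G" using assms(1) by (simp add: lie_groupoid_def topological_groupoid_def)
    show "openin (mtop M) (U \<alpha>)" if "\<alpha> \<in> I" for \<alpha>
      using assms(3) that is_chartD(1)[OF smooth_structureD(1)[OF M]] by blast
  qed (use assms in auto)
  have space: "mspace (product_manifold circle_manifold M\<^sub>0) = circle \<times> units G" by (simp add: space_M0)
  have "\<exists>V \<tau>. openin (gtop G) V \<and> x \<in> V \<and> smooth_section M P \<pi> V \<tau> \<and> (\<forall>y\<in>V \<inter> units G. \<tau> y = \<iota> (1, y))"
    if x: "x \<in> units G" for x
  proof -
    obtain V \<tau> where V: "openin (gtop G) V" "x \<in> V" "\<And>\<gamma>. \<gamma> \<in> V \<Longrightarrow> smooth_at M P \<tau> \<gamma>"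
      "\<And>\<gamma>. \<gamma> \<in> V \<Longrightarrow> \<pi> (\<tau> \<gamma>) = \<gamma>" "\<And>y. y \<in> V \<inter> units G \<Longrightarrow> \<tau> y = \<iota> (1, y)"
      by (rule normalised_section[OF x]) blast
    have "smooth_section M P \<pi> V \<tau>" by (simp add: smooth_section_iff[OF V(1)] V(3,4))
    then show ?thesis using V(1,2,5) by (intro exI[of _ V] exI[of _ \<tau>] conjI ballI)
  qed
  moreover have "embedded_submanifold P (units E)"
    using embedded_submanifold_if_local_retractions[OF M0 Pm smooth_unit_map unit_map_retraction]
    by (simp add: space_M0 units_E_eq)
  moreover have "embedded_submanifold P (preim E \<pi> (units G))"
    using embedded_submanifold_if_local_retractions[OF CM0 Pm smooth_iota iota_retraction]
    unfolding space iota_image .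
  moreover have "diffeomorphism (product_manifold circle_manifold M\<^sub>0) N \<iota>"
    if "embedded_structure P (preim E \<pi> (units G)) N" for N
    by (rule diffeomorphism_onto_embedded[OF CM0 P smooth_iota iota_retraction])
       (use that in \<open>simp_all only: space iota_image\<close>)
  ultimately show ?thesis
    by (intro conjI ballI allI impI submersion_range_source submersion_pi)
qed

end
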